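(* Let $(\mathcal C,\mathcal D)$ be a regular inclusion. Then there exist a $C^*$-diagonal $(\mathcal C_1,\mathcal D_1)$ and a regular $*$-monomorphism $\alpha:(\mathcal C,\mathcal D)\to(\mathcal C_1,\mathcal D_1)$ if and only if $\operatorname{Rad}(\mathcal C,\mathcal D)=(0)$.
   Context: All $C^*$-algebras are unital. An inclusion is a pair $(\mathcal C,\mathcal D)$ where $\mathcal C$ is a unital $C^*$-algebra and $\mathcal D\subseteq\mathcal C$ is an abelian $C^*$-subalgebra containing the unit of $\mathcal C$. Its set of normalizers is $\mathcal N(\mathcal C,\mathcal D)=\{v\in\mathcal C: v^*\mathcal Dv\cup v\mathcal Dv^*\subseteq\mathcal D\}$. The inclusion is regular if $\operatorname{span}\mathcal N(\mathcal C,\mathcal D)$ is norm dense in $\mathcal C$, and a MASA inclusion if $\mathcal D$ is a maximal abelian $C^*$-subalgebra of $\mathcal C$. It is an EP inclusion if every pure state of $\mathcal D$ has a unique extension to a state on $\mathcal C$ and no pure state of $\mathcal C$ annihilates $\mathcal D$. It is a Cartan inclusion if it is a regular MASA inclusion and there is a faithful conditional expectation $\mathcal C\to\mathcal D$. It is a $C^*$-diagonal if it is both a Cartan inclusion and an EP inclusion. A $*$-homomorphism $\alpha:\mathcal C\to\mathcal C_1$ is a regular $*$-homomorphism $(\mathcal C,\mathcal D)\to(\mathcal C_1,\mathcal D_1)$ if $\alpha(\mathcal N(\mathcal C,\mathcal D))\subseteq\mathcal N(\mathcal C_1,\mathcal D_1)$; it is a regular $*$-monomorphism if it is also injective. A state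 $\rho$ on $\mathcal C$ is $\mathcal D$-compatible if $|\rho(v)|^2\in\{0,\rho(v^*v)\}$ for every $v\in\mathcal N(\mathcal C,\mathcal D)$; $\mathfrak S(\mathcal C,\mathcal D)$ denotes the set of $\mathcal D$-compatible states. Writing $\pi_\rho$ for the GNS representation of $\rho$, the $\mathcal D$-radical is $$\operatorname{Rad}(\mathcal C,\mathcal D)=\{x\in\mathcal C: \|\pi_\rho(x)\|=0\text{ for all }\rho\in\mathfrak S(\mathcal C,\mathcal D)\}$$ if $\mathfrak S(\mathcal C,\mathcal D)\neq\emptyset$, and $\operatorname{Rad}(\mathcal C,\mathcal D)=\mathcal C$ otherwise. *)

theory Defs
  imports "HOL-Algebra.Module" "HOL-Analysis.Analysis"
begin

section \<open>Unital C*-algebras\<close>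

text \<open>Algebras are carrier-based, in the style of HOL-Algebra, so that algebras can be quantified
  inside a formula and a subalgebra \<open>D\<close> of \<open>A\<close> is a subset of the carrier, which becomes an algebra
  in its own right as \<open>A\<lparr>carrier := D\<rparr>\<close>.\<close>

definition complex_ring :: "complex ring" where
  "complex_ring = \<lparr>carrier = UNIV, monoid.mult = (*), one = 1, zero = 0, add = (+)\<rparr>"

record 'a cstar = "(complex, 'a) module" +
  star :: "'a \<Rightarrow> 'a" (\<open>(_\<^sup>\<star>\<index>)\<close> [1000] 999)
  nrm :: "'a \<Rightarrow> real"

text \<open>The value outside the carrier is irrelevant, but the locale \<open>Metric_space\<close> requires
  non-negativity and symmetry there as well.\<close>

definition cdist :: "'a cstar \<Rightarrow> 'a \<Rightarrow> 'a \<Rightarrow> real" where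
  "cdist A x y = (if x \<in> carrier A \<and> y \<in> carrier A then nrm A (x \<ominus>\<^bsub>A\<^esub> y) else 0)"

abbreviation ctopology :: "'a cstar \<Rightarrow> 'a topology" where
  "ctopology A \<equiv> Metric_space.mtopology (carrier A) (cdist A)"

locale normed_star_algebra = ring A + scalar: Module.module complex_ring A for A :: "'a cstar" (structure) +
  assumes smult_mult_left:
      "\<lbrakk>x \<in> carrier A; y \<in> carrier A\<rbrakk> \<Longrightarrow> (a \<odot> x) \<otimes> y = a \<odot> (x \<otimes> y)"
    and smult_mult_right:
      "\<lbrakk>x \<in> carrier A; y \<in> carrier A\<rbrakk> \<Longrightarrow> x \<otimes> (a \<odot> y) = a \<odot> (x \<otimes> y)"
    and star_closed [simp, intro]: "x \<in> carrier A \<Longrightarrow> x\<^sup>\<star> \<in> carrier A"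
    and star_star [simp]: "x \<in> carrier A \<Longrightarrow> (x\<^sup>\<star>)\<^sup>\<star> = x"
    and star_add: "\<lbrakk>x \<in> carrier A; y \<in> carrier A\<rbrakk> \<Longrightarrow> (x \<oplus> y)\<^sup>\<star> = x\<^sup>\<star> \<oplus> y\<^sup>\<star>"
    and star_smult: "x \<in> carrier A \<Longrightarrow> (a \<odot> x)\<^sup>\<star> = cnj a \<odot> x\<^sup>\<star>"
    and star_mult: "\<lbrakk>x \<in> carrier A; y \<in> carrier A\<rbrakk> \<Longrightarrow> (x \<otimes> y)\<^sup>\<star> = y\<^sup>\<star> \<otimes> x\<^sup>\<star>"
    and nrm_nonneg: "x \<in> carrier A \<Longrightarrow> 0 \<le> nrm A x"
    and nrm_eq_0_iff: "x \<in> carrier A \<Longrightarrow> nrm A x = 0 \<longleftrightarrow> x = \<zero>"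
    and nrm_triangle: "\<lbrakk>x \<in> carrier A; y \<in> carrier A\<rbrakk> \<Longrightarrow> nrm A (x \<oplus> y) \<le> nrm A x + nrm A y"
    and nrm_smult: "x \<in> carrier A \<Longrightarrow> nrm A (a \<odot> x) = cmod a * nrm A x"
    and nrm_mult: "\<lbrakk>x \<in> carrier A; y \<in> carrier A\<rbrakk> \<Longrightarrow> nrm A (x \<otimes> y) \<le> nrm A x * nrm A y"
begin

lemma nrm_uminus: "x \<in> carrier A \<Longrightarrow> nrm A (\<ominus> x) = nrm A x"
proof -
  assume x: "x \<in> carrier A"
  have "x \<oplus> (-1) \<odot> x = (1 \<odot> x) \<oplus> ((-1) \<odot> x)"
    using scalar.smult_one[OF x] by (simp add: complex_ring_def)
  also have "\<dots> = (0::complex) \<odot> x"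
    using scalar.smult_l_distr[of 1 "-1" x] x by (simp add: complex_ring_def)
  finally have "x \<oplus> (-1) \<odot> x = \<zero>"
    using nrm_smult[OF x, of 0] nrm_eq_0_iff[of "0 \<odot> x"] scalar.smult_closed[of 0 x] x
    by (simp add: complex_ring_def)
  moreover have c: "(-1) \<odot> x \<in> carrier A"
    using scalar.smult_closed[of "-1" x] x by (simp add: complex_ring_def)
  ultimately have "\<ominus> x = (-1) \<odot> x"
    using x a_comm[OF x c] by (metis add.inv_equality)
  then show ?thesis
    by (simp add: nrm_smult[OF x])
qed

lemma Metric_space_cdist: "Metric_space (carrier A) (cdist A)"
proof
  fix x y z
  show "0 \<le> cdist A x y"
    by (simp add: cdist_def nrm_nonneg)
  show "cdist A x y = cdist A y x"
  proof (cases "x \<in> carrier A \<and> y \<in> carrier A")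
    case True
    then have "y \<ominus> x = \<ominus> (x \<ominus> y)"
      by algebra
    then show ?thesis
      using True nrm_uminus[of "x \<ominus> y"] by (simp add: cdist_def)
  qed (auto simp: cdist_def)
  assume x: "x \<in> carrier A" and y: "y \<in> carrier A"
  show "cdist A x y = 0 \<longleftrightarrow> x = y"
    using x y by (simp add: cdist_def nrm_eq_0_iff add.inv_solve_right' a_minus_def)
  assume z: "z \<in> carrier A"
  have "x \<ominus> z = (x \<ominus> y) \<oplus> (y \<ominus> z)"
    using x y z by algebra
  then show "cdist A x z \<le> cdist A x y + cdist A y z"
    using x y z nrm_triangle[of "x \<ominus> y" "y \<ominus> z"] by (simp add: cdist_def)
qed

end

locale cstar_algebra = normed_star_algebra A for A :: "'a cstar" (structure) +
  assumes cstar_identity: "x \<in> carrier A \<Longrightarrow> nrm A (x\<^sup>\<star> \<otimes> x) = (nrm A x)\<^sup>2"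
    and complete: "Metric_space.mcomplete (carrier A) (cdist A)"

definition cstar_subalgebra :: "'a cstar \<Rightarrow> 'a set \<Rightarrow> bool" where
  "cstar_subalgebra A D \<longleftrightarrow>
     closedin (ctopology A) D \<and> \<zero>\<^bsub>A\<^esub> \<in> D \<and>
     (\<forall>x\<in>D. \<forall>y\<in>D. x \<oplus>\<^bsub>A\<^esub> y \<in> D \<and> x \<otimes>\<^bsub>A\<^esub> y \<in> D) \<and>
     (\<forall>x\<in>D. x\<^sup>\<star>\<^bsub>A\<^esub> \<in> D \<and> (\<forall>a. a \<odot>\<^bsub>A\<^esub> x \<in> D))"

definition abelian_cstar_subalgebra :: "'a cstar \<Rightarrow> 'a set \<Rightarrow> bool" where
  "abelian_cstar_subalgebra A D \<longleftrightarrow>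
     cstar_subalgebra A D \<and> (\<forall>x\<in>D. \<forall>y\<in>D. x \<otimes>\<^bsub>A\<^esub> y = y \<otimes>\<^bsub>A\<^esub> x)"

definition cspan :: "'a cstar \<Rightarrow> 'a set \<Rightarrow> 'a set" where
  "cspan A S = {\<Oplus>\<^bsub>A\<^esub>v\<in>F. c v \<odot>\<^bsub>A\<^esub> v | c F. finite F \<and> F \<subseteq> S}"

definition star_hom :: "'a cstar \<Rightarrow> 'b cstar \<Rightarrow> ('a \<Rightarrow> 'b) \<Rightarrow> bool" where
  "star_hom A B \<alpha> \<longleftrightarrow>
     \<alpha> \<in> carrier A \<rightarrow> carrier B \<and>
     (\<forall>x\<in>carrier A. \<forall>y\<in>carrier A. \<alpha> (x \<oplus>\<^bsub>A\<^esub> y) = \<alpha> x \<oplus>\<^bsub>B\<^esub> \<alpha> y \<and>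
                                 \<alpha> (x \<otimes>\<^bsub>A\<^esub> y) = \<alpha> x \<otimes>\<^bsub>B\<^esub> \<alpha> y) \<and>
     (\<forall>x\<in>carrier A. \<alpha> (x\<^sup>\<star>\<^bsub>A\<^esub>) = (\<alpha> x)\<^sup>\<star>\<^bsub>B\<^esub> \<and> (\<forall>a. \<alpha> (a \<odot>\<^bsub>A\<^esub> x) = a \<odot>\<^bsub>B\<^esub> \<alpha> x))"


section \<open>States and the GNS representation\<close>

text \<open>Functionals are \<open>undefined\<close> outside the carrier (\<open>extensional\<close>), so that equality of
  functions is equality of functionals.\<close>

definition state :: "'a cstar \<Rightarrow> ('a \<Rightarrow> complex) \<Rightarrow> bool" where
  "state A \<rho> \<longleftrightarrow>
     \<rho> \<in> extensional (carrier A) \<and>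
     (\<forall>x\<in>carrier A. \<forall>y\<in>carrier A. \<rho> (x \<oplus>\<^bsub>A\<^esub> y) = \<rho> x + \<rho> y) \<and>
     (\<forall>a. \<forall>x\<in>carrier A. \<rho> (a \<odot>\<^bsub>A\<^esub> x) = a * \<rho> x) \<and>
     (\<forall>x\<in>carrier A. \<rho> (x\<^sup>\<star>\<^bsub>A\<^esub> \<otimes>\<^bsub>A\<^esub> x) \<in> \<real>\<^sub>\<ge>\<^sub>0) \<and>
     \<rho> \<one>\<^bsub>A\<^esub> = 1"

definition pure_state :: "'a cstar \<Rightarrow> ('a \<Rightarrow> complex) \<Rightarrow> bool" where
  "pure_state A \<rho> \<longleftrightarrow>
     state A \<rho> \<and>
     (\<forall>\<sigma> \<tau>. \<forall>t::real. state A \<sigma> \<and> state A \<tau> \<and> 0 < t \<and> t < 1 \<and>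
        (\<forall>x\<in>carrier A. \<rho> x = of_real t * \<sigma> x + of_real (1 - t) * \<tau> x) \<longrightarrow> \<sigma> = \<rho> \<and> \<tau> = \<rho>)"

text \<open>The GNS Hilbert space of \<open>\<rho>\<close> is the completion of the quotient of \<open>A\<close> by the left kernel
  \<open>{x. \<rho> (x\<^sup>\<star> x) = 0}\<close> with inner product \<open>\<langle>x, y\<rangle> = \<rho> (y\<^sup>\<star> x)\<close>.  Quotient and completion are formed
  in one step: its vectors are the classes of sequences in \<open>A\<close> that are Cauchy for the seminorm
  \<open>\<rho> (x\<^sup>\<star> x)\<^sup>1\<^sup>/\<^sup>2\<close>, modulo sequences that are null for it.  The vector \<open>y + ker\<close> is the class of the
  constant sequence \<open>y\<close>.\<close>

definition gns_seminorm :: "'a cstar \<Rightarrow> ('a \<Rightarrow> complex) \<Rightarrow> 'a \<Rightarrow> real" where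
  "gns_seminorm A \<rho> x = sqrt (Re (\<rho> (x\<^sup>\<star>\<^bsub>A\<^esub> \<otimes>\<^bsub>A\<^esub> x)))"

definition gns_Cauchy :: "'a cstar \<Rightarrow> ('a \<Rightarrow> complex) \<Rightarrow> (nat \<Rightarrow> 'a) set" where
  "gns_Cauchy A \<rho> = {y. range y \<subseteq> carrier A \<and>
     (\<forall>e>0. \<exists>N. \<forall>m\<ge>N. \<forall>n\<ge>N. gns_seminorm A \<rho> (y m \<ominus>\<^bsub>A\<^esub> y n) < e)}"

definition gns_rel :: "'a cstar \<Rightarrow> ('a \<Rightarrow> complex) \<Rightarrow> ((nat \<Rightarrow> 'a) \<times> (nat \<Rightarrow> 'a)) set" where
  "gns_rel A \<rho> = {(y, z). y \<in> gns_Cauchy A \<rho> \<and> z \<in> gns_Cauchy A \<rho> \<and>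
     (\<lambda>n. gns_seminorm A \<rho> (y n \<ominus>\<^bsub>A\<^esub> z n)) \<longlonglongrightarrow> 0}"

definition gns_space :: "'a cstar \<Rightarrow> ('a \<Rightarrow> complex) \<Rightarrow> (nat \<Rightarrow> 'a) set set" where
  "gns_space A \<rho> = gns_Cauchy A \<rho> // gns_rel A \<rho>"

definition gns_inner ::
  "'a cstar \<Rightarrow> ('a \<Rightarrow> complex) \<Rightarrow> (nat \<Rightarrow> 'a) set \<Rightarrow> (nat \<Rightarrow> 'a) set \<Rightarrow> complex" where
  "gns_inner A \<rho> \<xi> \<eta> =
     (THE c. \<forall>y\<in>\<xi>. \<forall>z\<in>\<eta>. (\<lambda>n. \<rho> ((z n)\<^sup>\<star>\<^bsub>A\<^esub> \<otimes>\<^bsub>A\<^esub> y n)) \<longlonglongrightarrow> c)"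

definition gns_norm :: "'a cstar \<Rightarrow> ('a \<Rightarrow> complex) \<Rightarrow> (nat \<Rightarrow> 'a) set \<Rightarrow> real" where
  "gns_norm A \<rho> \<xi> = sqrt (Re (gns_inner A \<rho> \<xi> \<xi>))"

text \<open>\<open>\<pi>\<^sub>\<rho>(x)\<close>, the operator sending the class of \<open>(y\<^sub>n)\<close> to the class of \<open>(x y\<^sub>n)\<close>, that is, the
  continuous extension of \<open>y + ker \<mapsto> x y + ker\<close>.\<close>

definition gns_rep ::
  "'a cstar \<Rightarrow> ('a \<Rightarrow> complex) \<Rightarrow> 'a \<Rightarrow> (nat \<Rightarrow> 'a) set \<Rightarrow> (nat \<Rightarrow> 'a) set" where
  "gns_rep A \<rho> x \<xi> = gns_rel A \<rho> `` ((\<lambda>y n. x \<otimes>\<^bsub>A\<^esub> y n) ` \<xi>)"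

definition gns_opnorm :: "'a cstar \<Rightarrow> ('a \<Rightarrow> complex) \<Rightarrow> 'a \<Rightarrow> real" where
  "gns_opnorm A \<rho> x =
     (SUP \<xi>\<in>{\<xi> \<in> gns_space A \<rho>. gns_norm A \<rho> \<xi> \<le> 1}. gns_norm A \<rho> (gns_rep A \<rho> x \<xi>))"


section \<open>Inclusions\<close>

definition cstar_inclusion :: "'a cstar \<Rightarrow> 'a set \<Rightarrow> bool" where
  "cstar_inclusion C D \<longleftrightarrow>
     cstar_algebra C \<and> abelian_cstar_subalgebra C D \<and> \<one>\<^bsub>C\<^esub> \<in> D"

definition normalizers :: "'a cstar \<Rightarrow> 'a set \<Rightarrow> 'a set" where
  "normalizers C D = {v \<in> carrier C.
     \<forall>d\<in>D. v\<^sup>\<star>\<^bsub>C\<^esub> \<otimes>\<^bsub>C\<^esub> d \<otimes>\<^bsub>C\<^esub> v \<in> D \<and> v \<otimes>\<^bsub>C\<^esub> d \<otimes>\<^bsub>C\<^esub> v\<^sup>\<star>\<^bsub>C\<^esub> \<in> D}"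

definition regular_inclusion :: "'a cstar \<Rightarrow> 'a set \<Rightarrow> bool" where
  "regular_inclusion C D \<longleftrightarrow>
     cstar_inclusion C D \<and> ctopology C closure_of (cspan C (normalizers C D)) = carrier C"

definition MASA_inclusion :: "'a cstar \<Rightarrow> 'a set \<Rightarrow> bool" where
  "MASA_inclusion C D \<longleftrightarrow>
     cstar_inclusion C D \<and> (\<forall>B. abelian_cstar_subalgebra C B \<and> D \<subseteq> B \<longrightarrow> B = D)"

definition EP_inclusion :: "'a cstar \<Rightarrow> 'a set \<Rightarrow> bool" where
  "EP_inclusion C D \<longleftrightarrow>
     cstar_inclusion C D \<and>
     (\<forall>\<sigma>. pure_state (C\<lparr>carrier := D\<rparr>) \<sigma> \<longrightarrow> (\<exists>!\<rho>. state C \<rho> \<and> (\<forall>d\<in>D. \<rho> d = \<sigma> d))) \<and>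
     (\<forall>\<rho>. pure_state C \<rho> \<longrightarrow> \<not> (\<forall>d\<in>D. \<rho> d = 0))"

text \<open>The range of a conditional expectation is \<open>D\<close>; positive elements of \<open>D\<close> are those of the form
  \<open>d\<^sup>\<star> d\<close> with \<open>d \<in> D\<close>.  Complete positivity follows from positivity and the bimodule property.\<close>

definition conditional_expectation :: "'a cstar \<Rightarrow> 'a set \<Rightarrow> ('a \<Rightarrow> 'a) \<Rightarrow> bool" where
  "conditional_expectation C D E \<longleftrightarrow>
     E \<in> carrier C \<rightarrow> D \<and>
     (\<forall>x\<in>carrier C. \<forall>y\<in>carrier C. E (x \<oplus>\<^bsub>C\<^esub> y) = E x \<oplus>\<^bsub>C\<^esub> E y) \<and>
     (\<forall>a. \<forall>x\<in>carrier C. E (a \<odot>\<^bsub>C\<^esub> x) = a \<odot>\<^bsub>C\<^esub> E x) \<and>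
     (\<forall>d\<in>D. E d = d) \<and>
     (\<forall>d\<in>D. \<forall>x\<in>carrier C. E (d \<otimes>\<^bsub>C\<^esub> x) = d \<otimes>\<^bsub>C\<^esub> E x \<and> E (x \<otimes>\<^bsub>C\<^esub> d) = E x \<otimes>\<^bsub>C\<^esub> d) \<and>
     (\<forall>x\<in>carrier C. nrm C (E x) \<le> nrm C x) \<and>
     (\<forall>x\<in>carrier C. \<exists>d\<in>D. E (x\<^sup>\<star>\<^bsub>C\<^esub> \<otimes>\<^bsub>C\<^esub> x) = d\<^sup>\<star>\<^bsub>C\<^esub> \<otimes>\<^bsub>C\<^esub> d)"

definition faithful_expectation :: "'a cstar \<Rightarrow> 'a set \<Rightarrow> ('a \<Rightarrow> 'a) \<Rightarrow> bool" where
  "faithful_expectation C D E \<longleftrightarrow>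
     conditional_expectation C D E \<and>
     (\<forall>x\<in>carrier C. E (x\<^sup>\<star>\<^bsub>C\<^esub> \<otimes>\<^bsub>C\<^esub> x) = \<zero>\<^bsub>C\<^esub> \<longrightarrow> x = \<zero>\<^bsub>C\<^esub>)"

definition Cartan_inclusion :: "'a cstar \<Rightarrow> 'a set \<Rightarrow> bool" where
  "Cartan_inclusion C D \<longleftrightarrow>
     regular_inclusion C D \<and> MASA_inclusion C D \<and> (\<exists>E. faithful_expectation C D E)"

definition cstar_diagonal :: "'a cstar \<Rightarrow> 'a set \<Rightarrow> bool" where
  "cstar_diagonal C D \<longleftrightarrow> Cartan_inclusion C D \<and> EP_inclusion C D"

definition regular_star_hom ::
  "'a cstar \<Rightarrow> 'a set \<Rightarrow> 'b cstar \<Rightarrow> 'b set \<Rightarrow> ('a \<Rightarrow> 'b) \<Rightarrow> bool" where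
  "regular_star_hom C D C1 D1 \<alpha> \<longleftrightarrow>
     star_hom C C1 \<alpha> \<and> \<alpha> ` normalizers C D \<subseteq> normalizers C1 D1"

definition regular_star_mono ::
  "'a cstar \<Rightarrow> 'a set \<Rightarrow> 'b cstar \<Rightarrow> 'b set \<Rightarrow> ('a \<Rightarrow> 'b) \<Rightarrow> bool" where
  "regular_star_mono C D C1 D1 \<alpha> \<longleftrightarrow> regular_star_hom C D C1 D1 \<alpha> \<and> inj_on \<alpha> (carrier C)"

definition compatible_states :: "'a cstar \<Rightarrow> 'a set \<Rightarrow> ('a \<Rightarrow> complex) set" where
  "compatible_states C D = {\<rho>. state C \<rho> \<and>
     (\<forall>v\<in>normalizers C D. of_real ((cmod (\<rho> v))\<^sup>2) \<in> {0, \<rho> (v\<^sup>\<star>\<^bsub>C\<^esub> \<otimes>\<^bsub>C\<^esub> v)})}"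

definition Rad :: "'a cstar \<Rightarrow> 'a set \<Rightarrow> 'a set" where
  "Rad C D =
     (if compatible_states C D \<noteq> {}
      then {x \<in> carrier C. \<forall>\<rho>\<in>compatible_states C D. gns_opnorm C \<rho> x = 0}
      else carrier C)"

text \<open>The type of maps on \<open>'a \<times> 'a\<close>-indexed families of complex numbers.  It has room for the
  algebra of bounded operators on \<open>\<ell>\<^sup>2('a \<times> 'a)\<close> and serves as a universe in which to look for
  C*-algebras containing a given one with underlying type \<open>'a\<close>; HOL formulas cannot quantify over
  types.\<close>

type_synonym 'a universe = "('a \<times> 'a \<Rightarrow> complex) \<Rightarrow> ('a \<times> 'a \<Rightarrow> complex)"

end

theory Submission
  imports Defs
begin

text \<open>
  Suppose first that \<open>C\<close> embeds in a C*-diagonal. Every character \<open>\<sigma>\<close> of its diagonal has the unique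
  extension \<open>\<sigma> \<circ> E\<close>, and uniqueness forces the compatibility dichotomy on each normalizer \<open>v\<close>: either
  \<open>v\<close> moves \<open>\<sigma>\<close>, and then the extension vanishes at \<open>v\<close>, or the cyclic GNS vector is an eigenvector
  of \<open>v\<close>. Characters separate points and \<open>E\<close> is faithful, so the restrictions to \<open>C\<close> of these
  compatible states have no common kernel.

  For the converse, let \<open>\<rho>\<close> be a compatible state. The vectors \<open>v \<xi>\<^sub>\<rho>\<close> with \<open>v\<close> a normalizer are
  pairwise orthogonal or parallel, so they define an orthonormal basis of the GNS space in which every
  normalizer has a monomial matrix: at most one nonzero entry in each row and column. Choosing for every
  \<open>x \<noteq> 0\<close> a compatible \<open>\<rho>\<close> with \<open>\<pi>\<^sub>\<rho>(x) \<noteq> 0\<close> gives a faithful representation on \<open>\<ell>\<^sup>2('a \<times> 'a)\<close> that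
  maps normalizers to monomial operators. For every index set \<open>I\<close>, the closed span of all monomial
  operators on \<open>\<ell>\<^sup>2(I)\<close> is a C*-diagonal with diagonal \<open>\<ell>\<^sup>\<infinity>(I)\<close>. A state whose restriction to
  \<open>\<ell>\<^sup>\<infinity>(I)\<close> is pure vanishes on a monomial operator \<open>T\<close> with zero diagonal, since \<open>I\<close> is the union of
  three sets \<open>B\<close> with \<open>1\<^sub>B T 1\<^sub>B = 0\<close>.
\<close>

section \<open>Normed star-algebras\<close>

text \<open>Positivity is handled without spectra: square roots come from the fixed point of a
  contraction, the positive cone of an abelian algebra is the set of sums of squares, and a
  character is read off from a maximal preordering that contains this cone and avoids
  \<open>\<ominus> \<one>\<close>. The target has to live on one fixed type. This is possible
  because the basis vectors of each GNS space are given by normalizers, hence by elements of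
  \<open>C\<close>: in a pair from \<open>'a \<times> 'a\<close> the first coordinate names the
  state and the second the vector. Pairs outside this basis carry the zero operator, so the
  embedding is in general not unital, and the forward direction has to cope with maps
  \<open>\<alpha>\<close> that move the unit to a proper projection. The GNS completion enters only
  through a criterion for a vanishing operator norm. The representation itself is written down as a
  matrix of normalized numbers \<open>\<rho> (w\<^sup>\<star> \<otimes> c \<otimes> v)\<close>;
  multiplicativity is checked on normalizers, where a matrix product has a single term, and extended
  by density.\<close>

context normed_star_algebra
begin

lemma carrier_complex_ring [simp]: "a \<in> carrier complex_ring"
  by (simp add: complex_ring_def)

lemma smult_closed [simp, intro]: "x \<in> carrier A \<Longrightarrow> a \<odot> x \<in> carrier A"
  by (rule scalar.smult_closed) simp_all

lemma smult_add_left: "x \<in> carrier A \<Longrightarrow> (a + b) \<odot> x = a \<odot> x \<oplus> b \<odot> x"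
  using scalar.smult_l_distr[of a b x] by (simp add: complex_ring_def)

lemma smult_add_right: "\<lbrakk>x \<in> carrier A; y \<in> carrier A\<rbrakk> \<Longrightarrow> a \<odot> (x \<oplus> y) = a \<odot> x \<oplus> a \<odot> y"
  using scalar.smult_r_distr[of a x y] by (simp add: complex_ring_def)

lemma smult_smult [simp]: "x \<in> carrier A \<Longrightarrow> a \<odot> (b \<odot> x) = (a * b) \<odot> x"
  using scalar.smult_assoc1[of a b x] by (simp add: complex_ring_def)

lemma smult_1 [simp]: "x \<in> carrier A \<Longrightarrow> 1 \<odot> x = x"
  using scalar.smult_one[of x] by (simp add: complex_ring_def)

lemma smult_0_left [simp]: "x \<in> carrier A \<Longrightarrow> 0 \<odot> x = \<zero>"
  using scalar.smult_l_null[of x] by (simp add: complex_ring_def)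

lemma smult_0_right [simp]: "a \<odot> \<zero> = \<zero>"
  using scalar.smult_r_null[of a] by simp

lemma uminus_eq_smult: "x \<in> carrier A \<Longrightarrow> \<ominus> x = (-1) \<odot> x"
  by (metis add.inv_equality add.m_comm carrier_complex_ring smult_1 smult_0_left smult_add_left smult_closed
      add.right_inverse)

lemma minus_eq_smult: "\<lbrakk>x \<in> carrier A; y \<in> carrier A\<rbrakk> \<Longrightarrow> x \<ominus> y = x \<oplus> (-1) \<odot> y"
  by (simp add: a_minus_def uminus_eq_smult)

lemma nrm_minus_commute: "\<lbrakk>x \<in> carrier A; y \<in> carrier A\<rbrakk> \<Longrightarrow> nrm A (x \<ominus> y) = nrm A (y \<ominus> x)"
  using Metric_space.commute[OF Metric_space_cdist, of x y] by (simp add: cdist_def)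

lemma nrm_zero [simp]: "nrm A \<zero> = 0"
  by (simp add: nrm_eq_0_iff)

lemma nrm_minus_le: "\<lbrakk>x \<in> carrier A; y \<in> carrier A\<rbrakk> \<Longrightarrow> nrm A (x \<ominus> y) \<le> nrm A x + nrm A y"
  using nrm_triangle[of x "\<ominus> y"] by (simp add: a_minus_def nrm_uminus)

lemma star_zero [simp]: "\<zero>\<^sup>\<star> = \<zero>"
  using star_smult[of \<zero> 0] by simp

lemma star_one [simp]: "\<one>\<^sup>\<star> = \<one>"
  by (metis one_closed r_one star_closed star_mult star_star)

lemma star_uminus: "x \<in> carrier A \<Longrightarrow> (\<ominus> x)\<^sup>\<star> = \<ominus> (x\<^sup>\<star>)"
  by (simp add: uminus_eq_smult star_smult)

lemma star_minus: "\<lbrakk>x \<in> carrier A; y \<in> carrier A\<rbrakk> \<Longrightarrow> (x \<ominus> y)\<^sup>\<star> = x\<^sup>\<star> \<ominus> y\<^sup>\<star>"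
  by (simp add: a_minus_def star_add star_uminus)

lemma decompose:
  assumes "x \<in> carrier A"
  shows "\<exists>h k. h \<in> carrier A \<and> h\<^sup>\<star> = h \<and> k \<in> carrier A \<and> k\<^sup>\<star> = k \<and> x = h \<oplus> \<i> \<odot> k"
proof (intro exI conjI)
  let ?h = "(1/2) \<odot> (x \<oplus> x\<^sup>\<star>)" and ?k = "(- \<i> / 2) \<odot> (x \<oplus> (- 1) \<odot> x\<^sup>\<star>)"
  show "?h \<in> carrier A" "?k \<in> carrier A" using assms by auto
  show "?h\<^sup>\<star> = ?h" using assms by (simp add: star_smult star_add a_comm)
  show "?k\<^sup>\<star> = ?k" using assms by (simp add: star_smult star_add smult_add_right a_comm)
  have "?h \<oplus> \<i> \<odot> ?k = ((1/2) \<odot> x \<oplus> (1/2) \<odot> x) \<oplus> ((1/2) \<odot> x\<^sup>\<star> \<oplus> (- 1/2) \<odot> x\<^sup>\<star>)"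
    using assms by (simp add: smult_add_right a_ac)
  also have "\<dots> = x" using assms by (simp flip: smult_add_left)
  finally show "x = ?h \<oplus> \<i> \<odot> ?k" by simp
qed

lemma in_closure_of_iff:
  assumes "S \<subseteq> carrier A"
  shows "x \<in> ctopology A closure_of S \<longleftrightarrow> x \<in> carrier A \<and> (\<forall>e>0. \<exists>y\<in>S. nrm A (x \<ominus> y) < e)"
  using assms unfolding Metric_space.metric_closure_of[OF Metric_space_cdist]
  by (auto simp: Metric_space.in_mball[OF Metric_space_cdist] cdist_def) (metis subsetD)+

lemma closedin_iff:
  "closedin (ctopology A) S \<longleftrightarrow>
     S \<subseteq> carrier A \<and> (\<forall>x\<in>carrier A. (\<forall>e>0. \<exists>y\<in>S. nrm A (x \<ominus> y) < e) \<longrightarrow> x \<in> S)"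
proof (cases "S \<subseteq> carrier A")
  case True
  have "closedin (ctopology A) S \<longleftrightarrow> ctopology A closure_of S \<subseteq> S"
    using True closure_of_subset_eq[of S "ctopology A"]
    by (simp add: Metric_space.topspace_mtopology[OF Metric_space_cdist])
  also have "\<dots> \<longleftrightarrow> (\<forall>x\<in>carrier A. (\<forall>e>0. \<exists>y\<in>S. nrm A (x \<ominus> y) < e) \<longrightarrow> x \<in> S)"
    using in_closure_of_iff[OF True] by blast
  finally show ?thesis using True by simp
next
  case False
  then show ?thesis
    using closedin_subset[of "ctopology A" S]
    by (auto simp: Metric_space.topspace_mtopology[OF Metric_space_cdist])
qed

lemma cspan_subset: "S \<subseteq> carrier A \<Longrightarrow> cspan A S \<subseteq> carrier A"
  unfolding cspan_def by (auto intro!: finsum_closed)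

lemma cspan_induct [consumes 2, case_names zero add]:
  assumes "x \<in> cspan A S" "S \<subseteq> carrier A"
    and "P \<zero>"
    and "\<And>a v y. v \<in> S \<Longrightarrow> y \<in> carrier A \<Longrightarrow> P y \<Longrightarrow> P (a \<odot> v \<oplus> y)"
  shows "P x"
proof -
  obtain c F where F: "finite F" "F \<subseteq> S" and x: "x = (\<Oplus>v\<in>F. c v \<odot> v)"
    using assms(1) unfolding cspan_def by blast
  have "P (\<Oplus>v\<in>F. c v \<odot> v)" using F
  proof (induction F)
    case empty then show ?case using assms(3) by simp
  next
    case (insert v F)
    have "(\<Oplus>v\<in>insert v F. c v \<odot> v) = c v \<odot> v \<oplus> (\<Oplus>v\<in>F. c v \<odot> v)"
      using insert assms(2) by (intro finsum_insert) auto
    moreover have "(\<Oplus>v\<in>F. c v \<odot> v) \<in> carrier A"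
      using insert assms(2) by (intro finsum_closed) auto
    ultimately show ?case using insert assms(4) by auto
  qed
  then show ?thesis by (simp add: x)
qed

text \<open>\<open>cspan\<close> sums over a finite set with one coefficient per vector, so a vector
  that already occurs needs its coefficients merged instead of being appended.\<close>

lemma cspan_smult_add:
  assumes "S \<subseteq> carrier A" "v \<in> S" "y \<in> cspan A S"
  shows "a \<odot> v \<oplus> y \<in> cspan A S"
proof -
  obtain c F where F: "finite F" "F \<subseteq> S" and y: "y = (\<Oplus>v\<in>F. c v \<odot> v)"
    using assms(3) unfolding cspan_def by blast
  have FA: "F \<subseteq> carrier A" "v \<in> carrier A" using F assms by auto
  \<comment> \<open>Coefficients are 0 off \<open>F\<close>, which makes
    \<open>insert v (F - {v})\<close> a valid index set whether or not \<open>v\<close> lies in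
    \<open>F\<close>.\<close>
  define c0 where "c0 = (\<lambda>w. if w \<in> F then c w else 0)"
  define c' where "c' = c0(v := c0 v + a)"
  have eq: "(\<Oplus>w\<in>F - {v}. c0 w \<odot> w) = (\<Oplus>w\<in>F - {v}. c' w \<odot> w)"
    by (rule finsum_cong') (use FA in \<open>auto simp: c'_def\<close>)
  have "y = (\<Oplus>w\<in>F. c0 w \<odot> w)"
    unfolding y by (rule finsum_cong') (use FA in \<open>auto simp: c0_def\<close>)
  also have "\<dots> = (\<Oplus>w\<in>insert v (F - {v}). c0 w \<odot> w)"
  proof (cases "v \<in> F")
    case True then show ?thesis by (simp add: insert_absorb)
  next
    case False
    then have "(\<Oplus>w\<in>insert v F. c0 w \<odot> w) = c0 v \<odot> v \<oplus> (\<Oplus>w\<in>F. c0 w \<odot> w)"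
      using F FA by (intro finsum_insert) auto
    also have "\<dots> = (\<Oplus>w\<in>F. c0 w \<odot> w)"
      using False FA by (auto simp: c0_def intro!: l_zero finsum_closed)
    finally show ?thesis using False by simp
  qed
  also have "\<dots> = c0 v \<odot> v \<oplus> (\<Oplus>w\<in>F - {v}. c0 w \<odot> w)"
    using F FA by (intro finsum_insert) auto
  finally have "a \<odot> v \<oplus> y = a \<odot> v \<oplus> (c0 v \<odot> v \<oplus> (\<Oplus>w\<in>F - {v}. c' w \<odot> w))"
    by (simp add: eq)
  also have "\<dots> = c' v \<odot> v \<oplus> (\<Oplus>w\<in>F - {v}. c' w \<odot> w)"
  proof -
    have "(\<Oplus>w\<in>F - {v}. c' w \<odot> w) \<in> carrier A" using FA by (auto intro!: finsum_closed)
    then show ?thesis using FA by (simp add: c'_def smult_add_left a_ac)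
  qed
  also have "\<dots> = (\<Oplus>w\<in>insert v (F - {v}). c' w \<odot> w)"
    using F FA by (intro finsum_insert[symmetric]) auto
  finally show ?thesis
    unfolding cspan_def using F assms(2) by (intro CollectI exI[of _ c'] exI[of _ "insert v (F - {v})"]) auto
qed

lemma cspan_zero: "\<zero> \<in> cspan A S"
  unfolding cspan_def by (intro CollectI exI[of _ "\<lambda>_. 0"] exI[of _ "{}"]) auto

end

context cstar_algebra
begin

text \<open>The C*-identity and submultiplicativity bound the squared norm of \<open>y\<close> by
  the product of the norms of \<open>y\<^sup>\<star>\<close> and \<open>y\<close>. Cancelling gives
  one inequality, exchanging \<open>y\<close> and its adjoint the other.\<close>

lemma nrm_star [simp]: assumes "x \<in> carrier A" shows "nrm A (x\<^sup>\<star>) = nrm A x"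
proof -
  have le: "nrm A y \<le> nrm A (y\<^sup>\<star>)" if y: "y \<in> carrier A" for y
  proof (cases "nrm A y = 0")
    case True then show ?thesis using nrm_nonneg[of "y\<^sup>\<star>"] y by simp
  next
    case False
    have "nrm A y * nrm A y \<le> nrm A (y\<^sup>\<star>) * nrm A y"
      using cstar_identity[OF y] nrm_mult[of "y\<^sup>\<star>" y] y by (simp add: power2_eq_square)
    then show ?thesis using False nrm_nonneg[OF y] by simp
  qed
  show ?thesis using le[OF assms] le[of "x\<^sup>\<star>"] assms by simp
qed

text \<open>The square root is \<open>\<one> \<ominus> t\<close> for the fixed point \<open>t\<close> of the contraction \<open>t \<mapsto> (h + t\<^sup>2) / 2\<close>.\<close>

lemma one_minus_eq_square:
  assumes h: "h \<in> carrier A" "h\<^sup>\<star> = h" and h1: "nrm A h < 1"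
  shows "\<exists>s\<in>carrier A. s\<^sup>\<star> = s \<and> \<one> \<ominus> h = s \<otimes> s"
proof -
  interpret M: Metric_space "carrier A" "cdist A" by (rule Metric_space_cdist)
  define r where "r = nrm A h"
  have r: "0 \<le> r" "r < 1" using h1 nrm_nonneg[OF h(1)] by (auto simp: r_def)
  \<comment> \<open>On the ball of radius \<open>r < 1\<close> the values of \<open>f\<close> have
    norm at most \<open>(r + r * r) / 2 \<le> r\<close>, and \<open>f\<close> contracts with factor
    \<open>r\<close>.\<close>
  define B where "B = M.mcball \<zero> r"
  have B: "x \<in> B \<longleftrightarrow> x \<in> carrier A \<and> nrm A x \<le> r" for x
    by (auto simp: B_def cdist_def nrm_minus_commute[of \<zero>]) (simp_all add: minus_eq_smult)
  define f where "f t = (1/2) \<odot> (h \<oplus> t \<otimes> t)" for t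
  interpret S: Submetric "carrier A" "cdist A" B
    by unfold_locales (auto simp: B)
  have comp: "S.sub.mcomplete"
    by (rule S.closedin_mcomplete_imp_mcomplete) (auto simp: B_def complete)
  have fB: "f t \<in> B" if "t \<in> B" for t
  proof -
    from that have t: "t \<in> carrier A" "nrm A t \<le> r" by (auto simp: B)
    have "nrm A (f t) \<le> (1/2) * (r + nrm A t * nrm A t)"
      using nrm_triangle[of h "t \<otimes> t"] nrm_mult[of t t] t h by (simp add: f_def nrm_smult r_def)
    also have "nrm A t * nrm A t \<le> 1 * r"
      using t r nrm_nonneg[of t] by (intro mult_mono) auto
    finally show ?thesis using t h by (simp add: B f_def)
  qed
  have contr: "cdist A (f x) (f y) \<le> r * cdist A x y" if "x \<in> B" "y \<in> B" for x y
  proof -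
    from that have x: "x \<in> carrier A" "nrm A x \<le> r" and y: "y \<in> carrier A" "nrm A y \<le> r" by (auto simp: B)
    have eq: "(h \<oplus> x \<otimes> x) \<ominus> (h \<oplus> y \<otimes> y) = x \<otimes> (x \<ominus> y) \<oplus> (x \<ominus> y) \<otimes> y"
      using x y h by algebra
    have "f x \<ominus> f y = (1/2) \<odot> ((h \<oplus> x \<otimes> x) \<ominus> (h \<oplus> y \<otimes> y))"
      using x y h by (simp add: f_def minus_eq_smult smult_add_right)
    then have "nrm A (f x \<ominus> f y) = (1/2) * nrm A (x \<otimes> (x \<ominus> y) \<oplus> (x \<ominus> y) \<otimes> y)"
      using x y h by (simp add: eq nrm_smult)
    also have "nrm A (x \<otimes> (x \<ominus> y) \<oplus> (x \<ominus> y) \<otimes> y) \<le> nrm A x * nrm A (x \<ominus> y) + nrm A (x \<ominus> y) * nrm A y"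
      using x y by (intro order.trans[OF nrm_triangle] add_mono nrm_mult) auto
    also have "\<dots> \<le> r * nrm A (x \<ominus> y) + nrm A (x \<ominus> y) * r"
      using x y nrm_nonneg[of "x \<ominus> y"] by (intro add_mono mult_right_mono mult_left_mono) auto
    finally show ?thesis using x y h by (simp add: cdist_def f_def)
  qed
  have "\<zero> \<in> B" using r by (simp add: B)
  then obtain t where t: "t \<in> B" "f t = t"
    using S.sub.Banach_fixedpoint_thm[OF comp, of f r] fB contr r by blast
  have tc: "t \<in> carrier A" using t by (simp add: B)
  \<comment> \<open>As \<open>h\<close> is self-adjoint, \<open>f\<close> commutes with the star, so
    the adjoint of the fixed point is fixed as well; the contraction leaves room for only one fixed
    point in \<open>B\<close>.\<close>
  have ts: "t\<^sup>\<star> \<in> B" "f (t\<^sup>\<star>) = t\<^sup>\<star>"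
  proof -
    show "t\<^sup>\<star> \<in> B" using t(1) by (simp add: B)
    have "t\<^sup>\<star> = (f t)\<^sup>\<star>" using t by simp
    also have "\<dots> = f (t\<^sup>\<star>)" using tc h by (simp add: f_def star_smult star_add star_mult)
    finally show "f (t\<^sup>\<star>) = t\<^sup>\<star>" by simp
  qed
  have "t\<^sup>\<star> = t"
  proof -
    have "cdist A (t\<^sup>\<star>) t \<le> r * cdist A (t\<^sup>\<star>) t"
      using contr[OF ts(1) t(1)] ts t by simp
    then have "cdist A (t\<^sup>\<star>) t = 0"
      using r M.nonneg[of "t\<^sup>\<star>" t] by (smt (verit) mult_le_cancel_right1)
    then show ?thesis using tc by simp
  qed
  moreover have "\<one> \<ominus> h = (\<one> \<ominus> t) \<otimes> (\<one> \<ominus> t)"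
  proof -
    have "t \<oplus> t = 2 \<odot> t" using smult_add_left[of t 1 1] tc by simp
    also have "\<dots> = 2 \<odot> f t" by (simp add: t)
    also have "\<dots> = h \<oplus> t \<otimes> t" using tc h by (simp add: f_def)
    finally have "h = (t \<oplus> t) \<ominus> t \<otimes> t" using tc h by algebra
    moreover have "(\<one> \<ominus> t) \<otimes> (\<one> \<ominus> t) = \<one> \<ominus> ((t \<oplus> t) \<ominus> t \<otimes> t)"
      using tc by (simp add: minus_eq l_distr r_distr l_minus r_minus minus_add minus_minus a_ac)
    ultimately show ?thesis by simp
  qed
  ultimately show ?thesis using tc by (intro bexI[of _ "\<one> \<ominus> t"]) (auto simp: star_minus)
qed

end

section \<open>States and the GNS norm\<close>

lemma of_real_cmod_power2: "(complex_of_real (cmod z))\<^sup>2 = z * cnj z"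
  using complex_norm_square[of z] by simp

locale cstar_state = cstar_algebra A for A :: "'a cstar" (structure) +
  fixes \<rho> :: "'a \<Rightarrow> complex"
  assumes state: "state A \<rho>"
begin

lemma rho_add: "\<lbrakk>x \<in> carrier A; y \<in> carrier A\<rbrakk> \<Longrightarrow> \<rho> (x \<oplus> y) = \<rho> x + \<rho> y"
  and rho_smult: "x \<in> carrier A \<Longrightarrow> \<rho> (a \<odot> x) = a * \<rho> x"
  and rho_pos: "x \<in> carrier A \<Longrightarrow> \<rho> (x\<^sup>\<star> \<otimes> x) \<in> \<real>\<^sub>\<ge>\<^sub>0"
  and rho_one [simp]: "\<rho> \<one> = 1"
  using state by (auto simp: state_def)

lemma rho_zero [simp]: "\<rho> \<zero> = 0"
  using rho_smult[of \<zero> 0] by simp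

lemma rho_uminus: "x \<in> carrier A \<Longrightarrow> \<rho> (\<ominus> x) = - \<rho> x"
  by (simp add: uminus_eq_smult rho_smult)

lemma rho_minus: "\<lbrakk>x \<in> carrier A; y \<in> carrier A\<rbrakk> \<Longrightarrow> \<rho> (x \<ominus> y) = \<rho> x - \<rho> y"
  by (simp add: a_minus_def rho_add rho_uminus)

lemma Re_rho_pos: "x \<in> carrier A \<Longrightarrow> 0 \<le> Re (\<rho> (x\<^sup>\<star> \<otimes> x))"
  and Im_rho_pos: "x \<in> carrier A \<Longrightarrow> Im (\<rho> (x\<^sup>\<star> \<otimes> x)) = 0"
  using rho_pos[of x] by (auto simp: complex_nonneg_Reals_iff)

lemma rho_eq_Re: "x \<in> carrier A \<Longrightarrow> \<rho> (x\<^sup>\<star> \<otimes> x) = of_real (Re (\<rho> (x\<^sup>\<star> \<otimes> x)))"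
  by (simp add: complex_eq_iff Im_rho_pos)

lemma rho_expand:
  assumes "x \<in> carrier A" "y \<in> carrier A"
  shows "\<rho> ((x \<oplus> a \<odot> y)\<^sup>\<star> \<otimes> (x \<oplus> a \<odot> y)) =
    \<rho> (x\<^sup>\<star> \<otimes> x) + a * \<rho> (x\<^sup>\<star> \<otimes> y) + cnj a * \<rho> (y\<^sup>\<star> \<otimes> x) + (cmod a)\<^sup>2 * \<rho> (y\<^sup>\<star> \<otimes> y)"
  using assms
  by (simp add: star_add star_smult l_distr r_distr smult_mult_left smult_mult_right rho_add rho_smult
      of_real_cmod_power2 algebra_simps)

text \<open>Hermitian symmetry is not an axiom of \<open>state\<close>. It follows by polarization:
  the expansions with coefficients 1 and \<open>\<i>\<close> have vanishing imaginary part.\<close>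

lemma rho_cnj:
  assumes x: "x \<in> carrier A" and y: "y \<in> carrier A"
  shows "\<rho> (y\<^sup>\<star> \<otimes> x) = cnj (\<rho> (x\<^sup>\<star> \<otimes> y))"
proof -
  have "Im (\<rho> (x\<^sup>\<star> \<otimes> y)) + Im (\<rho> (y\<^sup>\<star> \<otimes> x)) = 0"
    using Im_rho_pos[of "x \<oplus> 1 \<odot> y"] x y unfolding rho_expand[OF x y] by (simp add: Im_rho_pos)
  moreover have "Re (\<rho> (x\<^sup>\<star> \<otimes> y)) - Re (\<rho> (y\<^sup>\<star> \<otimes> x)) = 0"
    using Im_rho_pos[of "x \<oplus> \<i> \<odot> y"] x y unfolding rho_expand[OF x y] by (simp add: Im_rho_pos)
  ultimately show ?thesis by (simp add: complex_eq_iff)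
qed

lemma rho_star: "x \<in> carrier A \<Longrightarrow> \<rho> (x\<^sup>\<star>) = cnj (\<rho> x)"
  using rho_cnj[of \<one> x] by simp

lemma Cauchy_Schwarz:
  assumes x: "x \<in> carrier A" and y: "y \<in> carrier A"
  shows "(cmod (\<rho> (x\<^sup>\<star> \<otimes> y)))\<^sup>2 \<le> Re (\<rho> (x\<^sup>\<star> \<otimes> x)) * Re (\<rho> (y\<^sup>\<star> \<otimes> y))"
proof -
  define b p q where "b = \<rho> (x\<^sup>\<star> \<otimes> y)" and "p = Re (\<rho> (x\<^sup>\<star> \<otimes> x))" and "q = Re (\<rho> (y\<^sup>\<star> \<otimes> y))"
  have *: "0 \<le> p - 2 * t * (cmod b)\<^sup>2 + t\<^sup>2 * (cmod b)\<^sup>2 * q" for t :: real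
  proof -
    \<comment> \<open>This coefficient makes the two cross terms equal and real, so positivity
      becomes a statement about a real quadratic in \<open>t\<close>.\<close>
    define a where "a = - of_real t * cnj b"
    have 1: "a * b = of_real (- t * (cmod b)\<^sup>2)" "cnj a * cnj b = of_real (- t * (cmod b)\<^sup>2)"
      by (simp_all add: a_def of_real_cmod_power2 mult.commute)
    have 2: "(cmod a)\<^sup>2 = t\<^sup>2 * (cmod b)\<^sup>2" by (simp add: a_def norm_mult power_mult_distrib)
    have "0 \<le> Re (\<rho> (x\<^sup>\<star> \<otimes> x) + a * b + cnj a * cnj b + (cmod a)\<^sup>2 * \<rho> (y\<^sup>\<star> \<otimes> y))"
      using Re_rho_pos[of "x \<oplus> a \<odot> y"] x y unfolding rho_expand[OF x y]
      by (simp add: b_def rho_cnj[OF x y])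
    then show ?thesis unfolding 1 2 by (simp add: p_def q_def)
  qed
  have q: "0 \<le> q" using Re_rho_pos[OF y] by (simp add: q_def)
  have "(cmod b)\<^sup>2 \<le> p * q"
  proof (cases "q = 0")
    case True
    have "b = 0"
    proof (rule ccontr)
      assume "b \<noteq> 0"
      \<comment> \<open>If \<open>q\<close> vanishes, the quadratic takes the value -1 at this
        point.\<close>
      then show False using *[of "(p + 1) / (2 * (cmod b)\<^sup>2)"] True by (simp add: field_simps)
    qed
    then show ?thesis using True by simp
  next
    case False
    \<comment> \<open>The quadratic is smallest at \<open>1 / q\<close>.\<close>
    then show ?thesis using *[of "1 / q"] q by (simp add: field_simps power2_eq_square)
  qed
  then show ?thesis by (simp add: b_def p_def q_def)
qed

text \<open>Null vectors are orthogonal to everything, by Cauchy--Schwarz with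
  \<open>x\<^sup>\<star>\<close> as the first vector.\<close>

lemma rho_mult_eq_0:
  assumes "x \<in> carrier A" "y \<in> carrier A" "\<rho> (y\<^sup>\<star> \<otimes> y) = 0"
  shows "\<rho> (x \<otimes> y) = 0"
  using Cauchy_Schwarz[of "x\<^sup>\<star>" y] assms by simp

text \<open>A vector on which Cauchy--Schwarz against \<open>\<one>\<close> is an equality is a multiple of \<open>\<one>\<close>.\<close>

lemma rho_mult_right:
  assumes x: "x \<in> carrier A" and k: "k \<in> carrier A" and eq: "\<rho> (k\<^sup>\<star> \<otimes> k) = (cmod (\<rho> k))\<^sup>2"
  shows "\<rho> (x \<otimes> k) = \<rho> x * \<rho> k"
proof -
  define z where "z = k \<oplus> (- \<rho> k) \<odot> \<one>"
  have z: "z \<in> carrier A" using k by (simp add: z_def)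
  have "\<rho> (z\<^sup>\<star> \<otimes> z) = 0"
    using k rho_expand[OF k one_closed, of "- \<rho> k"] eq
    by (simp add: z_def rho_star of_real_cmod_power2 mult.commute)
  then have "\<rho> (x \<otimes> z) = 0" using rho_mult_eq_0[OF x z] by simp
  then show ?thesis
    using x k by (simp add: z_def r_distr rho_add smult_mult_right rho_smult rho_uminus)
qed

lemma rho_mult_left:
  assumes x: "x \<in> carrier A" and k: "k \<in> carrier A" and eq: "\<rho> (k \<otimes> k\<^sup>\<star>) = (cmod (\<rho> k))\<^sup>2"
  shows "\<rho> (k \<otimes> x) = \<rho> k * \<rho> x"
proof -
  have "\<rho> (x\<^sup>\<star> \<otimes> k\<^sup>\<star>) = \<rho> (x\<^sup>\<star>) * \<rho> (k\<^sup>\<star>)"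
    using assms by (intro rho_mult_right) (auto simp: rho_star)
  then have "cnj (\<rho> (k \<otimes> x)) = cnj (\<rho> k * \<rho> x)"
    using x k by (simp add: rho_star mult.commute flip: star_mult)
  then show ?thesis by (simp only: complex_cnj_cancel_iff)
qed

text \<open>This is the effect of \<open>x\<^sup>\<star> \<otimes> x\<close> being dominated by its
  norm. For \<open>R\<close> above the squared norm of \<open>x\<close>, the element
  \<open>\<one> \<ominus> h\<close> with
  \<open>h = (1 / R) \<odot> (x\<^sup>\<star> \<otimes> x)\<close> is the square of a self-adjoint
  \<open>s\<close>, and \<open>\<rho>\<close> is nonnegative at
  \<open>(s \<otimes> a)\<^sup>\<star> \<otimes> (s \<otimes> a)\<close>.\<close>

lemma rho_conjugate_le:
  assumes x: "x \<in> carrier A" and a: "a \<in> carrier A"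
  shows "Re (\<rho> ((x \<otimes> a)\<^sup>\<star> \<otimes> (x \<otimes> a))) \<le> (nrm A x)\<^sup>2 * Re (\<rho> (a\<^sup>\<star> \<otimes> a))"
proof -
  have *: "Re (\<rho> ((x \<otimes> a)\<^sup>\<star> \<otimes> (x \<otimes> a))) \<le> R * Re (\<rho> (a\<^sup>\<star> \<otimes> a))" if R: "R > (nrm A x)\<^sup>2" for R
  proof -
    have R0: "R > 0" using R by (smt (verit) zero_le_power2)
    define h where "h = (1 / R) \<odot> (x\<^sup>\<star> \<otimes> x)"
    have "nrm A h < 1" using x R R0 by (simp add: h_def nrm_smult cstar_identity norm_divide)
    moreover have h: "h \<in> carrier A" "h\<^sup>\<star> = h" using x by (simp_all add: h_def star_smult star_mult)
    ultimately obtain s where s: "s \<in> carrier A" "s\<^sup>\<star> = s" "\<one> \<ominus> h = s \<otimes> s"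
      using one_minus_eq_square by blast
    have "(s \<otimes> a)\<^sup>\<star> \<otimes> (s \<otimes> a) = a\<^sup>\<star> \<otimes> (\<one> \<ominus> h) \<otimes> a"
      using s a by (simp add: star_mult m_assoc)
    also have "\<dots> = a\<^sup>\<star> \<otimes> a \<oplus> (- 1 / R) \<odot> ((x \<otimes> a)\<^sup>\<star> \<otimes> (x \<otimes> a))"
      using a x by (simp add: h_def minus_eq_smult star_mult l_distr r_distr smult_mult_left smult_mult_right m_assoc)
    finally have "0 \<le> Re (\<rho> (a\<^sup>\<star> \<otimes> a)) - Re (\<rho> ((x \<otimes> a)\<^sup>\<star> \<otimes> (x \<otimes> a))) / R"
      using Re_rho_pos[of "s \<otimes> a"] a x s by (simp add: rho_add rho_smult)
    then show ?thesis using R0 by (simp add: field_simps)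
  qed
  show ?thesis
  proof (rule field_le_epsilon)
    fix e :: real assume e: "e > 0"
    define q where "q = Re (\<rho> (a\<^sup>\<star> \<otimes> a))"
    have q: "q \<ge> 0" using Re_rho_pos[OF a] by (simp add: q_def)
    \<comment> \<open>Dividing by \<open>q + 1\<close> instead of \<open>q\<close> covers
      \<open>q = 0\<close>.\<close>
    have "Re (\<rho> ((x \<otimes> a)\<^sup>\<star> \<otimes> (x \<otimes> a))) \<le> ((nrm A x)\<^sup>2 + e / (q + 1)) * q"
      using * e q by (simp add: q_def)
    also have "\<dots> \<le> (nrm A x)\<^sup>2 * q + e"
      using e q by (simp add: field_simps)
    finally show "Re (\<rho> ((x \<otimes> a)\<^sup>\<star> \<otimes> (x \<otimes> a))) \<le> (nrm A x)\<^sup>2 * Re (\<rho> (a\<^sup>\<star> \<otimes> a)) + e"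
      by (simp add: q_def)
  qed
qed

lemma rho_bounded: assumes x: "x \<in> carrier A" shows "cmod (\<rho> x) \<le> nrm A x"
proof -
  have "(cmod (\<rho> x))\<^sup>2 \<le> Re (\<rho> (x\<^sup>\<star> \<otimes> x))" using Cauchy_Schwarz[of \<one> x] x by simp
  also have "\<dots> \<le> (nrm A x)\<^sup>2" using rho_conjugate_le[of x \<one>] x by simp
  finally show ?thesis using nrm_nonneg[OF x] by (rule power2_le_imp_le)
qed

section \<open>The GNS seminorm and the completion\<close>

definition snorm :: "'a \<Rightarrow> real" where "snorm = gns_seminorm A \<rho>"

lemma snorm_nonneg: "x \<in> carrier A \<Longrightarrow> 0 \<le> snorm x"
  by (simp add: snorm_def gns_seminorm_def Re_rho_pos)

lemma snorm_sq: "x \<in> carrier A \<Longrightarrow> (snorm x)\<^sup>2 = Re (\<rho> (x\<^sup>\<star> \<otimes> x))"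
  by (simp add: snorm_def gns_seminorm_def Re_rho_pos)

lemma snorm_smult: "x \<in> carrier A \<Longrightarrow> snorm (a \<odot> x) = cmod a * snorm x"
proof -
  assume x: "x \<in> carrier A"
  have "\<rho> ((a \<odot> x)\<^sup>\<star> \<otimes> (a \<odot> x)) = of_real ((cmod a)\<^sup>2) * \<rho> (x\<^sup>\<star> \<otimes> x)"
    using x by (simp add: star_smult smult_mult_left smult_mult_right rho_smult of_real_cmod_power2)
  then show ?thesis by (simp add: snorm_def gns_seminorm_def real_sqrt_mult)
qed

lemma cmod_form_le:
  assumes "x \<in> carrier A" "y \<in> carrier A" shows "cmod (\<rho> (x\<^sup>\<star> \<otimes> y)) \<le> snorm x * snorm y"
proof (rule power2_le_imp_le)
  show "(cmod (\<rho> (x\<^sup>\<star> \<otimes> y)))\<^sup>2 \<le> (snorm x * snorm y)\<^sup>2"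
    using Cauchy_Schwarz[OF assms] by (simp only: power_mult_distrib snorm_sq[OF assms(1)] snorm_sq[OF assms(2)])
  show "0 \<le> snorm x * snorm y" using assms snorm_nonneg by simp
qed

lemma snorm_triangle: assumes x: "x \<in> carrier A" and y: "y \<in> carrier A" shows "snorm (x \<oplus> y) \<le> snorm x + snorm y"
proof (rule power2_le_imp_le)
  have "(snorm (x \<oplus> y))\<^sup>2 = (snorm x)\<^sup>2 + (snorm y)\<^sup>2 + 2 * Re (\<rho> (x\<^sup>\<star> \<otimes> y))"
    using rho_expand[OF x y, of 1] x y by (simp add: snorm_sq rho_cnj[OF x y])
  also have "Re (\<rho> (x\<^sup>\<star> \<otimes> y)) \<le> snorm x * snorm y"
    using cmod_form_le[OF x y] complex_Re_le_cmod order.trans by blast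
  finally show "(snorm (x \<oplus> y))\<^sup>2 \<le> (snorm x + snorm y)\<^sup>2" by (simp add: power2_sum)
qed (use x y snorm_nonneg in auto)

lemma snorm_minus_triangle:
  assumes "x \<in> carrier A" "y \<in> carrier A" "z \<in> carrier A"
  shows "snorm (x \<ominus> z) \<le> snorm (x \<ominus> y) + snorm (y \<ominus> z)"
proof -
  have "x \<ominus> z = (x \<ominus> y) \<oplus> (y \<ominus> z)" using assms by algebra
  then show ?thesis using snorm_triangle[of "x \<ominus> y" "y \<ominus> z"] assms by simp
qed

lemma snorm_minus_commute: "\<lbrakk>x \<in> carrier A; y \<in> carrier A\<rbrakk> \<Longrightarrow> snorm (x \<ominus> y) = snorm (y \<ominus> x)"
proof -
  assume x: "x \<in> carrier A" and y: "y \<in> carrier A"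
  have "y \<ominus> x = (- 1) \<odot> (x \<ominus> y)" using x y by (simp add: minus_eq_smult smult_add_right a_comm)
  then show ?thesis using snorm_smult[of "x \<ominus> y" "-1"] x y by simp
qed

lemma snorm_mult_le: assumes "x \<in> carrier A" "a \<in> carrier A" shows "snorm (x \<otimes> a) \<le> nrm A x * snorm a"
proof (rule power2_le_imp_le)
  have xa: "x \<otimes> a \<in> carrier A" using assms by simp
  show "(snorm (x \<otimes> a))\<^sup>2 \<le> (nrm A x * snorm a)\<^sup>2"
    using rho_conjugate_le[OF assms] by (simp only: power_mult_distrib snorm_sq[OF xa] snorm_sq[OF assms(2)])
  show "0 \<le> nrm A x * snorm a" using assms snorm_nonneg nrm_nonneg by simp
qed

lemma mem_gns_Cauchy_iff:
  "y \<in> gns_Cauchy A \<rho> \<longleftrightarrow>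
     range y \<subseteq> carrier A \<and> (\<forall>e>0. \<exists>N. \<forall>m\<ge>N. \<forall>n\<ge>N. snorm (y m \<ominus> y n) < e)"
  by (simp add: gns_Cauchy_def snorm_def)

lemma gns_Cauchy_closed [simp]: "y \<in> gns_Cauchy A \<rho> \<Longrightarrow> y n \<in> carrier A"
  by (auto simp: mem_gns_Cauchy_iff)

lemma mem_gns_rel_iff:
  "(y, z) \<in> gns_rel A \<rho> \<longleftrightarrow>
     y \<in> gns_Cauchy A \<rho> \<and> z \<in> gns_Cauchy A \<rho> \<and> (\<lambda>n. snorm (y n \<ominus> z n)) \<longlonglongrightarrow> 0"
  by (simp add: gns_rel_def snorm_def)

lemma snorm_zero [simp]: "snorm \<zero> = 0"
  using snorm_smult[of \<zero> 0] by simp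

lemma equiv_gns_rel: "equiv (gns_Cauchy A \<rho>) (gns_rel A \<rho>)"
proof (rule equivI)
  show "gns_rel A \<rho> \<subseteq> gns_Cauchy A \<rho> \<times> gns_Cauchy A \<rho>"
    by (auto simp: mem_gns_rel_iff)
  show "refl_on (gns_Cauchy A \<rho>) (gns_rel A \<rho>)"
    by (auto simp: refl_on_def mem_gns_rel_iff r_neg minus_eq)
  show "sym (gns_rel A \<rho>)"
    by (auto simp: sym_def mem_gns_rel_iff snorm_minus_commute)
  show "trans (gns_rel A \<rho>)"
  proof (rule transI)
    fix x y z assume xy: "(x, y) \<in> gns_rel A \<rho>" and yz: "(y, z) \<in> gns_rel A \<rho>"
    then have C: "x n \<in> carrier A" "y n \<in> carrier A" "z n \<in> carrier A" for n
      by (auto simp: mem_gns_rel_iff)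
    have "(\<lambda>n. snorm (x n \<ominus> z n)) \<longlonglongrightarrow> 0"
    proof (rule tendsto_sandwich[of "\<lambda>_. 0"])
      show "(\<lambda>n. snorm (x n \<ominus> y n) + snorm (y n \<ominus> z n)) \<longlonglongrightarrow> 0"
        using xy yz tendsto_add[of _ "0::real" _ _ 0] by (auto simp: mem_gns_rel_iff)
    qed (auto intro!: always_eventually snorm_nonneg snorm_minus_triangle C minus_closed)
    then show "(x, z) \<in> gns_rel A \<rho>" using xy yz by (auto simp: mem_gns_rel_iff)
  qed
qed

lemma snorm_diff_le: assumes "x \<in> carrier A" "y \<in> carrier A" shows "\<bar>snorm x - snorm y\<bar> \<le> snorm (x \<ominus> y)"
  using snorm_minus_triangle[of x y \<zero>] snorm_minus_triangle[of y x \<zero>] snorm_minus_commute[of x y] assms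
  by (simp add: minus_eq)

text \<open>\<open>gns_inner\<close> is a definite description over all pairs of representatives, so
  a common limit must be established for every pair before it denotes anything.\<close>

lemma gns_norm_tendsto:
  assumes \<xi>: "\<xi> \<in> gns_space A \<rho>" and y: "y \<in> \<xi>"
  shows "(\<lambda>n. snorm (y n)) \<longlonglongrightarrow> gns_norm A \<rho> \<xi>"
proof -
  have inC: "z \<in> gns_Cauchy A \<rho>" if "z \<in> \<xi>" for z
    using that \<xi> in_quotient_imp_subset[OF equiv_gns_rel] by (auto simp: gns_space_def)
  have rel: "(z, w) \<in> gns_rel A \<rho>" if "z \<in> \<xi>" "w \<in> \<xi>" for z w
    using that \<xi> quotient_eq_iff[OF equiv_gns_rel, of \<xi> \<xi> z w] by (simp add: gns_space_def)
  have "Cauchy (\<lambda>n. snorm (y n))"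
  proof (rule metric_CauchyI)
    fix e :: real assume "e > 0"
    then obtain N where "\<forall>m\<ge>N. \<forall>n\<ge>N. snorm (y m \<ominus> y n) < e" using inC[OF y] by (auto simp: mem_gns_Cauchy_iff)
    then show "\<exists>M. \<forall>m\<ge>M. \<forall>n\<ge>M. dist (snorm (y m)) (snorm (y n)) < e"
      using snorm_diff_le inC[OF y] unfolding dist_real_def by (meson gns_Cauchy_closed le_less_trans)
  qed
  then obtain l where l: "(\<lambda>n. snorm (y n)) \<longlonglongrightarrow> l" using Cauchy_convergent convergent_def by blast
  have l0: "l \<ge> 0" using l inC[OF y] snorm_nonneg by (intro LIMSEQ_le_const) auto
  have lz: "(\<lambda>n. snorm (z n)) \<longlonglongrightarrow> l" if "z \<in> \<xi>" for z
  proof -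
    have "(\<lambda>n. snorm (z n) - snorm (y n)) \<longlonglongrightarrow> 0"
    proof (rule Lim_null_comparison)
      show "(\<lambda>n. snorm (z n \<ominus> y n)) \<longlonglongrightarrow> 0" using rel[OF that y] by (simp add: mem_gns_rel_iff)
    qed (use snorm_diff_le inC[OF that] inC[OF y] in \<open>auto intro!: always_eventually\<close>)
    then show ?thesis using tendsto_add[OF _ l] by fastforce
  qed
  \<comment> \<open>Replacing \<open>w n\<close> by \<open>z n\<close> costs
    \<open>\<rho> ((w n \<ominus> z n)\<^sup>\<star> \<otimes> z n)\<close>, which tends to 0 by
    Cauchy--Schwarz; what remains is the square of \<open>snorm (z n)\<close>.\<close>
  have conv: "(\<lambda>n. \<rho> ((w n)\<^sup>\<star> \<otimes> z n)) \<longlonglongrightarrow> of_real (l\<^sup>2)" if z: "z \<in> \<xi>" and w: "w \<in> \<xi>" for z w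
  proof -
    have C: "z n \<in> carrier A" "w n \<in> carrier A" for n using inC[OF z] inC[OF w] by auto
    have "(\<lambda>n. \<rho> ((w n \<ominus> z n)\<^sup>\<star> \<otimes> z n)) \<longlonglongrightarrow> 0"
    proof (rule Lim_null_comparison)
      show "(\<lambda>n. snorm (w n \<ominus> z n) * snorm (z n)) \<longlonglongrightarrow> 0"
        using tendsto_mult[of "\<lambda>n. snorm (w n \<ominus> z n)" 0 _ _ l] rel[OF w z] lz[OF z]
        by (simp add: mem_gns_rel_iff)
    qed (auto intro!: always_eventually cmod_form_le C minus_closed)
    moreover have "(\<lambda>n. of_real ((snorm (z n))\<^sup>2) :: complex) \<longlonglongrightarrow> of_real (l\<^sup>2)"
      by (intro tendsto_intros lz z)
    ultimately have "(\<lambda>n. \<rho> ((w n \<ominus> z n)\<^sup>\<star> \<otimes> z n) + of_real ((snorm (z n))\<^sup>2)) \<longlonglongrightarrow> 0 + of_real (l\<^sup>2)"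
      by (rule tendsto_add)
    moreover have "\<rho> ((w n \<ominus> z n)\<^sup>\<star> \<otimes> z n) + of_real ((snorm (z n))\<^sup>2) = \<rho> ((w n)\<^sup>\<star> \<otimes> z n)" for n
    proof -
      have "of_real ((snorm (z n))\<^sup>2) = \<rho> ((z n)\<^sup>\<star> \<otimes> z n)"
        using C by (simp only: snorm_sq flip: rho_eq_Re)
      then show ?thesis using C by (simp add: minus_eq star_add star_uminus l_distr l_minus rho_add rho_uminus)
    qed
    ultimately show ?thesis by simp
  qed
  have "gns_inner A \<rho> \<xi> \<xi> = of_real (l\<^sup>2)"
    unfolding gns_inner_def
  proof (rule the_equality)
    fix c assume "\<forall>y\<in>\<xi>. \<forall>z\<in>\<xi>. (\<lambda>n. \<rho> ((z n)\<^sup>\<star> \<otimes> y n)) \<longlonglongrightarrow> c"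
    then show "c = of_real (l\<^sup>2)" using conv[OF y y] y LIMSEQ_unique by blast
  qed (use conv in blast)
  then show ?thesis using l l0 by (simp add: gns_norm_def)
qed

lemma mult_gns_Cauchy:
  assumes x: "x \<in> carrier A" and y: "y \<in> gns_Cauchy A \<rho>"
  shows "(\<lambda>n. x \<otimes> y n) \<in> gns_Cauchy A \<rho>"
  unfolding mem_gns_Cauchy_iff
proof (intro conjI allI impI)
  show "range (\<lambda>n. x \<otimes> y n) \<subseteq> carrier A" using x y by auto
  fix e :: real assume e: "e > 0"
  have p: "nrm A x + 1 > 0" using nrm_nonneg[OF x] by simp
  obtain N where N: "\<forall>m\<ge>N. \<forall>n\<ge>N. snorm (y m \<ominus> y n) < e / (nrm A x + 1)"
    using y e p unfolding mem_gns_Cauchy_iff by (meson divide_pos_pos)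
  have "snorm (x \<otimes> y m \<ominus> x \<otimes> y n) < e" if "m \<ge> N" "n \<ge> N" for m n
  proof -
    have "x \<otimes> y m \<ominus> x \<otimes> y n = x \<otimes> (y m \<ominus> y n)"
      using x gns_Cauchy_closed[OF y] by (simp add: minus_eq r_distr r_minus)
    then have "snorm (x \<otimes> y m \<ominus> x \<otimes> y n) \<le> nrm A x * snorm (y m \<ominus> y n)"
      using snorm_mult_le x gns_Cauchy_closed[OF y] by simp
    also have "\<dots> \<le> (nrm A x + 1) * snorm (y m \<ominus> y n)"
      using snorm_nonneg[of "y m \<ominus> y n"] gns_Cauchy_closed[OF y] by (intro mult_right_mono) auto
    also have "\<dots> < e" using N that p by (simp add: field_simps)
    finally show ?thesis .
  qed
  then show "\<exists>N. \<forall>m\<ge>N. \<forall>n\<ge>N. snorm (x \<otimes> y m \<ominus> x \<otimes> y n) < e" by blast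
qed

text \<open>\<open>gns_rep\<close> forms a union of classes over all representatives. Left
  multiplication is bounded for the seminorm, so these classes coincide and one representative
  determines the image.\<close>

lemma gns_rep_eq:
  assumes x: "x \<in> carrier A" and \<xi>: "\<xi> \<in> gns_space A \<rho>" and y: "y \<in> \<xi>"
  shows "gns_rep A \<rho> x \<xi> = gns_rel A \<rho> `` {\<lambda>n. x \<otimes> y n}"
proof -
  have inC: "z \<in> gns_Cauchy A \<rho>" if "z \<in> \<xi>" for z
    using that \<xi> in_quotient_imp_subset[OF equiv_gns_rel] by (auto simp: gns_space_def)
  have rel: "(z, w) \<in> gns_rel A \<rho>" if "z \<in> \<xi>" "w \<in> \<xi>" for z w
    using that \<xi> quotient_eq_iff[OF equiv_gns_rel, of \<xi> \<xi> z w] by (simp add: gns_space_def)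
  have "gns_rel A \<rho> `` {\<lambda>n. x \<otimes> z n} = gns_rel A \<rho> `` {\<lambda>n. x \<otimes> y n}" if z: "z \<in> \<xi>" for z
  proof (rule equiv_class_eq[OF equiv_gns_rel])
    have C: "z n \<in> carrier A" "y n \<in> carrier A" for n using inC[OF z] inC[OF y] by auto
    have eq: "x \<otimes> z n \<ominus> x \<otimes> y n = x \<otimes> (z n \<ominus> y n)" for n
      using x C by (simp add: minus_eq r_distr r_minus)
    have "(\<lambda>n. snorm (x \<otimes> z n \<ominus> x \<otimes> y n)) \<longlonglongrightarrow> 0"
    proof (rule tendsto_sandwich[of "\<lambda>_. 0"])
      show "(\<lambda>n. nrm A x * snorm (z n \<ominus> y n)) \<longlonglongrightarrow> 0"
        using rel[OF z y] by (auto simp: mem_gns_rel_iff intro: tendsto_mult_right_zero)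
    qed (use x C in \<open>auto intro!: always_eventually snorm_nonneg snorm_mult_le simp: eq\<close>)
    then show "(\<lambda>n. x \<otimes> z n, \<lambda>n. x \<otimes> y n) \<in> gns_rel A \<rho>"
      using x inC[OF z] inC[OF y] by (simp add: mem_gns_rel_iff mult_gns_Cauchy)
  qed
  then show ?thesis using y unfolding gns_rep_def by blast
qed

lemma const_gns_Cauchy: "y \<in> carrier A \<Longrightarrow> (\<lambda>n. y) \<in> gns_Cauchy A \<rho>"
  by (auto simp: mem_gns_Cauchy_iff minus_eq r_neg)

lemma gns_norm_gns_rep_tendsto:
  assumes x: "x \<in> carrier A" and \<xi>: "\<xi> \<in> gns_space A \<rho>" and y: "y \<in> \<xi>"
  shows "(\<lambda>n. snorm (x \<otimes> y n)) \<longlonglongrightarrow> gns_norm A \<rho> (gns_rep A \<rho> x \<xi>)"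
proof (rule gns_norm_tendsto)
  have yC: "y \<in> gns_Cauchy A \<rho>"
    using y \<xi> in_quotient_imp_subset[OF equiv_gns_rel] by (auto simp: gns_space_def)
  show "gns_rep A \<rho> x \<xi> \<in> gns_space A \<rho>"
    using mult_gns_Cauchy[OF x yC] by (simp add: gns_rep_eq[OF assms] gns_space_def quotientI)
  show "(\<lambda>n. x \<otimes> y n) \<in> gns_rep A \<rho> x \<xi>"
    using mult_gns_Cauchy[OF x yC] equiv_class_self[OF equiv_gns_rel] by (simp add: gns_rep_eq[OF assms])
qed

text \<open>Constant sequences suffice to detect a nonzero operator. Conversely, if \<open>x\<close>
  sends every element of the algebra to a null vector, it sends a Cauchy sequence to a sequence that
  is null term by term.\<close>

lemma gns_opnorm_eq_0_iff:
  assumes x: "x \<in> carrier A"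
  shows "gns_opnorm A \<rho> x = 0 \<longleftrightarrow> (\<forall>y\<in>carrier A. \<rho> ((x \<otimes> y)\<^sup>\<star> \<otimes> (x \<otimes> y)) = 0)"
proof -
  define U where "U = {\<xi> \<in> gns_space A \<rho>. gns_norm A \<rho> \<xi> \<le> 1}"
  have op: "gns_opnorm A \<rho> x = (SUP \<xi>\<in>U. gns_norm A \<rho> (gns_rep A \<rho> x \<xi>))"
    by (simp add: gns_opnorm_def U_def)
  have ex: "\<exists>y. y \<in> \<xi> \<and> y \<in> gns_Cauchy A \<rho>" if "\<xi> \<in> gns_space A \<rho>" for \<xi>
    using that in_quotient_imp_non_empty[OF equiv_gns_rel] in_quotient_imp_subset[OF equiv_gns_rel]
    by (fastforce simp: gns_space_def)
  have const: "gns_rel A \<rho> `` {\<lambda>n. y} \<in> gns_space A \<rho> \<and> (\<lambda>n. y) \<in> gns_rel A \<rho> `` {\<lambda>n. y}"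
    if "y \<in> carrier A" for y
    using const_gns_Cauchy[OF that] equiv_class_self[OF equiv_gns_rel] by (simp add: gns_space_def quotientI)
  have cnorm: "gns_norm A \<rho> (gns_rel A \<rho> `` {\<lambda>n. y}) = snorm y" if "y \<in> carrier A" for y
    using gns_norm_tendsto[OF conjunct1[OF const[OF that]] conjunct2[OF const[OF that]]]
    by (intro LIMSEQ_unique[OF _ tendsto_const])
  have crep: "gns_norm A \<rho> (gns_rep A \<rho> x (gns_rel A \<rho> `` {\<lambda>n. y})) = snorm (x \<otimes> y)" if "y \<in> carrier A" for y
    using gns_norm_gns_rep_tendsto[OF x conjunct1[OF const[OF that]] conjunct2[OF const[OF that]]]
    by (intro LIMSEQ_unique[OF _ tendsto_const])
  have rho0: "\<rho> ((x \<otimes> y)\<^sup>\<star> \<otimes> (x \<otimes> y)) = 0 \<longleftrightarrow> snorm (x \<otimes> y) = 0" if "y \<in> carrier A" for y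
  proof -
    have "\<rho> ((x \<otimes> y)\<^sup>\<star> \<otimes> (x \<otimes> y)) = of_real ((snorm (x \<otimes> y))\<^sup>2)"
      using x that rho_eq_Re[of "x \<otimes> y"] by (simp only: snorm_sq m_closed)
    then show ?thesis by simp
  qed
  \<comment> \<open>A real supremum dominates its members only if the set is bounded above; here
    left multiplication by \<open>x\<close> has bound \<open>nrm A x\<close>.\<close>
  have bdd: "bdd_above ((\<lambda>\<xi>. gns_norm A \<rho> (gns_rep A \<rho> x \<xi>)) ` U)"
  proof (rule bdd_aboveI2)
    fix \<xi> assume \<xi>: "\<xi> \<in> U"
    then obtain y where y: "y \<in> \<xi>" "y \<in> gns_Cauchy A \<rho>" using ex by (auto simp: U_def)
    have s: "\<xi> \<in> gns_space A \<rho>" using \<xi> by (simp add: U_def)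
    have "gns_norm A \<rho> (gns_rep A \<rho> x \<xi>) \<le> nrm A x * gns_norm A \<rho> \<xi>"
      by (rule LIMSEQ_le[OF gns_norm_gns_rep_tendsto[OF x s y(1)] tendsto_mult_left[OF gns_norm_tendsto[OF s y(1)]]])
        (use x y(2) snorm_mult_le in auto)
    also have "\<dots> \<le> nrm A x * 1" using \<xi> nrm_nonneg[OF x] by (intro mult_left_mono) (auto simp: U_def)
    finally show "gns_norm A \<rho> (gns_rep A \<rho> x \<xi>) \<le> nrm A x" by simp
  qed
  show ?thesis
  proof
    assume 0: "gns_opnorm A \<rho> x = 0"
    show "\<forall>y\<in>carrier A. \<rho> ((x \<otimes> y)\<^sup>\<star> \<otimes> (x \<otimes> y)) = 0"
    proof
      fix y assume y: "y \<in> carrier A"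
      \<comment> \<open>Scaling moves \<open>y\<close> into the unit ball; the summand 1 covers null
        vectors.\<close>
      define c where "c = 1 / (snorm y + 1)"
      have c: "c > 0" "c * snorm y \<le> 1" using snorm_nonneg[OF y] by (auto simp: c_def)
      define y' where "y' = of_real c \<odot> y"
      have y': "y' \<in> carrier A" "snorm y' \<le> 1" using y c by (auto simp: y'_def snorm_smult)
      have "gns_rel A \<rho> `` {\<lambda>n. y'} \<in> U" using const[OF y'(1)] cnorm[OF y'(1)] y' by (simp add: U_def)
      then have "snorm (x \<otimes> y') \<le> 0" using cSUP_upper[OF _ bdd] 0 crep[OF y'(1)] op by metis
      then have "snorm (x \<otimes> y) \<le> 0" using x y c
        by (simp add: y'_def smult_mult_right snorm_smult mult_le_0_iff)
      then show "\<rho> ((x \<otimes> y)\<^sup>\<star> \<otimes> (x \<otimes> y)) = 0" using rho0[OF y] snorm_nonneg[of "x \<otimes> y"] x y by simp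
    qed
  next
    assume 0: "\<forall>y\<in>carrier A. \<rho> ((x \<otimes> y)\<^sup>\<star> \<otimes> (x \<otimes> y)) = 0"
    have "gns_norm A \<rho> (gns_rep A \<rho> x \<xi>) = 0" if \<xi>: "\<xi> \<in> U" for \<xi>
    proof -
      obtain y where y: "y \<in> \<xi>" "y \<in> gns_Cauchy A \<rho>" using ex \<xi> by (auto simp: U_def)
      have s: "\<xi> \<in> gns_space A \<rho>" using \<xi> by (simp add: U_def)
      have "(\<lambda>n. snorm (x \<otimes> y n)) = (\<lambda>n. 0)" using 0 rho0 y(2) by auto
      then show ?thesis
        using LIMSEQ_unique[OF gns_norm_gns_rep_tendsto[OF x s y(1)], of 0] by simp
    qed
    moreover have "U \<noteq> {}" using const[of \<zero>] cnorm[of \<zero>] by (auto simp: U_def)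
    ultimately show "gns_opnorm A \<rho> x = 0" unfolding op by (simp add: cSUP_const)
  qed
qed

end

section \<open>Positive elements of abelian C*-algebras\<close>

context normed_star_algebra
begin

lemma mcomplete_iff:
  "Metric_space.mcomplete (carrier A) (cdist A) \<longleftrightarrow>
    (\<forall>\<sigma> :: nat \<Rightarrow> 'a. range \<sigma> \<subseteq> carrier A \<and> (\<forall>e>0. \<exists>N. \<forall>m\<ge>N. \<forall>n\<ge>N. nrm A (\<sigma> m \<ominus> \<sigma> n) < e) \<longrightarrow>
       (\<exists>x\<in>carrier A. \<forall>e>0. \<exists>N. \<forall>n\<ge>N. nrm A (\<sigma> n \<ominus> x) < e))"
proof -
  interpret M: Metric_space "carrier A" "cdist A" by (rule Metric_space_cdist)
  have C: "M.MCauchy \<sigma> \<longleftrightarrow> range \<sigma> \<subseteq> carrier A \<and> (\<forall>e>0. \<exists>N. \<forall>m\<ge>N. \<forall>n\<ge>N. nrm A (\<sigma> m \<ominus> \<sigma> n) < e)" for \<sigma> :: "nat \<Rightarrow> 'a"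
  proof (cases "range \<sigma> \<subseteq> carrier A")
    case True
    then have "\<sigma> n \<in> carrier A" for n by auto
    then show ?thesis by (simp add: M.MCauchy_def cdist_def)
  qed (simp add: M.MCauchy_def)
  have L: "limitin M.mtopology \<sigma> x sequentially \<longleftrightarrow> x \<in> carrier A \<and> (\<forall>e>0. \<exists>N. \<forall>n\<ge>N. nrm A (\<sigma> n \<ominus> x) < e)"
    if "range \<sigma> \<subseteq> carrier A" for \<sigma> x
  proof -
    have "\<sigma> n \<in> carrier A" for n using that by auto
    then show ?thesis by (simp add: M.limit_metric_sequentially cdist_def cong: conj_cong)
  qed
  have eq: "(M.MCauchy \<sigma> \<longrightarrow> (\<exists>x. limitin M.mtopology \<sigma> x sequentially)) \<longleftrightarrow>
      (range \<sigma> \<subseteq> carrier A \<and> (\<forall>e>0. \<exists>N. \<forall>m\<ge>N. \<forall>n\<ge>N. nrm A (\<sigma> m \<ominus> \<sigma> n) < e) \<longrightarrow>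
       (\<exists>x\<in>carrier A. \<forall>e>0. \<exists>N. \<forall>n\<ge>N. nrm A (\<sigma> n \<ominus> x) < e))" for \<sigma> :: "nat \<Rightarrow> 'a"
    unfolding C Bex_def by (cases "range \<sigma> \<subseteq> carrier A") (simp_all only: L simp_thms)
  show ?thesis by (simp only: M.mcomplete_def eq simp_thms)
qed

lemma normed_star_subalgebra:
  assumes D: "D \<subseteq> carrier A" "\<zero> \<in> D" "\<one> \<in> D"
    and add: "\<And>x y. \<lbrakk>x \<in> D; y \<in> D\<rbrakk> \<Longrightarrow> x \<oplus> y \<in> D" and mult: "\<And>x y. \<lbrakk>x \<in> D; y \<in> D\<rbrakk> \<Longrightarrow> x \<otimes> y \<in> D"
    and star: "\<And>x. x \<in> D \<Longrightarrow> x\<^sup>\<star> \<in> D" and smult: "\<And>a x. x \<in> D \<Longrightarrow> a \<odot> x \<in> D"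
  shows "normed_star_algebra (A\<lparr>carrier := D\<rparr>)"
proof -
  note c = subsetD[OF D(1)]
  have inv: "\<exists>y\<in>D. y \<oplus> x = \<zero>" if "x \<in> D" for x
    using smult[OF that, of "-1"] c[OF that] l_neg[of x] by (auto simp: uminus_eq_smult)
  interpret R: ring "A\<lparr>carrier := D\<rparr>"
  proof (intro ring.intro Ring.ring_axioms.intro abelian_groupI monoidI)
  qed (use D add mult inv in \<open>auto simp: c l_distr r_distr a_ac m_assoc\<close>)
  show ?thesis
  proof (intro normed_star_algebra.intro R.ring_axioms normed_star_algebra_axioms.intro
      Module.module.intro module_axioms.intro R.abelian_group_axioms scalar.R.cring_axioms)
  qed (use c star smult in \<open>auto simp: complex_ring_def smult_add_left smult_add_right smult_mult_left
       smult_mult_right star_add star_smult star_mult nrm_nonneg nrm_eq_0_iff nrm_triangle nrm_smult nrm_mult\<close>)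
qed

end

context cstar_algebra
begin

lemma cstar_algebra_subalgebra:
  assumes "cstar_subalgebra A D" "\<one> \<in> D"
  shows "cstar_algebra (A\<lparr>carrier := D\<rparr>)"
proof -
  have D: "D \<subseteq> carrier A" and clo: "\<And>x. x \<in> carrier A \<Longrightarrow> (\<forall>e>0. \<exists>y\<in>D. nrm A (x \<ominus> y) < e) \<Longrightarrow> x \<in> D"
    using assms unfolding cstar_subalgebra_def closedin_iff by auto
  interpret S: normed_star_algebra "A\<lparr>carrier := D\<rparr>"
    using assms D unfolding cstar_subalgebra_def by (intro normed_star_subalgebra) auto
  \<comment> \<open>Subtraction uses the additive inverse taken within the carrier, so the one of
    the subalgebra has to be compared with the ambient one.\<close>
  have minus: "x \<ominus>\<^bsub>A\<lparr>carrier := D\<rparr>\<^esub> y = x \<ominus> y" if "x \<in> D" "y \<in> D" for x y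
    using S.minus_eq_smult[of x y] minus_eq_smult[of x y] that subsetD[OF D] by simp
  show ?thesis
  proof (intro cstar_algebra.intro S.normed_star_algebra_axioms cstar_algebra_axioms.intro)
    show "nrm (A\<lparr>carrier := D\<rparr>) (x\<^sup>\<star>\<^bsub>A\<lparr>carrier := D\<rparr>\<^esub> \<otimes>\<^bsub>A\<lparr>carrier := D\<rparr>\<^esub> x) = (nrm (A\<lparr>carrier := D\<rparr>) x)\<^sup>2"
      if "x \<in> carrier (A\<lparr>carrier := D\<rparr>)" for x
      using that D cstar_identity by auto
    show "Metric_space.mcomplete (carrier (A\<lparr>carrier := D\<rparr>)) (cdist (A\<lparr>carrier := D\<rparr>))"
    proof (rule S.mcomplete_iff[THEN iffD2], intro allI impI)
      fix \<sigma> :: "nat \<Rightarrow> 'a"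
      assume *: "range \<sigma> \<subseteq> carrier (A\<lparr>carrier := D\<rparr>) \<and>
        (\<forall>e>0. \<exists>N. \<forall>m\<ge>N. \<forall>n\<ge>N. nrm (A\<lparr>carrier := D\<rparr>) (\<sigma> m \<ominus>\<^bsub>A\<lparr>carrier := D\<rparr>\<^esub> \<sigma> n) < e)"
      then have \<sigma>: "\<And>n. \<sigma> n \<in> D" by auto
      have "range \<sigma> \<subseteq> carrier A \<and> (\<forall>e>0. \<exists>N. \<forall>m\<ge>N. \<forall>n\<ge>N. nrm A (\<sigma> m \<ominus> \<sigma> n) < e)"
        using conjunct2[OF *] subsetD[OF D \<sigma>] unfolding minus[OF \<sigma> \<sigma>] by (simp add: image_subset_iff)
      from complete[unfolded mcomplete_iff, THEN spec, THEN mp, OF this]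
      obtain x where x: "x \<in> carrier A" "\<And>e. e > 0 \<Longrightarrow> \<exists>N. \<forall>n\<ge>N. nrm A (\<sigma> n \<ominus> x) < e"
        by blast
      have "x \<in> D"
      proof (rule clo[OF x(1)], intro allI impI)
        fix e :: real assume "e > 0"
        then obtain N where "nrm A (\<sigma> N \<ominus> x) < e" using x(2) by blast
        then have "nrm A (x \<ominus> \<sigma> N) < e" using nrm_minus_commute[of x "\<sigma> N"] x(1) subsetD[OF D \<sigma>] by simp
        then show "\<exists>y\<in>D. nrm A (x \<ominus> y) < e" using \<sigma> by blast
      qed
      then show "\<exists>x\<in>carrier (A\<lparr>carrier := D\<rparr>). \<forall>e>0. \<exists>N. \<forall>n\<ge>N. nrm (A\<lparr>carrier := D\<rparr>) (\<sigma> n \<ominus>\<^bsub>A\<lparr>carrier := D\<rparr>\<^esub> x) < e"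
        using x(2) by (intro bexI[of _ x]) (simp_all add: minus[OF \<sigma>])
    qed
  qed
qed

end

section \<open>Sums of squares as the positive cone of an abelian algebra\<close>

locale abelian_cstar_algebra = cstar_algebra A for A :: "'a cstar" (structure) +
  assumes mult_commute: "\<lbrakk>x \<in> carrier A; y \<in> carrier A\<rbrakk> \<Longrightarrow> x \<otimes> y = y \<otimes> x"
begin

sublocale cring A
  by unfold_locales (simp add: mult_commute)

definition rsc :: "real \<Rightarrow> 'a" where "rsc t = of_real t \<odot> \<one>"

lemma rsc_closed [simp, intro]: "rsc t \<in> carrier A" by (simp add: rsc_def)
lemma rsc_star [simp]: "(rsc t)\<^sup>\<star> = rsc t" by (simp add: rsc_def star_smult)
lemma rsc_add: "rsc s \<oplus> rsc t = rsc (s + t)" by (simp add: rsc_def smult_add_left)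
lemma rsc_mult: "rsc s \<otimes> rsc t = rsc (s * t)" by (simp add: rsc_def smult_mult_left)
lemma rsc_uminus: "\<ominus> rsc t = rsc (- t)" by (simp add: rsc_def uminus_eq_smult)
lemma rsc_0: "rsc 0 = \<zero>" by (simp add: rsc_def)
lemma rsc_1: "rsc 1 = \<one>" by (simp add: rsc_def)
lemma rsc_smult: "x \<in> carrier A \<Longrightarrow> rsc t \<otimes> x = of_real t \<odot> x" by (simp add: rsc_def smult_mult_left)

text \<open>Only an inequality holds, because the algebra may be zero: the C*-identity leaves 0 and
  1 as possible norms of the unit.\<close>

lemma nrm_rsc_le: "nrm A (rsc t) \<le> \<bar>t\<bar>"
proof -
  have "(nrm A \<one>)\<^sup>2 = nrm A \<one>" using cstar_identity[of \<one>] by simp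
  then have "nrm A \<one> = 0 \<or> nrm A \<one> = 1" by (simp add: power2_eq_square)
  then show ?thesis by (auto simp: rsc_def nrm_smult)
qed

text \<open>This set stands in for the positive elements. Adding any positive scalar turns a member
  into a single square (\<open>sqs_add_rsc_eq_square\<close>).\<close>

inductive_set sqs :: "'a set" where
  square: "\<lbrakk>h \<in> carrier A; h\<^sup>\<star> = h\<rbrakk> \<Longrightarrow> h \<otimes> h \<in> sqs"
| add: "\<lbrakk>p \<in> sqs; q \<in> sqs\<rbrakk> \<Longrightarrow> p \<oplus> q \<in> sqs"

lemma sqs_closed: "p \<in> sqs \<Longrightarrow> p \<in> carrier A \<and> p\<^sup>\<star> = p"
  by (induction rule: sqs.induct) (auto simp: star_add star_mult)

lemma sqs_mult_square: "\<lbrakk>p \<in> sqs; h \<in> carrier A; h\<^sup>\<star> = h\<rbrakk> \<Longrightarrow> h \<otimes> h \<otimes> p \<in> sqs"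
proof (induction rule: sqs.induct)
  case (square k)
  have "h \<otimes> h \<otimes> (k \<otimes> k) = (h \<otimes> k) \<otimes> (h \<otimes> k)" using square by algebra
  moreover have "(h \<otimes> k)\<^sup>\<star> = h \<otimes> k" using square by (simp add: star_mult m_comm)
  ultimately show ?case using sqs.square[of "h \<otimes> k"] square by simp
next
  case (add p q)
  then show ?case using sqs_closed[of p] sqs_closed[of q] by (simp add: r_distr sqs.add)
qed

lemma sqs_mult: "\<lbrakk>p \<in> sqs; q \<in> sqs\<rbrakk> \<Longrightarrow> p \<otimes> q \<in> sqs"
proof (induction rule: sqs.induct)
  case (square h)
  then show ?case using sqs_mult_square by simp
next
  case (add p p')
  then show ?case using sqs_closed[of p] sqs_closed[of p'] sqs_closed[of q] by (simp add: l_distr sqs.add)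
qed

lemma rsc_in_sqs: "t \<ge> 0 \<Longrightarrow> rsc t \<in> sqs"
  using square[of "rsc (sqrt t)"] by (simp add: rsc_mult)

lemma rsc_minus_in_sqs:
  assumes x: "x \<in> carrier A" "x\<^sup>\<star> = x" and M: "nrm A x < M"
  shows "\<exists>s\<in>carrier A. s\<^sup>\<star> = s \<and> rsc M \<ominus> x = s \<otimes> s"
proof -
  have M0: "M > 0" using M nrm_nonneg[OF x(1)] by simp
  define h where "h = rsc (1 / M) \<otimes> x"
  have h: "h \<in> carrier A" "h\<^sup>\<star> = h" "nrm A h < 1"
    using x M M0 by (auto simp: h_def rsc_smult star_smult nrm_smult norm_divide)
  then obtain s where s: "s \<in> carrier A" "s\<^sup>\<star> = s" "\<one> \<ominus> h = s \<otimes> s" using one_minus_eq_square by blast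
  define u where "u = rsc (sqrt M) \<otimes> s"
  have u: "u \<in> carrier A" "u\<^sup>\<star> = u" using s by (auto simp: u_def rsc_smult star_smult)
  have "u \<otimes> u = (rsc (sqrt M) \<otimes> rsc (sqrt M)) \<otimes> (s \<otimes> s)"
    unfolding u_def using s(1) rsc_closed[of "sqrt M"] by algebra
  also have "\<dots> = rsc M \<otimes> (\<one> \<ominus> h)" using M0 s by (simp add: rsc_mult)
  also have "\<dots> = rsc M \<ominus> (rsc M \<otimes> rsc (1 / M)) \<otimes> x"
    unfolding h_def using x(1) rsc_closed[of M] rsc_closed[of "1 / M"] by algebra
  also have "\<dots> = rsc M \<ominus> x" using M0 x by (simp add: rsc_mult rsc_1)
  finally show ?thesis using u by auto
qed

text \<open>\<open>h \<oplus> \<i> \<odot> k\<close> is a multiple of a unitary.\<close>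

lemma nrm_le_of_sum_squares:
  assumes h: "h \<in> carrier A" "h\<^sup>\<star> = h" and k: "k \<in> carrier A" "k\<^sup>\<star> = k"
    and eq: "h \<otimes> h \<oplus> k \<otimes> k = rsc r" and r: "r \<ge> 0"
  shows "(nrm A h)\<^sup>2 \<le> r"
proof -
  define u where "u = h \<oplus> \<i> \<odot> k"
  have u: "u \<in> carrier A" using h k by (simp add: u_def)
  have us: "u\<^sup>\<star> = h \<oplus> (- \<i>) \<odot> k" using h k by (simp add: u_def star_add star_smult)
  have "u\<^sup>\<star> \<otimes> u = (h \<otimes> h \<oplus> k \<otimes> k) \<oplus> (\<i> \<odot> (h \<otimes> k) \<oplus> (- \<i>) \<odot> (h \<otimes> k))"
    unfolding us using h k m_comm[of k h]
    by (simp add: u_def l_distr r_distr smult_mult_left smult_mult_right smult_add_right a_ac)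
  also have "\<i> \<odot> (h \<otimes> k) \<oplus> (- \<i>) \<odot> (h \<otimes> k) = \<zero>"
    using h k smult_add_left[of "h \<otimes> k" \<i> "-\<i>"] by simp
  finally have "u\<^sup>\<star> \<otimes> u = rsc r" using eq h k by simp
  then have nu: "(nrm A u)\<^sup>2 \<le> r" using cstar_identity[OF u] nrm_rsc_le[of r] r by simp
  have "h = (1/2) \<odot> (u \<oplus> u\<^sup>\<star>)"
  proof -
    have "u \<oplus> u\<^sup>\<star> = (h \<oplus> h) \<oplus> (\<i> \<odot> k \<oplus> (- \<i>) \<odot> k)"
      unfolding us using h k by (simp add: u_def a_ac)
    also have "\<dots> = 2 \<odot> h"
      using h k smult_add_left[of h 1 1] smult_add_left[of k \<i> "-\<i>"] by simp
    finally show ?thesis using h by simp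
  qed
  then have "nrm A h \<le> nrm A u"
    using nrm_triangle[of u "u\<^sup>\<star>"] nrm_smult[of "u \<oplus> u\<^sup>\<star>" "1/2"] u by simp
  then have "(nrm A h)\<^sup>2 \<le> (nrm A u)\<^sup>2" using nrm_nonneg[OF h(1)] by (intro power_mono) auto
  then show ?thesis using nu by simp
qed

text \<open>Lying within distance \<open>r\<close> of the scalar \<open>r\<close> is a norm
  criterion for positivity that passes to sums by the triangle inequality. For a square
  \<open>h \<otimes> h\<close> a slightly larger scalar \<open>r\<close> makes the difference a
  square \<open>s \<otimes> s\<close>, and
  \<open>s \<otimes> s \<oplus> h \<otimes> h = rsc r\<close> bounds its norm.\<close>

lemma sqs_near_rsc: "p \<in> sqs \<Longrightarrow> \<exists>r\<ge>0. nrm A (rsc r \<ominus> p) \<le> r"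
proof (induction rule: sqs.induct)
  case (square h)
  define r where "r = nrm A (h \<otimes> h) + 1"
  have r: "r \<ge> 0" using square nrm_nonneg[of "h \<otimes> h"] by (simp add: r_def)
  obtain s where s: "s \<in> carrier A" "s\<^sup>\<star> = s" "rsc r \<ominus> h \<otimes> h = s \<otimes> s"
    using rsc_minus_in_sqs[of "h \<otimes> h" r] square by (auto simp: r_def star_mult)
  have "s \<otimes> s \<oplus> h \<otimes> h = rsc r" unfolding s(3)[symmetric] using square rsc_closed[of r] by algebra
  then have "(nrm A s)\<^sup>2 \<le> r" using nrm_le_of_sum_squares s square r by blast
  moreover have "nrm A (s \<otimes> s) \<le> (nrm A s)\<^sup>2" using nrm_mult[of s s] s by (simp add: power2_eq_square)
  ultimately show ?case using s r by (auto intro!: exI[of _ r])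
next
  case (add p q)
  then obtain r s where r: "r \<ge> 0" "nrm A (rsc r \<ominus> p) \<le> r" and s: "s \<ge> 0" "nrm A (rsc s \<ominus> q) \<le> s" by blast
  have c: "p \<in> carrier A" "q \<in> carrier A" using add sqs_closed by auto
  have "rsc (r + s) \<ominus> (p \<oplus> q) = (rsc r \<ominus> p) \<oplus> (rsc s \<ominus> q)"
    unfolding rsc_add[symmetric] using c rsc_closed[of r] rsc_closed[of s] by algebra
  then have "nrm A (rsc (r + s) \<ominus> (p \<oplus> q)) \<le> r + s"
    using nrm_triangle[of "rsc r \<ominus> p" "rsc s \<ominus> q"] r s c by simp
  then show ?case using r s by (intro exI[of _ "r + s"]) auto
qed

text \<open>If \<open>r\<close> is the nearby scalar, then \<open>rsc r \<ominus> p\<close> has norm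
  below \<open>r + e\<close>, so subtracting it from \<open>rsc (r + e)\<close> leaves a
  square.\<close>

lemma sqs_add_rsc_eq_square:
  assumes p: "p \<in> sqs" and e: "e > 0"
  shows "\<exists>s\<in>carrier A. s\<^sup>\<star> = s \<and> p \<oplus> rsc e = s \<otimes> s"
proof -
  obtain r where r: "r \<ge> 0" "nrm A (rsc r \<ominus> p) \<le> r" using sqs_near_rsc[OF p] by blast
  have c: "p \<in> carrier A" "p\<^sup>\<star> = p" using sqs_closed[OF p] by auto
  obtain s where s: "s \<in> carrier A" "s\<^sup>\<star> = s" "rsc (r + e) \<ominus> (rsc r \<ominus> p) = s \<otimes> s"
    using rsc_minus_in_sqs[of "rsc r \<ominus> p" "r + e"] r e c by (auto simp: star_minus)
  have "rsc (r + e) \<ominus> (rsc r \<ominus> p) = p \<oplus> rsc e"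
    unfolding rsc_add[symmetric] using c rsc_closed[of r] rsc_closed[of e] by algebra
  then show ?thesis using s by auto
qed

lemma nrm_le_of_sqs_sum:
  assumes p: "p \<in> sqs" and q: "q \<in> sqs" and eq: "p \<oplus> q = rsc r" and r: "r \<ge> 0"
  shows "nrm A p \<le> r"
proof (rule field_le_epsilon)
  fix e :: real assume e: "e > 0"
  \<comment> \<open>One third of \<open>e\<close> is spent on \<open>p\<close>, one on
    \<open>q\<close>, and one on the way back from \<open>s \<otimes> s\<close> to
    \<open>p\<close>.\<close>
  obtain s where s: "s \<in> carrier A" "s\<^sup>\<star> = s" "p \<oplus> rsc (e / 3) = s \<otimes> s"
    using sqs_add_rsc_eq_square[OF p, of "e / 3"] e by auto
  obtain t where t: "t \<in> carrier A" "t\<^sup>\<star> = t" "q \<oplus> rsc (e / 3) = t \<otimes> t"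
    using sqs_add_rsc_eq_square[OF q, of "e / 3"] e by auto
  have c: "p \<in> carrier A" "q \<in> carrier A" using sqs_closed p q by auto
  have "s \<otimes> s \<oplus> t \<otimes> t = (p \<oplus> q) \<oplus> (rsc (e / 3) \<oplus> rsc (e / 3))"
    unfolding s(3)[symmetric] t(3)[symmetric] using c rsc_closed[of "e / 3"] by algebra
  also have "\<dots> = rsc (r + e / 3 + e / 3)" unfolding eq rsc_add by (simp only: add.assoc)
  finally have "(nrm A s)\<^sup>2 \<le> r + e / 3 + e / 3" using nrm_le_of_sum_squares s t r e by simp
  moreover have "nrm A (s \<otimes> s) \<le> (nrm A s)\<^sup>2" using nrm_mult[of s s] s by (simp add: power2_eq_square)
  moreover have "p = s \<otimes> s \<ominus> rsc (e / 3)"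
    unfolding s(3)[symmetric] using c rsc_closed[of "e / 3"] by algebra
  then have "nrm A p \<le> nrm A (s \<otimes> s) + nrm A (rsc (e / 3))" using nrm_minus_le[of "s \<otimes> s" "rsc (e / 3)"] s by simp
  moreover have "nrm A (rsc (e / 3)) \<le> e / 3" using nrm_rsc_le[of "e / 3"] e by simp
  ultimately show "nrm A p \<le> r + e" by simp
qed

text \<open>If \<open>b q = 1 + p\<close> with \<open>p\<close>, \<open>q\<close> positive and \<open>q \<le> M\<close>, then a lower bound \<open>-r \<le> 0\<close> of \<open>b\<close> improves
  to \<open>-r + 1/M\<close>, because \<open>M (b + r) = (M - q) (b + r) + (1 + p) + r q\<close>.\<close>

lemma sqs_of_mult_ge_one:
  assumes b: "b \<in> carrier A" "b\<^sup>\<star> = b" and p: "p \<in> sqs" and q: "q \<in> sqs" and eq: "b \<otimes> q = \<one> \<oplus> p"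
  shows "b \<in> sqs"
proof -
  have c: "p \<in> carrier A" "q \<in> carrier A" "q\<^sup>\<star> = q" using sqs_closed p q by auto
  define M where "M = nrm A q + 1"
  have M0: "M > 0" using c nrm_nonneg[of q] by (simp add: M_def)
  have M: "rsc M \<ominus> q \<in> sqs" using rsc_minus_in_sqs[of q M] c square by (auto simp: M_def)
  have step: "b \<oplus> rsc (r - 1 / M) \<in> sqs" if r: "b \<oplus> rsc r \<in> sqs" "r \<ge> 0" for r
  proof -
    define X where "X = (rsc M \<ominus> q) \<otimes> (b \<oplus> rsc r) \<oplus> p \<oplus> rsc r \<otimes> q"
    have X: "X \<in> sqs" unfolding X_def by (rule sqs.add[OF sqs.add[OF sqs_mult[OF M r(1)] p] sqs_mult[OF rsc_in_sqs[OF r(2)] q]])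
    have "\<one> \<oplus> X = (rsc M \<ominus> q) \<otimes> (b \<oplus> rsc r) \<oplus> (\<one> \<oplus> p) \<oplus> rsc r \<otimes> q"
      unfolding X_def using b(1) c(1,2) rsc_closed[of M] rsc_closed[of r] by algebra
    also have "\<dots> = rsc M \<otimes> (b \<oplus> rsc r)"
      unfolding eq[symmetric] using b(1) c(1,2) rsc_closed[of M] rsc_closed[of r] by algebra
    finally have "rsc (1 / M) \<otimes> (\<one> \<oplus> X) = (rsc (1 / M) \<otimes> rsc M) \<otimes> (b \<oplus> rsc r)"
      using b(1) m_assoc by simp
    then have "b \<oplus> rsc r = rsc (1 / M) \<otimes> (\<one> \<oplus> X)" using M0 b by (simp add: rsc_mult rsc_1)
    then have "(b \<oplus> rsc r) \<ominus> rsc (1 / M) = rsc (1 / M) \<otimes> X"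
      using sqs_closed[OF X] rsc_closed[of "1 / M"]
      by (simp add: r_distr minus_eq a_comm[of "rsc (1 / M)"] a_assoc r_neg)
    moreover have "(b \<oplus> rsc r) \<ominus> rsc (1 / M) = b \<oplus> rsc (r - 1 / M)"
      using b rsc_add[of r "- (1 / M)"] by (simp add: minus_eq rsc_uminus a_assoc)
    moreover have "rsc (1 / M) \<otimes> X \<in> sqs" using X rsc_in_sqs[of "1 / M"] M0 sqs_mult by simp
    ultimately show ?thesis by simp
  qed
  have neg: "b \<in> sqs" if "b \<oplus> rsc r \<in> sqs" "r \<le> 0" for r
    using sqs.add[OF that(1) rsc_in_sqs[of "- r"]] that(2) b by (simp add: a_assoc rsc_add rsc_0)
  \<comment> \<open>Every application of \<open>step\<close> lowers \<open>r\<close> by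
    \<open>1 / M\<close>, so \<open>n\<close> of them bring a value of at most \<open>n / M\<close>
    down to 0.\<close>
  have "b \<in> sqs" if "b \<oplus> rsc r \<in> sqs" "r \<le> real n / M" for n r
    using that
  proof (induction n arbitrary: r)
    case 0 then show ?case using neg by simp
  next
    case (Suc n)
    show ?case
    proof (cases "r \<le> 0")
      case True then show ?thesis using neg Suc.prems by blast
    next
      case False
      then have "b \<oplus> rsc (r - 1 / M) \<in> sqs" using step Suc.prems by simp
      moreover have "r - 1 / M \<le> real n / M" using Suc.prems(2) by (simp add: add_divide_distrib)
      ultimately show ?thesis using Suc.IH by blast
    qed
  qed
  moreover have "b \<oplus> rsc (nrm A b + 1) \<in> sqs"
  proof -
    obtain s where "s \<in> carrier A" "s\<^sup>\<star> = s" "rsc (nrm A b + 1) \<ominus> (\<ominus> b) = s \<otimes> s"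
      using rsc_minus_in_sqs[of "\<ominus> b" "nrm A b + 1"] b by (auto simp: star_uminus nrm_uminus)
    then show ?thesis using square[of s] b by (simp add: minus_eq minus_minus a_comm)
  qed
  moreover obtain n where "(nrm A b + 1) * M \<le> real n" using real_arch_simple by blast
  then have "nrm A b + 1 \<le> real n / M" using M0 by (simp add: field_simps)
  ultimately show ?thesis by blast
qed

text \<open>An equality would give \<open>b \<otimes> q = \<one> \<oplus> p\<close> for
  \<open>b = rsc e \<ominus> a\<close>, hence \<open>b\<close> would be positive by
  \<open>sqs_of_mult_ge_one\<close>. Then \<open>a\<close> and \<open>b\<close> are positive with
  sum \<open>rsc e\<close>, which bounds the norm of \<open>a\<close> by \<open>e\<close>.\<close>

lemma not_minus_one_in_extension:
  assumes a: "a \<in> sqs" and e: "0 \<le> e" "e < nrm A a" and p: "p \<in> sqs" and q: "q \<in> sqs"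
  shows "p \<oplus> (a \<ominus> rsc e) \<otimes> q \<noteq> \<ominus> \<one>"
proof
  assume eq: "p \<oplus> (a \<ominus> rsc e) \<otimes> q = \<ominus> \<one>"
  define b where "b = rsc e \<ominus> a"
  have c: "a \<in> carrier A" "a\<^sup>\<star> = a" "p \<in> carrier A" "q \<in> carrier A" using sqs_closed a p q by auto
  have b: "b \<in> carrier A" "b\<^sup>\<star> = b" using c by (auto simp: b_def star_minus)
  have "b \<otimes> q = p \<ominus> (p \<oplus> (a \<ominus> rsc e) \<otimes> q)"
    unfolding b_def using c rsc_closed[of e] by algebra
  also have "\<dots> = \<one> \<oplus> p" unfolding eq using c by (simp add: minus_eq minus_minus a_comm)
  finally have "b \<in> sqs" using sqs_of_mult_ge_one[OF b p q] by simp
  moreover have "a \<oplus> b = rsc e" unfolding b_def using c rsc_closed[of e] by algebra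
  ultimately show False using nrm_le_of_sqs_sum[OF a] e by fastforce
qed

section \<open>Preorderings in the sense of real algebra and their total extensions\<close>

definition preordering :: "'a set \<Rightarrow> bool" where
  "preordering Q \<longleftrightarrow> sqs \<subseteq> Q \<and> (\<forall>x\<in>Q. x \<in> carrier A \<and> x\<^sup>\<star> = x) \<and>
     (\<forall>x\<in>Q. \<forall>y\<in>Q. x \<oplus> y \<in> Q \<and> x \<otimes> y \<in> Q)"

lemma preordering_sqs: "preordering sqs"
  by (simp add: preordering_def sqs_closed sqs_mult sqs.add)

lemma preordering_extend:
  assumes Q: "preordering Q" and x: "x \<in> carrier A" "x\<^sup>\<star> = x"
  shows "preordering {p \<oplus> x \<otimes> q | p q. p \<in> Q \<and> q \<in> Q}" (is "preordering ?R")
    and "Q \<subseteq> {p \<oplus> x \<otimes> q | p q. p \<in> Q \<and> q \<in> Q}"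
    and "x \<in> {p \<oplus> x \<otimes> q | p q. p \<in> Q \<and> q \<in> Q}"
proof -
  have Qc: "\<And>p. p \<in> Q \<Longrightarrow> p \<in> carrier A" "\<And>p. p \<in> Q \<Longrightarrow> p\<^sup>\<star> = p"
    and Qa: "\<And>p q. p \<in> Q \<Longrightarrow> q \<in> Q \<Longrightarrow> p \<oplus> q \<in> Q" and Qm: "\<And>p q. p \<in> Q \<Longrightarrow> q \<in> Q \<Longrightarrow> p \<otimes> q \<in> Q"
    and Qs: "sqs \<subseteq> Q" using Q by (auto simp: preordering_def)
  have zo: "\<zero> \<in> Q" "\<one> \<in> Q" using Qs rsc_in_sqs[of 0] rsc_in_sqs[of 1] by (auto simp: rsc_0 rsc_1)
  have xx: "x \<otimes> x \<in> Q" using Qs square x by blast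
  show "Q \<subseteq> ?R"
  proof
    fix p assume p: "p \<in> Q"
    then have "p = p \<oplus> x \<otimes> \<zero>" using x Qc by simp
    then show "p \<in> ?R" using p zo by blast
  qed
  have "x = \<zero> \<oplus> x \<otimes> \<one>" using x by simp
  then show "x \<in> ?R" using zo by blast
  have "u \<oplus> v \<in> ?R \<and> u \<otimes> v \<in> ?R" if uv: "u \<in> ?R" "v \<in> ?R" for u v
  proof -
    obtain p q p' q' where u: "u = p \<oplus> x \<otimes> q" "p \<in> Q" "q \<in> Q" and v: "v = p' \<oplus> x \<otimes> q'" "p' \<in> Q" "q' \<in> Q"
      using uv by blast
    note cs = Qc(1)[OF u(2)] Qc(1)[OF u(3)] Qc(1)[OF v(2)] Qc(1)[OF v(3)]
    have "u \<oplus> v = (p \<oplus> p') \<oplus> x \<otimes> (q \<oplus> q')" unfolding u v using x cs by algebra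
    \<comment> \<open>The square \<open>x \<otimes> x\<close> already lies in \<open>Q\<close>, so
      the quadratic term joins the part free of \<open>x\<close>.\<close>
    moreover have "u \<otimes> v = (p \<otimes> p' \<oplus> (x \<otimes> x) \<otimes> (q \<otimes> q')) \<oplus> x \<otimes> (p \<otimes> q' \<oplus> p' \<otimes> q)"
      unfolding u v using x cs by algebra
    moreover have "p \<oplus> p' \<in> Q" "q \<oplus> q' \<in> Q" "p \<otimes> p' \<oplus> (x \<otimes> x) \<otimes> (q \<otimes> q') \<in> Q" "p \<otimes> q' \<oplus> p' \<otimes> q \<in> Q"
      using u v Qa Qm xx by auto
    ultimately show ?thesis by blast
  qed
  moreover have "u \<in> carrier A \<and> u\<^sup>\<star> = u" if "u \<in> ?R" for u
    using that x Qc by (auto simp: star_add star_mult m_comm)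
  ultimately show "preordering ?R" unfolding preordering_def using Qs \<open>Q \<subseteq> ?R\<close> by (intro conjI ballI) blast+
qed

text \<open>A maximal preordering without \<open>\<ominus> \<one>\<close> is total. If neither
  \<open>x\<close> nor its negative could be adjoined, then
  \<open>x \<otimes> q = \<ominus> \<one> \<ominus> p\<close> and
  \<open>x \<otimes> s = r \<oplus> \<one>\<close> with coefficients in \<open>Q\<close>; the
  product of these two equations expresses \<open>\<ominus> \<one>\<close> by members of
  \<open>Q\<close> and the square of \<open>x\<close>.\<close>

lemma ex_total_preordering:
  assumes R: "preordering R" "\<ominus> \<one> \<notin> R"
  shows "\<exists>Q. R \<subseteq> Q \<and> preordering Q \<and> \<ominus> \<one> \<notin> Q \<and> (\<forall>x\<in>carrier A. x\<^sup>\<star> = x \<longrightarrow> x \<in> Q \<or> \<ominus> x \<in> Q)"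
proof -
  define \<A> where "\<A> = {Q. R \<subseteq> Q \<and> preordering Q \<and> \<ominus> \<one> \<notin> Q}"
  have "\<exists>Q\<in>\<A>. \<forall>X\<in>\<A>. Q \<subseteq> X \<longrightarrow> X = Q"
  proof (rule subset_Zorn_nonempty)
    show "\<A> \<noteq> {}" using R by (auto simp: \<A>_def)
    fix \<C> assume \<C>: "\<C> \<noteq> {}" "subset.chain \<A> \<C>"
    then have sub: "\<C> \<subseteq> \<A>" by (simp add: subset_chain_def)
    have two: "\<exists>X\<in>\<C>. u \<in> X \<and> v \<in> X" if uv: "u \<in> \<Union>\<C>" "v \<in> \<Union>\<C>" for u v
    proof -
      obtain X Y where "X \<in> \<C>" "Y \<in> \<C>" "u \<in> X" "v \<in> Y" using uv by blast
      moreover then have "X \<subseteq> Y \<or> Y \<subseteq> X" using \<C>(2) by (auto simp: subset_chain_def)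
      ultimately show ?thesis by blast
    qed
    have ord: "preordering X" if "X \<in> \<C>" for X using that sub by (auto simp: \<A>_def)
    have "u \<oplus> v \<in> \<Union>\<C> \<and> u \<otimes> v \<in> \<Union>\<C>" if uv: "u \<in> \<Union>\<C>" "v \<in> \<Union>\<C>" for u v
    proof -
      obtain X where "X \<in> \<C>" "u \<in> X" "v \<in> X" using two[OF uv] by blast
      moreover from this have "u \<oplus> v \<in> X \<and> u \<otimes> v \<in> X"
        using ord[of X] by (simp add: preordering_def)
      ultimately show ?thesis by blast
    qed
    moreover have "u \<in> carrier A \<and> u\<^sup>\<star> = u" if "u \<in> \<Union>\<C>" for u
      using that ord by (auto simp: preordering_def)
    moreover have "R \<subseteq> \<Union>\<C>" "\<ominus> \<one> \<notin> \<Union>\<C>" using \<C>(1) sub by (auto simp: \<A>_def)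
    moreover then have "sqs \<subseteq> \<Union>\<C>" using R(1) by (auto simp: preordering_def)
    ultimately show "\<Union>\<C> \<in> \<A>" unfolding \<A>_def preordering_def by blast
  qed
  then obtain Q where Q: "R \<subseteq> Q" "preordering Q" "\<ominus> \<one> \<notin> Q"
    and max: "\<And>X. R \<subseteq> X \<Longrightarrow> preordering X \<Longrightarrow> \<ominus> \<one> \<notin> X \<Longrightarrow> Q \<subseteq> X \<Longrightarrow> X = Q"
    by (auto simp: \<A>_def)
  have Qc: "\<And>p. p \<in> Q \<Longrightarrow> p \<in> carrier A"
    and Qa: "\<And>p q. p \<in> Q \<Longrightarrow> q \<in> Q \<Longrightarrow> p \<oplus> q \<in> Q" and Qm: "\<And>p q. p \<in> Q \<Longrightarrow> q \<in> Q \<Longrightarrow> p \<otimes> q \<in> Q"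
    and Qs: "sqs \<subseteq> Q" using Q(2) by (auto simp: preordering_def)
  have ext: "\<exists>p q. p \<in> Q \<and> q \<in> Q \<and> \<ominus> \<one> = p \<oplus> x \<otimes> q" if x: "x \<in> carrier A" "x\<^sup>\<star> = x" "x \<notin> Q" for x
  proof (rule ccontr)
    assume "\<not> ?thesis"
    then have "{p \<oplus> x \<otimes> q | p q. p \<in> Q \<and> q \<in> Q} = Q"
      using preordering_extend[OF Q(2) x(1,2)] Q(1) by (intro max) blast+
    then show False using preordering_extend(3)[OF Q(2) x(1,2)] x(3) by simp
  qed
  have "x \<in> Q \<or> \<ominus> x \<in> Q" if x: "x \<in> carrier A" "x\<^sup>\<star> = x" for x
  proof (rule ccontr)
    assume *: "\<not> ?thesis"
    obtain p q where 1: "p \<in> Q" "q \<in> Q" "\<ominus> \<one> = p \<oplus> x \<otimes> q" using ext[of x] x * by auto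
    obtain r s where 2: "r \<in> Q" "s \<in> Q" "\<ominus> \<one> = r \<oplus> \<ominus> x \<otimes> s"
      using ext[of "\<ominus> x"] x * by (auto simp: star_uminus)
    note cs = Qc[OF 1(1)] Qc[OF 1(2)] Qc[OF 2(1)] Qc[OF 2(2)]
    have "x \<otimes> q = \<ominus> \<one> \<ominus> p" unfolding 1(3) using x cs by algebra
    moreover have "x \<otimes> s = r \<oplus> \<one>"
    proof -
      have "x \<otimes> s = r \<ominus> (r \<oplus> \<ominus> x \<otimes> s)" using x cs by algebra
      also have "\<dots> = r \<oplus> \<one>" unfolding 2(3)[symmetric] using cs by (simp add: minus_eq minus_minus)
      finally show ?thesis .
    qed
    ultimately have "(x \<otimes> q) \<otimes> (x \<otimes> s) = (\<ominus> \<one> \<ominus> p) \<otimes> (r \<oplus> \<one>)" by simp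
    then have "p \<oplus> r \<oplus> p \<otimes> r \<oplus> (x \<otimes> x) \<otimes> (q \<otimes> s) = p \<oplus> r \<oplus> p \<otimes> r \<oplus> (\<ominus> \<one> \<ominus> p) \<otimes> (r \<oplus> \<one>)"
      using x cs by (simp add: m_ac)
    also have "\<dots> = \<ominus> \<one>" using x cs by algebra
    finally have "\<ominus> \<one> = p \<oplus> r \<oplus> p \<otimes> r \<oplus> (x \<otimes> x) \<otimes> (q \<otimes> s)" by simp
    moreover have "x \<otimes> x \<in> Q" using Qs square x by blast
    ultimately have "\<ominus> \<one> \<in> Q" using 1 2 Qa Qm by simp
    then show False using Q(3) by simp
  qed
  then show ?thesis using Q by blast
qed

end

section \<open>Characters of abelian C*-algebras\<close>

text \<open>Unlike states, characters are not made \<open>extensional\<close>; they are restricted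
  to the carrier when they serve as states.\<close>

definition character :: "'a cstar \<Rightarrow> ('a \<Rightarrow> complex) \<Rightarrow> bool" where
  "character A \<sigma> \<longleftrightarrow>
     (\<forall>x\<in>carrier A. \<forall>y\<in>carrier A. \<sigma> (x \<oplus>\<^bsub>A\<^esub> y) = \<sigma> x + \<sigma> y \<and> \<sigma> (x \<otimes>\<^bsub>A\<^esub> y) = \<sigma> x * \<sigma> y) \<and>
     (\<forall>x\<in>carrier A. \<sigma> (x\<^sup>\<star>\<^bsub>A\<^esub>) = cnj (\<sigma> x) \<and> (\<forall>a. \<sigma> (a \<odot>\<^bsub>A\<^esub> x) = a * \<sigma> x)) \<and> \<sigma> \<one>\<^bsub>A\<^esub> = 1"

locale total_preordering = abelian_cstar_algebra A for A :: "'a cstar" (structure) +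
  fixes Q :: "'a set"
  assumes pre: "preordering Q" and minus_one: "\<ominus> \<one> \<notin> Q"
    and total: "\<lbrakk>x \<in> carrier A; x\<^sup>\<star> = x\<rbrakk> \<Longrightarrow> x \<in> Q \<or> \<ominus> x \<in> Q"
begin

lemma Q_add: "\<lbrakk>x \<in> Q; y \<in> Q\<rbrakk> \<Longrightarrow> x \<oplus> y \<in> Q"
  and Q_mult: "\<lbrakk>x \<in> Q; y \<in> Q\<rbrakk> \<Longrightarrow> x \<otimes> y \<in> Q"
  and Q_rsc: "t \<ge> 0 \<Longrightarrow> rsc t \<in> Q"
  using pre rsc_in_sqs by (auto simp: preordering_def)

lemma rsc_in_Q: assumes "rsc t \<in> Q" shows "t \<ge> 0"
proof (rule ccontr)
  assume t: "\<not> t \<ge> 0"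
  then have "0 \<le> 1 / - t" by simp
  then have "rsc (1 / - t) \<otimes> rsc t \<in> Q" using assms Q_mult Q_rsc by blast
  moreover have "rsc (1 / - t) \<otimes> rsc t = \<ominus> \<one>" using t by (simp add: rsc_mult rsc_uminus flip: rsc_1)
  ultimately show False using minus_one by simp
qed

lemma Q_upper:
  assumes x: "x \<in> carrier A" "x\<^sup>\<star> = x"
  shows "rsc (nrm A x + 1) \<ominus> x \<in> Q" "x \<oplus> rsc (nrm A x + 1) \<in> Q"
proof -
  have *: "rsc (nrm A y + 1) \<ominus> y \<in> Q" if "y \<in> carrier A" "y\<^sup>\<star> = y" for y
    using rsc_minus_in_sqs[of y "nrm A y + 1"] that square pre by (auto simp: preordering_def)
  show "rsc (nrm A x + 1) \<ominus> x \<in> Q" using *[OF x] .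
  show "x \<oplus> rsc (nrm A x + 1) \<in> Q"
  proof -
    have "rsc (nrm A x + 1) \<ominus> (\<ominus> x) = x \<oplus> rsc (nrm A x + 1)"
      using x rsc_closed[of "nrm A x + 1"] by algebra
    moreover have "rsc (nrm A (\<ominus> x) + 1) \<ominus> (\<ominus> x) \<in> Q"
      using *[of "\<ominus> x"] x by (simp only: star_uminus a_inv_closed)
    ultimately show ?thesis using x by (simp only: nrm_uminus)
  qed
qed

text \<open>\<open>Q\<close> plays the role of \<open>{x. \<sigma> x \<ge> 0}\<close> for the character \<open>\<sigma>\<close> to be constructed, and
  \<open>near x c\<close> says \<open>\<sigma> x = c\<close>.\<close>

definition near :: "'a \<Rightarrow> real \<Rightarrow> bool" where
  "near x c \<longleftrightarrow> (\<forall>e>0. x \<oplus> rsc (e - c) \<in> Q \<and> \<ominus> x \<oplus> rsc (e + c) \<in> Q)"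

lemma nearD1: "near x c \<Longrightarrow> e > 0 \<Longrightarrow> x \<oplus> rsc (e - c) \<in> Q"
  and nearD2: "near x c \<Longrightarrow> e > 0 \<Longrightarrow> \<ominus> x \<oplus> rsc (e + c) \<in> Q"
  by (auto simp: near_def)

text \<open>The value is the supremum of the cut \<open>T\<close>. Above the supremum membership
  fails, and totality of \<open>Q\<close> then puts the negative into \<open>Q\<close>, which is the
  upper estimate.\<close>

lemma near_ex:
  assumes x: "x \<in> carrier A" "x\<^sup>\<star> = x"
  shows "\<exists>c. near x c"
proof -
  define T where "T = {t. x \<oplus> rsc (- t) \<in> Q}"
  have ne: "- (nrm A x + 1) \<in> T" using Q_upper(2)[OF x] by (simp only: T_def mem_Collect_eq group_add_class.minus_minus)
  have up: "t \<le> nrm A x + 1" if "t \<in> T" for t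
  proof -
    have "(rsc (nrm A x + 1) \<ominus> x) \<oplus> (x \<oplus> rsc (- t)) \<in> Q"
      using that by (intro Q_add[OF Q_upper(1)[OF x]]) (simp add: T_def)
    moreover have "(rsc (nrm A x + 1) \<ominus> x) \<oplus> (x \<oplus> rsc (- t)) = rsc (nrm A x + 1) \<oplus> rsc (- t)"
      using x rsc_closed[of "- t"] rsc_closed[of "nrm A x + 1"] by algebra
    ultimately show ?thesis using rsc_in_Q[of "nrm A x + 1 - t"] by (simp add: rsc_add)
  qed
  then have bdd: "bdd_above T" by (rule bdd_aboveI)
  have "near x (Sup T)"
    unfolding near_def
  proof (intro allI impI conjI)
    fix e :: real assume e: "e > 0"
    obtain t where t: "t \<in> T" "Sup T - e < t" using less_cSup_iff[of T "Sup T - e"] ne bdd e by auto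
    have "(x \<oplus> rsc (- t)) \<oplus> rsc (t - Sup T + e) \<in> Q" by (rule Q_add[OF _ Q_rsc]) (use t in \<open>auto simp: T_def\<close>)
    then show "x \<oplus> rsc (e - Sup T) \<in> Q" using x by (simp add: a_assoc rsc_add)
    have "Sup T + e \<notin> T" using cSup_upper[OF _ bdd, of "Sup T + e"] e by auto
    then have "\<ominus> (x \<oplus> rsc (- (Sup T + e))) \<in> Q"
      using total[of "x \<oplus> rsc (- (Sup T + e))"] x by (auto simp: T_def star_add)
    moreover have "\<ominus> (x \<oplus> rsc (- (Sup T + e))) = \<ominus> x \<oplus> rsc (e + Sup T)"
      using x by (simp add: minus_add rsc_uminus add.commute)
    ultimately show "\<ominus> x \<oplus> rsc (e + Sup T) \<in> Q" by simp
  qed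
  then show ?thesis ..
qed

lemma near_le:
  assumes x: "x \<in> carrier A" and c: "near x c" and d: "near x d"
  shows "c \<le> d"
proof (rule field_le_epsilon)
  fix e :: real assume e: "e > 0"
  have "(x \<oplus> rsc (e / 2 - c)) \<oplus> (\<ominus> x \<oplus> rsc (e / 2 + d)) \<in> Q"
    using c d e by (auto intro!: Q_add[OF nearD1 nearD2])
  moreover have "(x \<oplus> rsc (e / 2 - c)) \<oplus> (\<ominus> x \<oplus> rsc (e / 2 + d)) = rsc (e / 2 - c) \<oplus> rsc (e / 2 + d)"
    using x rsc_closed[of "e / 2 - c"] rsc_closed[of "e / 2 + d"] by algebra
  ultimately have "rsc (e + d - c) \<in> Q" by (simp add: rsc_add algebra_simps)
  then show "c \<le> d + e" using rsc_in_Q by fastforce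
qed

lemma near_rsc: "near (rsc t) t"
  by (simp add: near_def rsc_uminus rsc_add Q_rsc)

lemma near_add:
  assumes "x \<in> carrier A" "y \<in> carrier A" "near x c" "near y d"
  shows "near (x \<oplus> y) (c + d)"
  unfolding near_def
proof (intro allI impI conjI)
  fix e :: real assume e: "e > 0"
  have "(x \<oplus> rsc (e / 2 - c)) \<oplus> (y \<oplus> rsc (e / 2 - d)) \<in> Q"
    using assms e by (auto intro!: Q_add[OF nearD1 nearD1])
  moreover have "(x \<oplus> rsc (e / 2 - c)) \<oplus> (y \<oplus> rsc (e / 2 - d)) = (x \<oplus> y) \<oplus> (rsc (e / 2 - c) \<oplus> rsc (e / 2 - d))"
    using assms rsc_closed[of "e / 2 - c"] rsc_closed[of "e / 2 - d"] by algebra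
  moreover have "rsc (e / 2 - c) \<oplus> rsc (e / 2 - d) = rsc (e - (c + d))" by (simp add: rsc_add algebra_simps)
  ultimately show "(x \<oplus> y) \<oplus> rsc (e - (c + d)) \<in> Q" by simp
  have "(\<ominus> x \<oplus> rsc (e / 2 + c)) \<oplus> (\<ominus> y \<oplus> rsc (e / 2 + d)) \<in> Q"
    using assms e by (auto intro!: Q_add[OF nearD2 nearD2])
  moreover have "(\<ominus> x \<oplus> rsc (e / 2 + c)) \<oplus> (\<ominus> y \<oplus> rsc (e / 2 + d)) = \<ominus> (x \<oplus> y) \<oplus> (rsc (e / 2 + c) \<oplus> rsc (e / 2 + d))"
    using assms rsc_closed[of "e / 2 + c"] rsc_closed[of "e / 2 + d"] by algebra
  moreover have "rsc (e / 2 + c) \<oplus> rsc (e / 2 + d) = rsc (e + (c + d))" by (simp add: rsc_add algebra_simps)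
  ultimately show "\<ominus> (x \<oplus> y) \<oplus> rsc (e + (c + d)) \<in> Q" by simp
qed

text \<open>With \<open>\<bar>y\<bar> \<le> M\<close> and \<open>d * M = e\<close> the point is the
  identity \<open>2 (x y + d M) = (x + d) (y + M) + (d - x) (M - y)\<close>, whose right side is
  built from members of \<open>Q\<close>; flipping the sign of \<open>y\<close> gives the other
  estimate.\<close>

lemma near_mult_0:
  assumes x: "x \<in> carrier A" "near x 0" and y: "y \<in> carrier A" "y\<^sup>\<star> = y"
  shows "near (x \<otimes> y) 0"
  unfolding near_def
proof (intro allI impI conjI)
  fix e :: real assume e: "e > 0"
  define M where "M = nrm A y + 1"
  have M: "M > 0" using nrm_nonneg[OF y(1)] by (simp add: M_def)
  define d where "d = e / M"
  have d: "d > 0" "d * M = e" using e M by (auto simp: d_def)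
  have xd: "x \<oplus> rsc d \<in> Q" "\<ominus> x \<oplus> rsc d \<in> Q" using x(2) d by (auto simp: near_def)
  have yM: "rsc M \<ominus> y \<in> Q" "y \<oplus> rsc M \<in> Q" using Q_upper[OF y] by (auto simp: M_def)
  \<comment> \<open>The identities produce twice the wanted element; the scalar one half is
    nonnegative, so multiplying by it stays inside \<open>Q\<close>.\<close>
  have half: "p \<in> Q" if "p \<oplus> p \<in> Q" "p \<in> carrier A" for p
  proof -
    have "rsc (1/2) \<otimes> (p \<oplus> p) = (rsc (1/2) \<oplus> rsc (1/2)) \<otimes> p" using that(2) rsc_closed[of "1/2"] by algebra
    then have "rsc (1/2) \<otimes> (p \<oplus> p) = p" using that(2) by (simp add: rsc_add rsc_1)
    then show ?thesis using Q_mult[OF Q_rsc that(1), of "1/2"] by simp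
  qed
  have "(x \<oplus> rsc d) \<otimes> (y \<oplus> rsc M) \<oplus> (\<ominus> x \<oplus> rsc d) \<otimes> (rsc M \<ominus> y) \<in> Q"
    by (rule Q_add[OF Q_mult Q_mult]; fact)
  moreover have "(x \<oplus> rsc d) \<otimes> (y \<oplus> rsc M) \<oplus> (\<ominus> x \<oplus> rsc d) \<otimes> (rsc M \<ominus> y)
      = (x \<otimes> y \<oplus> rsc d \<otimes> rsc M) \<oplus> (x \<otimes> y \<oplus> rsc d \<otimes> rsc M)"
    using x y rsc_closed[of d] rsc_closed[of M] by algebra
  ultimately show "x \<otimes> y \<oplus> rsc (e - 0) \<in> Q"
    using half[of "x \<otimes> y \<oplus> rsc d \<otimes> rsc M"] x(1) y(1) d(2) by (simp add: rsc_mult)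
  have "(x \<oplus> rsc d) \<otimes> (rsc M \<ominus> y) \<oplus> (\<ominus> x \<oplus> rsc d) \<otimes> (y \<oplus> rsc M) \<in> Q"
    by (rule Q_add[OF Q_mult Q_mult]; fact)
  moreover have "(x \<oplus> rsc d) \<otimes> (rsc M \<ominus> y) \<oplus> (\<ominus> x \<oplus> rsc d) \<otimes> (y \<oplus> rsc M)
      = (\<ominus> (x \<otimes> y) \<oplus> rsc d \<otimes> rsc M) \<oplus> (\<ominus> (x \<otimes> y) \<oplus> rsc d \<otimes> rsc M)"
    using x y rsc_closed[of d] rsc_closed[of M] by algebra
  ultimately show "\<ominus> (x \<otimes> y) \<oplus> rsc (e + 0) \<in> Q"
    using half[of "\<ominus> (x \<otimes> y) \<oplus> rsc d \<otimes> rsc M"] x(1) y(1) d(2) by (simp add: rsc_mult)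
qed

text \<open>The identity \<open>x y - c d = (x - c) y + (y - d) c\<close> reduces the claim to
  factors of value 0.\<close>

lemma near_mult:
  assumes x: "x \<in> carrier A" "x\<^sup>\<star> = x" "near x c" and y: "y \<in> carrier A" "y\<^sup>\<star> = y" "near y d"
  shows "near (x \<otimes> y) (c * d)"
proof -
  have "near (x \<oplus> rsc (- c)) (c + - c)" "near (y \<oplus> rsc (- d)) (d + - d)"
    using x y near_rsc by (intro near_add; simp)+
  then have "near ((x \<oplus> rsc (- c)) \<otimes> y) 0" "near ((y \<oplus> rsc (- d)) \<otimes> rsc c) 0"
    using x y by (intro near_mult_0; simp)+
  then have "near ((x \<oplus> rsc (- c)) \<otimes> y \<oplus> (y \<oplus> rsc (- d)) \<otimes> rsc c) (0 + 0)"
    using x y by (intro near_add) auto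
  then have "near (((x \<oplus> rsc (- c)) \<otimes> y \<oplus> (y \<oplus> rsc (- d)) \<otimes> rsc c) \<oplus> rsc (c * d)) (0 + 0 + c * d)"
    using x y near_rsc by (intro near_add[OF _ _ _ near_rsc]) auto
  moreover have "((x \<oplus> rsc (- c)) \<otimes> y \<oplus> (y \<oplus> rsc (- d)) \<otimes> rsc c) \<oplus> rsc (c * d) = x \<otimes> y"
    unfolding rsc_uminus[symmetric] rsc_mult[symmetric]
    using x y rsc_closed[of c] rsc_closed[of d] by algebra
  ultimately show ?thesis by simp
qed

definition val :: "'a \<Rightarrow> real" where "val x = (THE c. near x c)"

lemma val_eqI: "\<lbrakk>x \<in> carrier A; near x c\<rbrakk> \<Longrightarrow> val x = c"
  unfolding val_def using near_le by (intro the_equality antisym) auto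

lemma near_val: "\<lbrakk>x \<in> carrier A; x\<^sup>\<star> = x\<rbrakk> \<Longrightarrow> near x (val x)"
  using near_ex val_eqI by metis

definition chi :: "'a \<Rightarrow> complex" where
  "chi x = Complex (val ((1/2) \<odot> (x \<oplus> x\<^sup>\<star>))) (val ((- \<i> / 2) \<odot> (x \<oplus> (- 1) \<odot> x\<^sup>\<star>)))"

lemma chi_eq:
  assumes h: "h \<in> carrier A" "h\<^sup>\<star> = h" and k: "k \<in> carrier A" "k\<^sup>\<star> = k"
  shows "chi (h \<oplus> \<i> \<odot> k) = Complex (val h) (val k)"
proof -
  have canc: "a \<oplus> (b \<oplus> (a \<oplus> (- 1) \<odot> b)) = 2 \<odot> a" if "a \<in> carrier A" "b \<in> carrier A" for a b
  proof -
    have "a \<oplus> (b \<oplus> (a \<oplus> (- 1) \<odot> b)) = (1 \<odot> a \<oplus> 1 \<odot> a) \<oplus> (1 \<odot> b \<oplus> (- 1) \<odot> b)"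
      using that by (simp add: a_ac)
    also have "\<dots> = 2 \<odot> a"
      using that smult_add_left[of a 1 1] smult_add_left[of b 1 "- 1"] by simp
    finally show ?thesis .
  qed
  have s: "(h \<oplus> \<i> \<odot> k)\<^sup>\<star> = h \<oplus> (- 1) \<odot> (\<i> \<odot> k)" using h k by (simp add: star_add star_smult)
  have "(h \<oplus> \<i> \<odot> k) \<oplus> (h \<oplus> \<i> \<odot> k)\<^sup>\<star> = 2 \<odot> h"
    unfolding s using canc[of h "\<i> \<odot> k"] h k by (simp add: a_assoc)
  moreover have "(h \<oplus> \<i> \<odot> k) \<oplus> (- 1) \<odot> (h \<oplus> \<i> \<odot> k)\<^sup>\<star> = 2 \<odot> (\<i> \<odot> k)"
  proof -
    have "(h \<oplus> \<i> \<odot> k) \<oplus> (- 1) \<odot> (h \<oplus> \<i> \<odot> k)\<^sup>\<star> = (h \<oplus> \<i> \<odot> k) \<oplus> ((- 1) \<odot> h \<oplus> \<i> \<odot> k)"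
      unfolding s using h k by (simp add: smult_add_right)
    also have "\<dots> = \<i> \<odot> k \<oplus> (h \<oplus> (\<i> \<odot> k \<oplus> (- 1) \<odot> h))" using h k by (simp add: a_ac)
    finally show ?thesis using canc[of "\<i> \<odot> k" h] h k by simp
  qed
  ultimately show ?thesis using h k by (simp add: chi_def)
qed

lemma val_add: "\<lbrakk>x \<in> carrier A; x\<^sup>\<star> = x; y \<in> carrier A; y\<^sup>\<star> = y\<rbrakk> \<Longrightarrow> val (x \<oplus> y) = val x + val y"
  by (intro val_eqI near_add near_val) auto

lemma val_mult: "\<lbrakk>x \<in> carrier A; x\<^sup>\<star> = x; y \<in> carrier A; y\<^sup>\<star> = y\<rbrakk> \<Longrightarrow> val (x \<otimes> y) = val x * val y"
  by (intro val_eqI near_mult near_val) auto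

lemma val_smult: "\<lbrakk>x \<in> carrier A; x\<^sup>\<star> = x\<rbrakk> \<Longrightarrow> val (of_real t \<odot> x) = t * val x"
  using val_mult[of "rsc t" x] val_eqI[OF _ near_rsc, of t] by (simp add: rsc_smult)

lemma chi_add: assumes "x \<in> carrier A" "y \<in> carrier A" shows "chi (x \<oplus> y) = chi x + chi y"
proof -
  obtain h k h' k' where d: "h \<in> carrier A" "h\<^sup>\<star> = h" "k \<in> carrier A" "k\<^sup>\<star> = k" "x = h \<oplus> \<i> \<odot> k"
    "h' \<in> carrier A" "h'\<^sup>\<star> = h'" "k' \<in> carrier A" "k'\<^sup>\<star> = k'" "y = h' \<oplus> \<i> \<odot> k'"
    using decompose[OF assms(1)] decompose[OF assms(2)] by blast
  have "x \<oplus> y = (h \<oplus> h') \<oplus> \<i> \<odot> (k \<oplus> k')" using d by (simp add: smult_add_right a_ac)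
  then show ?thesis using d by (simp add: chi_eq star_add val_add complex_eq_iff)
qed

lemma chi_mult: assumes "x \<in> carrier A" "y \<in> carrier A" shows "chi (x \<otimes> y) = chi x * chi y"
proof -
  obtain h k h' k' where d: "h \<in> carrier A" "h\<^sup>\<star> = h" "k \<in> carrier A" "k\<^sup>\<star> = k" "x = h \<oplus> \<i> \<odot> k"
    "h' \<in> carrier A" "h'\<^sup>\<star> = h'" "k' \<in> carrier A" "k'\<^sup>\<star> = k'" "y = h' \<oplus> \<i> \<odot> k'"
    using decompose[OF assms(1)] decompose[OF assms(2)] by blast
  have "x \<otimes> y = (h \<otimes> h' \<oplus> of_real (- 1) \<odot> (k \<otimes> k')) \<oplus> \<i> \<odot> (h \<otimes> k' \<oplus> k \<otimes> h')"
    using d by (simp add: smult_add_right l_distr r_distr smult_mult_left smult_mult_right a_ac)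
  moreover have "(h \<otimes> h' \<oplus> of_real (- 1) \<odot> (k \<otimes> k'))\<^sup>\<star> = h \<otimes> h' \<oplus> of_real (- 1) \<odot> (k \<otimes> k')"
    "(h \<otimes> k' \<oplus> k \<otimes> h')\<^sup>\<star> = h \<otimes> k' \<oplus> k \<otimes> h'"
    using d by (simp_all add: star_add star_mult star_smult m_comm[of h'] m_comm[of k'])
  moreover have "val (h \<otimes> h' \<oplus> of_real (- 1) \<odot> (k \<otimes> k')) = val h * val h' - val k * val k'"
    using d by (subst val_add) (simp_all only: val_smult val_mult star_smult star_mult m_comm[of h'] m_comm[of k']
       m_closed smult_closed, simp_all)
  moreover have "val (h \<otimes> k' \<oplus> k \<otimes> h') = val h * val k' + val k * val h'"
    using d by (subst val_add) (simp_all add: val_mult star_mult m_comm[of h'] m_comm[of k'])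
  ultimately show ?thesis using d by (simp add: chi_eq complex_eq_iff)
qed

lemma character_chi: "character A chi"
proof -
  have sm: "chi (a \<odot> x) = a * chi x" if x: "x \<in> carrier A" for a x
  proof -
    have "a \<odot> \<one> = rsc (Re a) \<oplus> \<i> \<odot> rsc (Im a)"
      by (simp add: rsc_def flip: smult_add_left complex_eq)
    then have "chi (a \<odot> \<one>) = a"
      using chi_eq[of "rsc (Re a)" "rsc (Im a)"] by (simp add: val_eqI[OF _ near_rsc])
    moreover have "a \<odot> x = (a \<odot> \<one>) \<otimes> x" using x by (simp add: smult_mult_left)
    ultimately show ?thesis using x chi_mult by simp
  qed
  have st: "chi (x\<^sup>\<star>) = cnj (chi x)" if x: "x \<in> carrier A" for x
  proof -
    obtain h k where d: "h \<in> carrier A" "h\<^sup>\<star> = h" "k \<in> carrier A" "k\<^sup>\<star> = k" "x = h \<oplus> \<i> \<odot> k"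
      using decompose[OF x] by blast
    have "x\<^sup>\<star> = h \<oplus> \<i> \<odot> (of_real (- 1) \<odot> k)" using d by (simp add: star_add star_smult)
    moreover have "(of_real (- 1) \<odot> k)\<^sup>\<star> = of_real (- 1) \<odot> k" using d by (simp add: star_smult)
    ultimately show ?thesis using d chi_eq[of h "of_real (- 1) \<odot> k"] val_smult[of k "- 1"]
      by (simp add: chi_eq complex_eq_iff)
  qed
  have "chi \<one> = 1" using chi_eq[of "rsc 1" "rsc 0"]
    by (simp add: val_eqI[OF _ near_rsc] complex_eq_iff) (simp add: rsc_1 rsc_0 complex_eq_iff)
  then show ?thesis using chi_add chi_mult sm st by (simp add: character_def)
qed

lemma val_ge: assumes "a \<in> carrier A" "a\<^sup>\<star> = a" "a \<ominus> rsc e \<in> Q" shows "e \<le> val a"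
proof (rule field_le_epsilon)
  fix d :: real assume d: "d > 0"
  have "(a \<ominus> rsc e) \<oplus> (\<ominus> a \<oplus> rsc (d + val a)) \<in> Q"
    using assms(3) near_val[OF assms(1,2)] d by (auto intro!: Q_add[OF _ nearD2])
  moreover have "(a \<ominus> rsc e) \<oplus> (\<ominus> a \<oplus> rsc (d + val a)) = rsc (d + val a) \<ominus> rsc e"
    using assms(1) rsc_closed[of "d + val a"] rsc_closed[of e] by algebra
  ultimately have "rsc (d + val a - e) \<in> Q" by (simp add: minus_eq rsc_uminus rsc_add)
  then show "e \<le> val a + d" using rsc_in_Q by fastforce
qed

end

context abelian_cstar_algebra
begin

lemma star_mult_in_sqs: assumes x: "x \<in> carrier A" shows "x\<^sup>\<star> \<otimes> x \<in> sqs"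
proof -
  obtain h k where hk: "h \<in> carrier A" "h\<^sup>\<star> = h" "k \<in> carrier A" "k\<^sup>\<star> = k" "x = h \<oplus> \<i> \<odot> k"
    using decompose[OF x] by blast
  have "x\<^sup>\<star> \<otimes> x = (h \<otimes> h \<oplus> k \<otimes> k) \<oplus> (\<i> \<odot> (h \<otimes> k) \<oplus> (- \<i>) \<odot> (h \<otimes> k))"
    using hk m_comm[of k h]
    by (simp add: star_add star_smult l_distr r_distr smult_mult_left smult_mult_right smult_add_right a_ac)
  also have "\<i> \<odot> (h \<otimes> k) \<oplus> (- \<i>) \<odot> (h \<otimes> k) = \<zero>"
    using hk smult_add_left[of "h \<otimes> k" \<i> "-\<i>"] by simp
  finally show ?thesis using hk by (simp add: sqs.add square)
qed

text \<open>Half the norm of \<open>a\<close> is a threshold \<open>e\<close> strictly between 0 and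
  that norm, so adjoining \<open>a \<ominus> rsc e\<close> to the cone does not produce
  \<open>\<ominus> \<one>\<close>. A total extension contains \<open>a \<ominus> rsc e\<close>, and
  its character is at least \<open>e\<close> at \<open>a\<close>.\<close>

lemma ex_character:
  assumes d: "d \<in> carrier A" "d \<noteq> \<zero>"
  shows "\<exists>\<sigma>. character A \<sigma> \<and> \<sigma> (d\<^sup>\<star> \<otimes> d) \<noteq> 0"
proof -
  define a where "a = d\<^sup>\<star> \<otimes> d"
  define e where "e = nrm A a / 2"
  have "nrm A a = (nrm A d)\<^sup>2" using cstar_identity[OF d(1)] by (simp add: a_def)
  then have na: "nrm A a > 0" using d nrm_eq_0_iff[OF d(1)] by simp
  have a: "a \<in> sqs" "a \<in> carrier A" "a\<^sup>\<star> = a" using d star_mult_in_sqs by (auto simp: a_def star_mult)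
  define R where "R = {p \<oplus> (a \<ominus> rsc e) \<otimes> q | p q. p \<in> sqs \<and> q \<in> sqs}"
  have R: "preordering R" "a \<ominus> rsc e \<in> R"
    using preordering_extend[OF preordering_sqs, of "a \<ominus> rsc e"] a by (auto simp: R_def star_minus)
  have "\<ominus> \<one> \<notin> R"
  proof
    assume "\<ominus> \<one> \<in> R"
    then obtain p q where "p \<in> sqs" "q \<in> sqs" "\<ominus> \<one> = p \<oplus> (a \<ominus> rsc e) \<otimes> q" by (auto simp: R_def)
    then show False using not_minus_one_in_extension[OF a(1), of e p q] na by (simp add: e_def)
  qed
  then obtain Q where Q: "R \<subseteq> Q" "preordering Q" "\<ominus> \<one> \<notin> Q"
    "\<forall>x\<in>carrier A. x\<^sup>\<star> = x \<longrightarrow> x \<in> Q \<or> \<ominus> x \<in> Q" using ex_total_preordering[OF R(1)] by blast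
  interpret T: total_preordering A Q using Q by unfold_locales auto
  have "e \<le> T.val a" using T.val_ge a R(2) Q(1) by blast
  moreover have "T.chi a = Complex (T.val a) (T.val (rsc 0))"
    using T.chi_eq[of a "rsc 0"] a by (simp add: rsc_0)
  ultimately have "T.chi a \<noteq> 0" using na by (auto simp: e_def complex_eq_iff)
  then show ?thesis using T.character_chi by (auto simp: a_def)
qed

end

section \<open>Compatible states from C*-diagonals\<close>

lemma cstar_stateI: "cstar_algebra A \<Longrightarrow> state A \<rho> \<Longrightarrow> cstar_state A \<rho>"
  by (simp add: cstar_state_def cstar_state_axioms_def)

lemma state_character:
  fixes A :: "'a cstar" (structure)
  assumes "cstar_algebra A" "character A \<sigma>"
  shows "state A (restrict \<sigma> (carrier A))"
proof -
  interpret cstar_algebra A by fact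
  show ?thesis
    using assms(2) by (auto simp: state_def character_def complex_nonneg_Reals_iff)
qed

text \<open>For \<open>z = x \<oplus> (- \<sigma> x) \<odot> \<one>\<close> the character vanishes
  at \<open>z\<^sup>\<star> \<otimes> z\<close>. Both components of a convex combination are
  nonnegative there, hence 0, and by Cauchy--Schwarz they vanish at \<open>z\<close> too.\<close>

lemma pure_state_character:
  fixes A :: "'a cstar" (structure)
  assumes A: "cstar_algebra A" and \<sigma>: "character A \<sigma>"
  shows "pure_state A (restrict \<sigma> (carrier A))"
proof -
  interpret cstar_algebra A by fact
  have main: "\<sigma>\<^sub>1 = restrict \<sigma> (carrier A)"
    if st: "state A \<sigma>\<^sub>1" "state A \<tau>" and t: "0 < t" "t < 1"
      and eq: "\<forall>x\<in>carrier A. \<sigma> x = of_real t * \<sigma>\<^sub>1 x + of_real (1 - t) * \<tau> x" for \<sigma>\<^sub>1 \<tau> and t :: real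
  proof (rule extensionalityI[where A = "carrier A"])
    show "\<sigma>\<^sub>1 \<in> extensional (carrier A)" using st by (simp add: state_def)
    fix x assume x: "x \<in> carrier A"
    interpret S: cstar_state A \<sigma>\<^sub>1 using A st by (intro cstar_stateI)
    interpret T: cstar_state A \<tau> using A st by (intro cstar_stateI)
    define z where "z = x \<oplus> (- \<sigma> x) \<odot> \<one>"
    have z: "z \<in> carrier A" "\<sigma> z = 0" using x \<sigma> by (auto simp: z_def character_def)
    have "\<sigma> (z\<^sup>\<star> \<otimes> z) = 0" using z \<sigma> by (auto simp: character_def)
    then have "Re (of_real t * \<sigma>\<^sub>1 (z\<^sup>\<star> \<otimes> z) + of_real (1 - t) * \<tau> (z\<^sup>\<star> \<otimes> z)) = 0"
      using eq z by simp
    then have "t * Re (\<sigma>\<^sub>1 (z\<^sup>\<star> \<otimes> z)) + (1 - t) * Re (\<tau> (z\<^sup>\<star> \<otimes> z)) = 0"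
      by simp
    moreover have "0 \<le> t * Re (\<sigma>\<^sub>1 (z\<^sup>\<star> \<otimes> z))" "0 \<le> (1 - t) * Re (\<tau> (z\<^sup>\<star> \<otimes> z))"
      using S.Re_rho_pos[OF z(1)] T.Re_rho_pos[OF z(1)] t by auto
    ultimately have "t * Re (\<sigma>\<^sub>1 (z\<^sup>\<star> \<otimes> z)) = 0" by linarith
    then have "\<sigma>\<^sub>1 (z\<^sup>\<star> \<otimes> z) = 0" using S.Im_rho_pos[OF z(1)] t by (simp add: complex_eq_iff)
    then have "\<sigma>\<^sub>1 z = 0" using S.rho_mult_eq_0[of "\<one>" z] z by simp
    then show "\<sigma>\<^sub>1 x = restrict \<sigma> (carrier A) x" using x by (simp add: z_def S.rho_add S.rho_smult S.rho_uminus)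
  qed (simp_all)
  have flip: "of_real (1 - (1 - t)) = (of_real t :: complex)" for t :: real by simp
  show ?thesis
    unfolding pure_state_def
  proof (intro conjI allI impI state_character A \<sigma>)
    fix \<sigma>\<^sub>1 \<tau> and t :: real
    assume *: "state A \<sigma>\<^sub>1 \<and> state A \<tau> \<and> 0 < t \<and> t < 1 \<and>
      (\<forall>x\<in>carrier A. restrict \<sigma> (carrier A) x = of_real t * \<sigma>\<^sub>1 x + of_real (1 - t) * \<tau> x)"
    show "\<sigma>\<^sub>1 = restrict \<sigma> (carrier A)" using * by (intro main[of \<sigma>\<^sub>1 \<tau> t]) auto
    show "\<tau> = restrict \<sigma> (carrier A)"
      using * by (intro main[of \<tau> \<sigma>\<^sub>1 "1 - t"]) (auto simp: add.commute)
  qed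
qed

section \<open>States from vectors and expectations, and compatibility from unique extension\<close>

context cstar_state
begin

lemma rho_expand_mid:
  assumes "x \<in> carrier A" "y \<in> carrier A" "b \<in> carrier A"
  shows "\<rho> ((x \<oplus> a \<odot> y)\<^sup>\<star> \<otimes> b \<otimes> (x \<oplus> a \<odot> y)) =
    \<rho> (x\<^sup>\<star> \<otimes> b \<otimes> x) + a * \<rho> (x\<^sup>\<star> \<otimes> b \<otimes> y) + cnj a * \<rho> (y\<^sup>\<star> \<otimes> b \<otimes> x) + a * cnj a * \<rho> (y\<^sup>\<star> \<otimes> b \<otimes> y)"
  using assms
  by (simp add: star_add star_smult l_distr r_distr smult_mult_left smult_mult_right rho_add rho_smult algebra_simps)

lemma state_vector:
  assumes y: "y \<in> carrier A" and m: "\<rho> (y\<^sup>\<star> \<otimes> y) = of_real m" "m > 0"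
  shows "state A (restrict (\<lambda>x. \<rho> (y\<^sup>\<star> \<otimes> x \<otimes> y) / of_real m) (carrier A))"
proof -
  have "\<rho> (y\<^sup>\<star> \<otimes> (x\<^sup>\<star> \<otimes> x) \<otimes> y) / of_real m \<in> \<real>\<^sub>\<ge>\<^sub>0" if x: "x \<in> carrier A" for x
  proof -
    have "y\<^sup>\<star> \<otimes> (x\<^sup>\<star> \<otimes> x) \<otimes> y = (x \<otimes> y)\<^sup>\<star> \<otimes> (x \<otimes> y)" using x y by (simp add: star_mult m_assoc)
    then show ?thesis using rho_pos[of "x \<otimes> y"] x y m(2)
      by (auto simp: complex_nonneg_Reals_iff Im_divide_of_real Re_divide_of_real)
  qed
  then show ?thesis
    using y m by (auto simp: state_def l_distr r_distr smult_mult_left smult_mult_right rho_add rho_smult add_divide_distrib)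
qed

end

lemma inclusion_facts:
  fixes C :: "'a cstar" (structure)
  assumes "cstar_inclusion C D"
  shows "cstar_algebra C" "D \<subseteq> carrier C" "\<one> \<in> D"
    "\<And>x y. \<lbrakk>x \<in> D; y \<in> D\<rbrakk> \<Longrightarrow> x \<oplus> y \<in> D" "\<And>x y. \<lbrakk>x \<in> D; y \<in> D\<rbrakk> \<Longrightarrow> x \<otimes> y \<in> D"
    "\<And>x. x \<in> D \<Longrightarrow> x\<^sup>\<star> \<in> D" "\<And>x a. x \<in> D \<Longrightarrow> a \<odot> x \<in> D"
    "\<And>x y. \<lbrakk>x \<in> D; y \<in> D\<rbrakk> \<Longrightarrow> x \<otimes> y = y \<otimes> x"
proof -
  show C: "cstar_algebra C" using assms by (simp add: cstar_inclusion_def)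
  interpret cstar_algebra C by fact
  have "closedin (ctopology C) D"
    using assms by (simp add: cstar_inclusion_def abelian_cstar_subalgebra_def cstar_subalgebra_def)
  then show "D \<subseteq> carrier C" unfolding closedin_iff by simp
qed (use assms in \<open>auto simp: cstar_inclusion_def abelian_cstar_subalgebra_def cstar_subalgebra_def\<close>)

lemma abelian_cstar_algebra_subalgebra:
  assumes "cstar_inclusion C D"
  shows "abelian_cstar_algebra (C\<lparr>carrier := D\<rparr>)"
proof -
  interpret cstar_algebra C using inclusion_facts(1)[OF assms] .
  interpret D: cstar_algebra "C\<lparr>carrier := D\<rparr>"
    using assms by (intro cstar_algebra_subalgebra) (auto simp: cstar_inclusion_def abelian_cstar_subalgebra_def)
  show ?thesis using inclusion_facts(8)[OF assms] by unfold_locales auto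
qed

lemma state_expectation:
  fixes C :: "'a cstar" (structure)
  assumes inc: "cstar_inclusion C D" and E: "conditional_expectation C D E" and \<sigma>: "state (C\<lparr>carrier := D\<rparr>) \<sigma>"
  shows "state C (restrict (\<lambda>x. \<sigma> (E x)) (carrier C))"
proof -
  note incf = inclusion_facts[OF inc]
  interpret cstar_algebra C by fact
  interpret B: abelian_cstar_algebra "C\<lparr>carrier := D\<rparr>" by (rule abelian_cstar_algebra_subalgebra[OF inc])
  interpret S: cstar_state "C\<lparr>carrier := D\<rparr>" \<sigma> by (rule cstar_stateI[OF B.cstar_algebra_axioms \<sigma>])
  have ED: "E x \<in> D" if "x \<in> carrier C" for x using E that by (auto simp: conditional_expectation_def)
  have "\<sigma> (E (x\<^sup>\<star> \<otimes> x)) \<in> \<real>\<^sub>\<ge>\<^sub>0" if x: "x \<in> carrier C" for x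
  proof -
    obtain d where "d \<in> D" "E (x\<^sup>\<star> \<otimes> x) = d\<^sup>\<star> \<otimes> d"
      using E x unfolding conditional_expectation_def by blast
    then show ?thesis using S.rho_pos[of d] by simp
  qed
  moreover have "\<sigma> (E (x \<oplus> y)) = \<sigma> (E x) + \<sigma> (E y)" if "x \<in> carrier C" "y \<in> carrier C" for x y
    using E that S.rho_add[of "E x" "E y"] ED by (simp add: conditional_expectation_def)
  moreover have "\<sigma> (E (a \<odot> x)) = a * \<sigma> (E x)" if "x \<in> carrier C" for a x
    using E that S.rho_smult[of "E x" a] ED by (simp add: conditional_expectation_def)
  moreover have "\<sigma> (E \<one>) = 1" using E incf(3) S.rho_one by (simp add: conditional_expectation_def)
  ultimately show ?thesis by (simp add: state_def)
qed

text \<open>The case distinction is whether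
  \<open>d \<mapsto> \<rho> (v\<^sup>\<star> \<otimes> d \<otimes> v)\<close> is a multiple of
  \<open>\<rho>\<close> on \<open>D\<close>. If it is, a nonzero component of \<open>v\<close>
  orthogonal to the cyclic vector would yield superpositions that restrict to multiples of
  \<open>\<rho>\<close> on \<open>D\<close> but have cross terms, against uniqueness. If it is not,
  some \<open>d\<close> with \<open>\<rho> d = 0\<close> separates the two functionals, and
  commutativity of \<open>D\<close> forces \<open>\<rho> v = 0\<close>.\<close>

lemma compatible_extension:
  fixes C :: "'a cstar" (structure)
  assumes inc: "cstar_inclusion C D" and st: "state C \<rho>"
    and char: "\<And>d. d \<in> D \<Longrightarrow> \<rho> (d\<^sup>\<star> \<otimes> d) = (cmod (\<rho> d))\<^sup>2"
    and uniq: "\<And>\<tau>. state C \<tau> \<Longrightarrow> (\<forall>d\<in>D. \<tau> d = \<rho> d) \<Longrightarrow> \<tau> = \<rho>"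
  shows "\<rho> \<in> compatible_states C D"
proof -
  note incf = inclusion_facts[OF inc]
  interpret cstar_state C \<rho> using incf(1) st by (rule cstar_stateI)
  note Dc = subsetD[OF incf(2)]
  have right: "\<rho> (x \<otimes> d) = \<rho> x * \<rho> d" and left: "\<rho> (d \<otimes> x) = \<rho> d * \<rho> x"
    if "x \<in> carrier C" "d \<in> D" for x d
  proof -
    show "\<rho> (x \<otimes> d) = \<rho> x * \<rho> d" using that char[of d] Dc by (intro rho_mult_right) auto
    have "d \<otimes> d\<^sup>\<star> = d\<^sup>\<star> \<otimes> d" using that incf by simp
    then show "\<rho> (d \<otimes> x) = \<rho> d * \<rho> x" using that char[of d] Dc by (intro rho_mult_left) auto
  qed
  \<comment> \<open>The normalized vector state of \<open>y\<close> agrees with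
    \<open>\<rho>\<close> on \<open>D\<close>, so by uniqueness it is \<open>\<rho>\<close>
    everywhere.\<close>
  have U: "\<rho> (y\<^sup>\<star> \<otimes> x \<otimes> y) = of_real m * \<rho> x"
    if y: "y \<in> carrier C" and m: "\<rho> (y\<^sup>\<star> \<otimes> y) = of_real m" "m > 0"
      and eig: "\<And>d. d \<in> D \<Longrightarrow> \<rho> (y\<^sup>\<star> \<otimes> d \<otimes> y) = of_real m * \<rho> d" and x: "x \<in> carrier C" for y x m
  proof -
    have "restrict (\<lambda>x. \<rho> (y\<^sup>\<star> \<otimes> x \<otimes> y) / of_real m) (carrier C) = \<rho>"
      using m eig Dc by (intro uniq state_vector[OF y m]) auto
    then have "restrict (\<lambda>x. \<rho> (y\<^sup>\<star> \<otimes> x \<otimes> y) / of_real m) (carrier C) x = \<rho> x" by simp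
    then show ?thesis using m(2) x by (simp add: field_simps)
  qed
  have "of_real ((cmod (\<rho> v))\<^sup>2) \<in> {0, \<rho> (v\<^sup>\<star> \<otimes> v)}" if v: "v \<in> normalizers C D" for v
  proof -
    have vc: "v \<in> carrier C" using v by (simp add: normalizers_def)
    have vd: "v\<^sup>\<star> \<otimes> d \<otimes> v \<in> D" "v \<otimes> d \<otimes> v\<^sup>\<star> \<in> D" if "d \<in> D" for d
      using v that by (auto simp: normalizers_def)
    define k where "k = Re (\<rho> (v\<^sup>\<star> \<otimes> v))"
    have k: "\<rho> (v\<^sup>\<star> \<otimes> v) = of_real k" using rho_eq_Re[OF vc] by (simp add: k_def)
    have vvD: "v \<otimes> v\<^sup>\<star> \<in> D" using vd(2)[OF incf(3)] vc by simp
    show ?thesis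
    proof (cases "\<forall>d\<in>D. \<rho> (v\<^sup>\<star> \<otimes> d \<otimes> v) = \<rho> d * of_real k")
      case True
      \<comment> \<open>\<open>w\<close> is the component of \<open>v\<close> orthogonal to the
        cyclic vector and \<open>\<kappa>\<close> its squared length. Showing
        \<open>\<kappa> = 0\<close> makes the cyclic vector an eigenvector of
        \<open>v\<close>.\<close>
      define w where "w = v \<oplus> (- \<rho> v) \<odot> \<one>"
      have w: "w \<in> carrier C" "\<rho> w = 0" using vc by (auto simp: w_def rho_add rho_smult rho_uminus)
      define \<kappa> where "\<kappa> = k - (cmod (\<rho> v))\<^sup>2"
      have wd: "\<rho> (w\<^sup>\<star> \<otimes> d \<otimes> w) = of_real \<kappa> * \<rho> d" if d: "d \<in> D" for d
        using d Dc[OF d] vc True unfolding w_def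
        by (simp add: rho_expand_mid right left rho_star \<kappa>_def of_real_cmod_power2 algebra_simps)
      have ww: "\<rho> (w\<^sup>\<star> \<otimes> w) = of_real \<kappa>" using wd[OF incf(3)] w by simp
      have \<kappa>0: "\<kappa> \<ge> 0" using Re_rho_pos[OF w(1)] ww by simp
      have "\<kappa> = 0"
      proof (rule ccontr)
        assume "\<kappa> \<noteq> 0"
        then have \<kappa>: "\<kappa> > 0" using \<kappa>0 by simp
        \<comment> \<open>For unimodular \<open>t\<close> the vectors \<open>\<one>\<close>,
          \<open>w\<close> and \<open>\<one> \<oplus> t \<odot> w\<close> all induce multiples of
          \<open>\<rho>\<close>; subtracting the first two from the third isolates the cross
          terms.\<close>
        have *: "t * \<rho> (x \<otimes> w) + cnj t * \<rho> (w\<^sup>\<star> \<otimes> x) = 0" if x: "x \<in> carrier C" and t: "t * cnj t = 1" for t x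
        proof -
          define y where "y = \<one> \<oplus> t \<odot> w"
          have y: "y \<in> carrier C" using w by (simp add: y_def)
          have yd: "\<rho> (y\<^sup>\<star> \<otimes> d \<otimes> y) = of_real (1 + \<kappa>) * \<rho> d" if d: "d \<in> D" for d
          proof -
            have "\<rho> (d \<otimes> w) = 0" "\<rho> (w\<^sup>\<star> \<otimes> d) = 0"
              using left[OF w(1) d] right[OF star_closed[OF w(1)] d] w by (simp_all add: rho_star)
            then show ?thesis
              using rho_expand_mid[OF one_closed w(1) Dc[OF d], of t] Dc[OF d] w(1) wd[OF d]
              unfolding y_def t by (simp add: distrib_right)
          qed
          have yy: "\<rho> (y\<^sup>\<star> \<otimes> y) = of_real (1 + \<kappa>)"
            using yd[OF incf(3)] y by simp
          have "\<rho> (y\<^sup>\<star> \<otimes> x \<otimes> y) = of_real (1 + \<kappa>) * \<rho> x"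
            using \<kappa> by (intro U[OF y yy _ yd x]) simp
          moreover have "\<rho> (w\<^sup>\<star> \<otimes> x \<otimes> w) = of_real \<kappa> * \<rho> x"
            by (rule U[OF w(1) ww \<kappa> wd x])
          ultimately show ?thesis
            using rho_expand_mid[OF one_closed w(1) x, of t] x w(1)
            unfolding y_def t by (simp add: distrib_right)
        qed
        \<comment> \<open>The choices 1 and \<open>\<i>\<close> for \<open>t\<close> show that the
          two cross terms have sum 0 and difference 0.\<close>
        have "\<rho> (w\<^sup>\<star> \<otimes> w) = 0"
          using *[of "w\<^sup>\<star>" 1] *[of "w\<^sup>\<star>" \<i>] w by (simp add: complex_eq_iff)
        then show False using ww \<kappa> by simp
      qed
      then show ?thesis using k by (simp add: \<kappa>_def)
    next
      case False
      then obtain d\<^sub>0 where d0: "d\<^sub>0 \<in> D" "\<rho> (v\<^sup>\<star> \<otimes> d\<^sub>0 \<otimes> v) \<noteq> \<rho> d\<^sub>0 * of_real k" by blast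
      \<comment> \<open>The scalar shift achieves \<open>\<rho> d = 0\<close> and keeps the two
        functionals apart, since both scale the unit in the same ratio \<open>k\<close>.\<close>
      define d where "d = d\<^sub>0 \<oplus> (- \<rho> d\<^sub>0) \<odot> \<one>"
      have d: "d \<in> D" "d \<in> carrier C" "\<rho> d = 0"
        using d0 incf Dc by (auto simp: d_def rho_add rho_smult rho_uminus)
      have "\<rho> (v\<^sup>\<star> \<otimes> d \<otimes> v) \<noteq> 0"
        using d0 Dc[OF d0(1)] vc k
        by (simp add: d_def l_distr r_distr smult_mult_left smult_mult_right rho_add rho_smult rho_uminus)
      moreover have "\<rho> v * \<rho> (v\<^sup>\<star> \<otimes> d \<otimes> v) = 0"
      proof -
        have "\<rho> v * \<rho> (v\<^sup>\<star> \<otimes> d \<otimes> v) = \<rho> (v \<otimes> (v\<^sup>\<star> \<otimes> d \<otimes> v))"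
          using right vd(1)[OF d(1)] vc by simp
        also have "v \<otimes> (v\<^sup>\<star> \<otimes> d \<otimes> v) = (v \<otimes> v\<^sup>\<star>) \<otimes> d \<otimes> v"
          using vc d(2) by (simp add: m_assoc)
        also have "\<dots> = d \<otimes> ((v \<otimes> v\<^sup>\<star>) \<otimes> v)"
          using vc d(2) incf(8)[OF vvD d(1)] by (simp add: m_assoc)
        also have "\<rho> \<dots> = 0" using left[OF _ d(1)] d(3) vc by simp
        finally show ?thesis .
      qed
      ultimately show ?thesis by simp
    qed
  qed
  then show ?thesis using st by (simp add: compatible_states_def)
qed

lemma diagonal_compatible_state:
  fixes C :: "'a cstar" (structure)
  assumes diag: "cstar_diagonal C D" and b: "b \<in> carrier C" "b \<noteq> \<zero>"
  shows "\<exists>\<rho>\<in>compatible_states C D. \<rho> (b\<^sup>\<star> \<otimes> b) \<noteq> 0"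
proof -
  have inc: "cstar_inclusion C D" and EP: "EP_inclusion C D"
    using diag by (auto simp: cstar_diagonal_def EP_inclusion_def)
  obtain E where "faithful_expectation C D E" using diag by (auto simp: cstar_diagonal_def Cartan_inclusion_def)
  then have E: "conditional_expectation C D E" "\<And>x. x \<in> carrier C \<Longrightarrow> E (x\<^sup>\<star> \<otimes> x) = \<zero> \<Longrightarrow> x = \<zero>"
    by (auto simp: faithful_expectation_def)
  note incf = inclusion_facts[OF inc]
  interpret cstar_algebra C by fact
  interpret B: abelian_cstar_algebra "C\<lparr>carrier := D\<rparr>" by (rule abelian_cstar_algebra_subalgebra[OF inc])
  have Epos: "\<exists>d\<in>D. E (x\<^sup>\<star> \<otimes> x) = d\<^sup>\<star> \<otimes> d" if "x \<in> carrier C" for x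
    using E(1) that by (simp add: conditional_expectation_def)
  obtain d where d: "d \<in> D" "E (b\<^sup>\<star> \<otimes> b) = d\<^sup>\<star> \<otimes> d" using Epos[OF b(1)] by blast
  have "d \<noteq> \<zero>" using E(2)[OF b(1)] b(2) d by auto
  then obtain \<sigma> where char: "character (C\<lparr>carrier := D\<rparr>) \<sigma>" and nz: "\<sigma> (d\<^sup>\<star> \<otimes> d) \<noteq> 0"
    using B.ex_character[of d] d by auto
  have \<sigma>: "\<sigma> (x \<oplus> y) = \<sigma> x + \<sigma> y" "\<sigma> (x \<otimes> y) = \<sigma> x * \<sigma> y" "\<sigma> (x\<^sup>\<star>) = cnj (\<sigma> x)" "\<sigma> (a \<odot> x) = a * \<sigma> x"
    "\<sigma> \<one> = 1" if "x \<in> D" "y \<in> D" for x y a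
    using char that by (auto simp: character_def)
  define \<rho> where "\<rho> = restrict (\<lambda>x. \<sigma> (E x)) (carrier C)"
  have ED: "E x \<in> D" if "x \<in> carrier C" for x using E(1) that by (auto simp: conditional_expectation_def)
  have Eid: "E x = x" if "x \<in> D" for x using E(1) that by (auto simp: conditional_expectation_def)
  have \<rho>D: "\<rho> x = \<sigma> x" if "x \<in> D" for x using that incf(2) by (auto simp: \<rho>_def Eid)
  have pure: "pure_state (C\<lparr>carrier := D\<rparr>) (restrict \<sigma> D)"
    using pure_state_character[OF B.cstar_algebra_axioms char] by simp
  have \<rho>: "\<rho> = restrict (\<lambda>x. restrict \<sigma> D (E x)) (carrier C)"
    unfolding \<rho>_def using ED by (intro restrict_ext) simp
  have st: "state C \<rho>"
    unfolding \<rho> by (rule state_expectation[OF inc E(1) conjunct1[OF pure[unfolded pure_state_def]]])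
  have "\<exists>!\<tau>. state C \<tau> \<and> (\<forall>d\<in>D. \<tau> d = restrict \<sigma> D d)"
    using EP pure unfolding EP_inclusion_def by blast
  moreover have "state C \<rho> \<and> (\<forall>d\<in>D. \<rho> d = restrict \<sigma> D d)" using st \<rho>D by simp
  ultimately have uniq: "\<tau> = \<rho>" if "state C \<tau>" "\<forall>d\<in>D. \<tau> d = \<rho> d" for \<tau>
    using that \<rho>D by (metis restrict_apply')
  have "\<rho> \<in> compatible_states C D"
  proof (rule compatible_extension[OF inc st _ uniq])
    fix x assume x: "x \<in> D"
    then show "\<rho> (x\<^sup>\<star> \<otimes> x) = (cmod (\<rho> x))\<^sup>2"
      using incf(5,6) \<sigma> by (simp add: \<rho>D of_real_cmod_power2 mult.commute)
  qed
  moreover have "\<rho> (b\<^sup>\<star> \<otimes> b) \<noteq> 0" using b d nz by (simp add: \<rho>_def)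
  ultimately show ?thesis by blast
qed

lemma D_subset_normalizers:
  assumes "cstar_inclusion C D" shows "D \<subseteq> normalizers C D"
  using inclusion_facts[OF assms] by (auto simp: normalizers_def)

text \<open>A compatible state \<open>\<rho>\<close> of the diagonal that detects
  \<open>\<alpha> x\<close> is pulled back along \<open>\<alpha>\<close>. As \<open>\<alpha>\<close>
  need not preserve the unit, the value at \<open>p = \<alpha> \<one>\<close> has to be shown to be
  1: \<open>p\<close> is a projection and a normalizer, so compatibility allows only 0 and
  1.\<close>

lemma compatible_state_of_embedding:
  fixes C :: "'a cstar" (structure)
  assumes inc: "cstar_inclusion C D" and diag: "cstar_diagonal C1 D1"
    and mono: "regular_star_mono C D C1 D1 \<alpha>" and x: "x \<in> carrier C" "x \<noteq> \<zero>"
  shows "\<exists>\<tau>\<in>compatible_states C D. \<tau> (x\<^sup>\<star> \<otimes> x) \<noteq> 0"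
proof -
  interpret C: cstar_algebra C by (rule inclusion_facts[OF inc])
  have inc1: "cstar_inclusion C1 D1" using diag by (auto simp: cstar_diagonal_def EP_inclusion_def)
  note incf = inclusion_facts[OF inc] and incf1 = inclusion_facts[OF inc1]
  have \<alpha>: "\<alpha> a \<in> carrier C1" "\<alpha> (a \<oplus> b) = \<alpha> a \<oplus>\<^bsub>C1\<^esub> \<alpha> b" "\<alpha> (a \<otimes> b) = \<alpha> a \<otimes>\<^bsub>C1\<^esub> \<alpha> b"
    "\<alpha> (a\<^sup>\<star>) = (\<alpha> a)\<^sup>\<star>\<^bsub>C1\<^esub>" "\<alpha> (c \<odot> a) = c \<odot>\<^bsub>C1\<^esub> \<alpha> a" if "a \<in> carrier C" "b \<in> carrier C" for a b c
    using mono that by (auto simp: regular_star_mono_def regular_star_hom_def star_hom_def)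
  have inj: "inj_on \<alpha> (carrier C)" and reg: "\<alpha> ` normalizers C D \<subseteq> normalizers C1 D1"
    using mono by (auto simp: regular_star_mono_def regular_star_hom_def)
  interpret C1: cstar_algebra C1 by (rule incf1)
  have "\<alpha> \<zero> = \<zero>\<^bsub>C1\<^esub>"
    using \<alpha>(5)[OF C.zero_closed C.zero_closed, of 0] \<alpha>(1)[OF C.zero_closed C.zero_closed] by simp
  then have "\<alpha> x \<noteq> \<zero>\<^bsub>C1\<^esub>" using inj x by (metis C.zero_closed inj_onD)
  then obtain \<rho> where \<rho>: "\<rho> \<in> compatible_states C1 D1" "\<rho> ((\<alpha> x)\<^sup>\<star>\<^bsub>C1\<^esub> \<otimes>\<^bsub>C1\<^esub> \<alpha> x) \<noteq> 0"
    using diagonal_compatible_state[OF diag \<alpha>(1)[OF x(1) x(1)]] by blast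
  interpret cstar_state C1 \<rho> using \<rho> incf1 by (intro cstar_stateI) (auto simp: compatible_states_def)
  have \<alpha>x: "\<alpha> x \<in> carrier C1" using \<alpha>(1)[OF x(1) x(1)] .
  define p where "p = \<alpha> \<one>"
  have p: "p \<in> carrier C1" "p\<^sup>\<star>\<^bsub>C1\<^esub> = p" "p \<otimes>\<^bsub>C1\<^esub> p = p"
    using \<alpha>(1)[OF C.one_closed C.one_closed] \<alpha>(4,3)[OF C.one_closed C.one_closed, symmetric]
    by (simp_all add: p_def)
  have "p \<in> normalizers C1 D1" using reg D_subset_normalizers[OF inc] incf(3) by (auto simp: p_def)
  then have "of_real ((cmod (\<rho> p))\<^sup>2) \<in> {0, \<rho> p}" using \<rho>(1) p by (auto simp: compatible_states_def)
  moreover have "\<rho> p \<noteq> 0"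
  proof
    assume "\<rho> p = 0"
    \<comment> \<open>With \<open>\<rho> p = 0\<close> the projection \<open>p\<close> is a null
      vector, yet it is a right unit for \<open>\<alpha> x\<close>, so the nonzero value in the
      choice of \<open>\<rho>\<close> would be 0.\<close>
    then have "\<rho> (((\<alpha> x)\<^sup>\<star>\<^bsub>C1\<^esub> \<otimes>\<^bsub>C1\<^esub> \<alpha> x) \<otimes>\<^bsub>C1\<^esub> p) = 0"
      using rho_mult_eq_0[of "(\<alpha> x)\<^sup>\<star>\<^bsub>C1\<^esub> \<otimes>\<^bsub>C1\<^esub> \<alpha> x" p] by (simp add: p \<alpha>x)
    moreover have "(\<alpha> x)\<^sup>\<star>\<^bsub>C1\<^esub> \<otimes>\<^bsub>C1\<^esub> \<alpha> x \<otimes>\<^bsub>C1\<^esub> p = (\<alpha> x)\<^sup>\<star>\<^bsub>C1\<^esub> \<otimes>\<^bsub>C1\<^esub> \<alpha> x"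
    proof -
      have "\<alpha> x \<otimes>\<^bsub>C1\<^esub> p = \<alpha> (x \<otimes> \<one>)"
        unfolding p_def by (rule \<alpha>(3)[OF x(1) C.one_closed, symmetric])
      also have "\<dots> = \<alpha> x" by (rule arg_cong[OF C.r_one[OF x(1)]])
      finally have xp: "\<alpha> x \<otimes>\<^bsub>C1\<^esub> p = \<alpha> x" .
      have "(\<alpha> x)\<^sup>\<star>\<^bsub>C1\<^esub> \<otimes>\<^bsub>C1\<^esub> \<alpha> x \<otimes>\<^bsub>C1\<^esub> p = (\<alpha> x)\<^sup>\<star>\<^bsub>C1\<^esub> \<otimes>\<^bsub>C1\<^esub> (\<alpha> x \<otimes>\<^bsub>C1\<^esub> p)"
        by (rule C1.m_assoc[OF C1.star_closed[OF \<alpha>x] \<alpha>x p(1)])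
      then show ?thesis unfolding xp .
    qed
    ultimately show False using \<rho>(2) by metis
  qed
  ultimately have rp: "of_real ((cmod (\<rho> p))\<^sup>2) = \<rho> p" by (simp del: of_real_power)
  then have "cmod (\<rho> p) = (cmod (\<rho> p))\<^sup>2" by (metis norm_of_real abs_power2)
  then have "cmod (\<rho> p) = 1" using \<open>\<rho> p \<noteq> 0\<close> by (simp add: power2_eq_square)
  then have p1: "\<rho> p = 1" using rp by simp
  define \<tau> where "\<tau> = restrict (\<lambda>y. \<rho> (\<alpha> y)) (carrier C)"
  have "state C \<tau>"
    using \<alpha> p1 rho_pos unfolding state_def \<tau>_def by (auto simp: rho_add rho_smult p_def)
  moreover have "of_real ((cmod (\<tau> v))\<^sup>2) \<in> {0, \<tau> (v\<^sup>\<star> \<otimes> v)}" if v: "v \<in> normalizers C D" for v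
  proof -
    have "v \<in> carrier C" using v by (simp add: normalizers_def)
    moreover have "\<alpha> v \<in> normalizers C1 D1" using v reg by blast
    ultimately show ?thesis using \<rho>(1) \<alpha> by (simp add: compatible_states_def \<tau>_def)
  qed
  ultimately have "\<tau> \<in> compatible_states C D" by (simp add: compatible_states_def)
  moreover have "\<tau> (x\<^sup>\<star> \<otimes> x) \<noteq> 0" using \<rho>(2) x \<alpha> by (simp add: \<tau>_def)
  ultimately show ?thesis by blast
qed

text \<open>The convention for an empty set of compatible states is included: in that case both
  sides say that \<open>C\<close> is the zero algebra.\<close>

lemma Rad_eq_zero_iff:
  fixes C :: "'a cstar" (structure)
  assumes inc: "cstar_inclusion C D"
  shows "Rad C D = {\<zero>} \<longleftrightarrow>
    (\<forall>x\<in>carrier C. x \<noteq> \<zero> \<longrightarrow>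
      (\<exists>\<rho>\<in>compatible_states C D. \<exists>y\<in>carrier C. \<rho> ((x \<otimes> y)\<^sup>\<star> \<otimes> (x \<otimes> y)) \<noteq> 0))"
proof -
  interpret C: cstar_algebra C by (rule inclusion_facts[OF inc])
  have op: "gns_opnorm C \<rho> x = 0 \<longleftrightarrow> (\<forall>y\<in>carrier C. \<rho> ((x \<otimes> y)\<^sup>\<star> \<otimes> (x \<otimes> y)) = 0)"
    if "\<rho> \<in> compatible_states C D" "x \<in> carrier C" for \<rho> x
    using that by (intro cstar_state.gns_opnorm_eq_0_iff cstar_stateI C.cstar_algebra_axioms)
      (auto simp: compatible_states_def)
  have "\<rho> \<zero> = 0" if "\<rho> \<in> compatible_states C D" for \<rho>
    using that by (intro cstar_state.rho_zero[of C] cstar_stateI C.cstar_algebra_axioms) (auto simp: compatible_states_def)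
  then show ?thesis by (auto simp: Rad_def op)
qed

lemma Rad_eq_zero_of_embedding:
  fixes C :: "'a cstar" (structure)
  assumes "cstar_inclusion C D" "cstar_diagonal C1 D1" "regular_star_mono C D C1 D1 \<alpha>"
  shows "Rad C D = {\<zero>}"
proof -
  interpret C: cstar_algebra C by (rule inclusion_facts[OF assms(1)])
  show ?thesis unfolding Rad_eq_zero_iff[OF assms(1)]
  proof (intro ballI impI)
    fix x assume x: "x \<in> carrier C" "x \<noteq> \<zero>"
    then obtain \<tau> where "\<tau> \<in> compatible_states C D" "\<tau> (x\<^sup>\<star> \<otimes> x) \<noteq> 0"
      using compatible_state_of_embedding[OF assms] by blast
    then show "\<exists>\<rho>\<in>compatible_states C D. \<exists>y\<in>carrier C. \<rho> ((x \<otimes> y)\<^sup>\<star> \<otimes> (x \<otimes> y)) \<noteq> 0"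
      using x by (intro bexI[of _ \<tau>] bexI[of _ "\<one>"]) auto
  qed
qed

section \<open>The Hilbert space of square-summable families\<close>

definition square_summable :: "('i \<Rightarrow> complex) \<Rightarrow> bool" where
  "square_summable f \<longleftrightarrow> (\<lambda>i. (cmod (f i))\<^sup>2) summable_on UNIV"

lemma square_summable_add:
  assumes "square_summable f" "square_summable g" shows "square_summable (\<lambda>i. f i + g i)"
  unfolding square_summable_def
proof (rule summable_on_comparison_test)
  show "(\<lambda>i. 2 * (cmod (f i))\<^sup>2 + 2 * (cmod (g i))\<^sup>2) summable_on UNIV"
    using assms by (intro summable_on_add summable_on_cmult_right) (auto simp: square_summable_def)
  fix i
  have "(cmod (f i + g i))\<^sup>2 \<le> (cmod (f i) + cmod (g i))\<^sup>2"
    by (intro power_mono norm_triangle_ineq) auto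
  also have "\<dots> \<le> 2 * (cmod (f i))\<^sup>2 + 2 * (cmod (g i))\<^sup>2"
    using sum_squares_bound[of "cmod (f i)" "cmod (g i)"] by (simp add: power2_sum)
  finally show "(cmod (f i + g i))\<^sup>2 \<le> 2 * (cmod (f i))\<^sup>2 + 2 * (cmod (g i))\<^sup>2" .
qed auto

lemma square_summable_cmult:
  assumes "square_summable f" shows "square_summable (\<lambda>i. c * f i)"
  using assms unfolding square_summable_def norm_mult power_mult_distrib by (rule summable_on_cmult_right)

lemma square_summable_mult:
  assumes "square_summable f" "square_summable g" shows "(\<lambda>i. f i * g i) summable_on UNIV"
proof (rule abs_summable_summable[OF abs_summable_product])
qed (use assms in \<open>auto simp: square_summable_def norm_mult power2_eq_square\<close>)

typedef 'i ell2 = "{f :: 'i \<Rightarrow> complex. square_summable f}" morphisms coord Ell2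
  by (rule exI[of _ "\<lambda>_. 0"]) (simp add: square_summable_def)

setup_lifting type_definition_ell2

lemma square_summable_coord: "square_summable (coord f)"
  using coord by auto

lift_definition scaleC :: "complex \<Rightarrow> 'i ell2 \<Rightarrow> 'i ell2" is "\<lambda>c f i. c * f i"
  by (rule square_summable_cmult)

lift_definition single :: "'i \<Rightarrow> complex \<Rightarrow> 'i ell2" is "\<lambda>i c j. if j = i then c else 0"
  unfolding square_summable_def
  by (rule finite_nonzero_values_imp_summable_on) (auto intro: finite_subset[of _ "{i}" for i])

instantiation ell2 :: (type) real_vector
begin

lift_definition zero_ell2 :: "'a ell2" is "\<lambda>_. 0" by (simp add: square_summable_def)
lift_definition plus_ell2 :: "'a ell2 \<Rightarrow> 'a ell2 \<Rightarrow> 'a ell2" is "\<lambda>f g i. f i + g i"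
  by (rule square_summable_add)
lift_definition uminus_ell2 :: "'a ell2 \<Rightarrow> 'a ell2" is "\<lambda>f i. - f i"
  by (simp add: square_summable_def)
lift_definition minus_ell2 :: "'a ell2 \<Rightarrow> 'a ell2 \<Rightarrow> 'a ell2" is "\<lambda>f g i. f i - g i"
  using square_summable_add[of _ "\<lambda>i. - g i" for g] by (simp add: square_summable_def)
lift_definition scaleR_ell2 :: "real \<Rightarrow> 'a ell2 \<Rightarrow> 'a ell2" is "\<lambda>r f i. of_real r * f i"
  by (rule square_summable_cmult)

instance
  by standard (transfer; simp add: fun_eq_iff algebra_simps)+

end

lemma coord_simps [simp]:
  "coord 0 i = 0" "coord (f + g) i = coord f i + coord g i" "coord (f - g) i = coord f i - coord g i"
  "coord (- f) i = - coord f i" "coord (r *\<^sub>R f) i = of_real r * coord f i"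
  "coord (scaleC c f) i = c * coord f i" "coord (single j c) i = (if i = j then c else 0)"
  by (transfer; simp)+

lemma ell2_eqI: "(\<And>i. coord f i = coord g i) \<Longrightarrow> f = g"
  by transfer auto

lemma coord_sum [simp]: "coord (\<Sum>x\<in>F. h x) i = (\<Sum>x\<in>F. coord (h x) i)"
  by (induction F rule: infinite_finite_induct) auto

lemma inner_summable: "(\<lambda>i. inner (coord f i) (coord g i)) summable_on UNIV"
proof -
  have "inner a b = Re (cnj a * b)" for a b :: complex by (simp add: inner_complex_def)
  moreover have "(\<lambda>i. cnj (coord f i) * coord g i) summable_on UNIV"
    using square_summable_coord[of f] square_summable_coord[of g]
    by (intro square_summable_mult) (auto simp: square_summable_def)
  then have "(\<lambda>i. Re (cnj (coord f i) * coord g i)) summable_on UNIV" by (rule summable_on_Re)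
  ultimately show ?thesis by simp
qed

instantiation ell2 :: (type) real_inner
begin

definition inner_ell2 :: "'a ell2 \<Rightarrow> 'a ell2 \<Rightarrow> real" where
  "inner_ell2 f g = (\<Sum>\<^sub>\<infinity>i. inner (coord f i) (coord g i))"
definition norm_ell2 :: "'a ell2 \<Rightarrow> real" where "norm_ell2 f = sqrt (inner f f)"
definition sgn_ell2 :: "'a ell2 \<Rightarrow> 'a ell2" where "sgn_ell2 f = f /\<^sub>R norm f"
definition dist_ell2 :: "'a ell2 \<Rightarrow> 'a ell2 \<Rightarrow> real" where "dist_ell2 f g = norm (f - g)"
definition uniformity_ell2 :: "('a ell2 \<times> 'a ell2) filter" where
  "uniformity_ell2 = (INF e\<in>{0<..}. principal {(x, y). dist x y < e})"
definition open_ell2 :: "'a ell2 set \<Rightarrow> bool" where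
  "open_ell2 U \<longleftrightarrow> (\<forall>x\<in>U. eventually (\<lambda>(x', y). x' = x \<longrightarrow> y \<in> U) uniformity)"

instance
proof
  fix x y z :: "'a ell2" and r :: real
  show "dist x y = norm (x - y)" by (rule dist_ell2_def)
  show "sgn x = x /\<^sub>R norm x" by (rule sgn_ell2_def)
  show "uniformity = (INF e\<in>{0<..}. principal {(x, y). dist x y < (e::real)} :: ('a ell2 \<times> 'a ell2) filter)"
    by (rule uniformity_ell2_def)
  show "open U \<longleftrightarrow> (\<forall>x\<in>U. eventually (\<lambda>(x', y). x' = x \<longrightarrow> y \<in> U) uniformity)" for U :: "'a ell2 set"
    by (rule open_ell2_def)
  show "inner x y = inner y x" by (simp add: inner_ell2_def inner_commute)
  show "inner (x + y) z = inner x z + inner y z"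
    by (simp add: inner_ell2_def inner_add_left infsum_add inner_summable)
  show "inner (r *\<^sub>R x) y = r * inner x y"
    by (simp add: inner_ell2_def infsum_cmult_right' flip: scaleR_conv_of_real)
  show "0 \<le> inner x x" by (simp add: inner_ell2_def infsum_nonneg)
  show "norm x = sqrt (inner x x)" by (rule norm_ell2_def)
  show "inner x x = 0 \<longleftrightarrow> x = 0"
  proof
    assume "inner x x = 0"
    then have "inner (coord x i) (coord x i) = 0" for i
      using nonneg_infsum_le_0D[of "\<lambda>i. inner (coord x i) (coord x i)" UNIV i] inner_summable[of x x]
      by (simp add: inner_ell2_def)
    then show "x = 0" by (intro ell2_eqI) simp
  qed (simp add: inner_ell2_def)
qed

end

lemma norm_ell2_power2: "(norm f)\<^sup>2 = (\<Sum>\<^sub>\<infinity>i. (cmod (coord f i))\<^sup>2)"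
  by (simp add: power2_norm_eq_inner inner_ell2_def flip: cmod_power2)

lemma sum_coord_le: "finite F \<Longrightarrow> (\<Sum>i\<in>F. (cmod (coord f i))\<^sup>2) \<le> (norm f)\<^sup>2"
  unfolding norm_ell2_power2
  using square_summable_coord[of f] by (intro finite_sum_le_infsum) (auto simp: square_summable_def)

lemma norm_coord_le: "cmod (coord f i) \<le> norm f"
  using sum_coord_le[of "{i}" f] by (auto intro: power2_le_imp_le)

text \<open>\<open>Ell2 h\<close> is unspecified unless \<open>h\<close> is square summable; a
  uniform bound on finite sums provides summability and the norm estimate together.\<close>

lemma ell2_of_bounded_sums:
  assumes le: "\<And>F. finite F \<Longrightarrow> (\<Sum>i\<in>F. (cmod (h i))\<^sup>2) \<le> M\<^sup>2" and M: "M \<ge> 0"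
  shows "coord (Ell2 h) = h" "norm (Ell2 h) \<le> M"
proof -
  have s: "square_summable h"
    unfolding square_summable_def
    by (rule nonneg_bdd_above_summable_on) (use le in \<open>auto intro!: bdd_aboveI\<close>)
  then show eq: "coord (Ell2 h) = h" by (simp add: Ell2_inverse)
  have "(norm (Ell2 h))\<^sup>2 \<le> M\<^sup>2"
    unfolding norm_ell2_power2 eq
    by (rule infsum_le_finite_sums) (use s le in \<open>auto simp: square_summable_def\<close>)
  then show "norm (Ell2 h) \<le> M" using M by (rule power2_le_imp_le)
qed

instance ell2 :: (type) banach
proof
  fix X :: "nat \<Rightarrow> 'a ell2" assume X: "Cauchy X"
  have "Cauchy (\<lambda>n. coord (X n) i)" for i
  proof (rule metric_CauchyI)
    fix e :: real assume "e > 0"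
    then obtain N where N: "\<forall>m\<ge>N. \<forall>n\<ge>N. norm (X m - X n) < e" using X by (meson CauchyD)
    have "dist (coord (X m) i) (coord (X n) i) < e" if "m \<ge> N" "n \<ge> N" for m n
      using N that norm_coord_le[of "X m - X n" i] by (auto simp: dist_norm intro: le_less_trans)
    then show "\<exists>N. \<forall>m\<ge>N. \<forall>n\<ge>N. dist (coord (X m) i) (coord (X n) i) < e" by blast
  qed
  then have "\<forall>i. \<exists>l. (\<lambda>n. coord (X n) i) \<longlonglongrightarrow> l" by (metis Cauchy_convergent convergent_def)
  then obtain l where l: "\<And>i. (\<lambda>n. coord (X n) i) \<longlonglongrightarrow> l i" by metis
  have near: "\<exists>N. \<forall>n\<ge>N. \<forall>F. finite F \<longrightarrow> (\<Sum>i\<in>F. (cmod (coord (X n) i - l i))\<^sup>2) \<le> e\<^sup>2" if e: "e > 0" for e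
  proof -
    obtain N where N: "\<forall>m\<ge>N. \<forall>n\<ge>N. norm (X m - X n) < e" using X e by (meson CauchyD)
    have "(\<Sum>i\<in>F. (cmod (coord (X n) i - l i))\<^sup>2) \<le> e\<^sup>2" if n: "n \<ge> N" and F: "finite F" for n F
    proof (rule LIMSEQ_le_const2)
      show "(\<lambda>m. \<Sum>i\<in>F. (cmod (coord (X n) i - coord (X m) i))\<^sup>2) \<longlonglongrightarrow> (\<Sum>i\<in>F. (cmod (coord (X n) i - l i))\<^sup>2)"
        by (intro tendsto_intros l)
      have "(\<Sum>i\<in>F. (cmod (coord (X n) i - coord (X m) i))\<^sup>2) \<le> e\<^sup>2" if "m \<ge> N" for m
      proof -
        have "(\<Sum>i\<in>F. (cmod (coord (X n) i - coord (X m) i))\<^sup>2) \<le> (norm (X n - X m))\<^sup>2"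
          using sum_coord_le[OF F, of "X n - X m"] by simp
        also have "\<dots> \<le> e\<^sup>2" using N n that by (intro power_mono) (auto intro: less_imp_le)
        finally show ?thesis .
      qed
      then show "\<exists>N. \<forall>m\<ge>N. (\<Sum>i\<in>F. (cmod (coord (X n) i - coord (X m) i))\<^sup>2) \<le> e\<^sup>2" by blast
    qed
    then show ?thesis by blast
  qed
  obtain N1 where N1: "\<And>F. finite F \<Longrightarrow> (\<Sum>i\<in>F. (cmod (coord (X N1) i - l i))\<^sup>2) \<le> 1\<^sup>2"
    using near[of 1] by auto
  \<comment> \<open>The finite sums control only the difference between \<open>X N1\<close> and the
    coordinatewise limit, so the limit is reached by subtracting that difference from
    \<open>X N1\<close>.\<close>
  define L where "L = X N1 - Ell2 (\<lambda>i. coord (X N1) i - l i)"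
  have L: "coord L i = l i" for i
    unfolding L_def using ell2_of_bounded_sums(1)[of "\<lambda>i. coord (X N1) i - l i" 1] N1 by simp
  have "X \<longlonglongrightarrow> L"
  proof (rule metric_LIMSEQ_I)
    fix e :: real assume e: "e > 0"
    obtain N where N: "\<And>n F. n \<ge> N \<Longrightarrow> finite F \<Longrightarrow> (\<Sum>i\<in>F. (cmod (coord (X n) i - l i))\<^sup>2) \<le> (e/2)\<^sup>2"
      using near[of "e/2"] e by auto
    have "dist (X n) L < e" if "n \<ge> N" for n
    proof -
      have "norm (Ell2 (coord (X n - L))) \<le> e/2"
        using N[OF that] e by (intro ell2_of_bounded_sums(2)) (auto simp: L)
      then show ?thesis using e by (simp add: coord_inverse dist_norm)
    qed
    then show "\<exists>N. \<forall>n\<ge>N. dist (X n) L < e" by blast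
  qed
  then show "convergent X" by (auto simp: convergent_def)
qed

lemma inner_single: "inner f (single i c) = inner (coord f i) c"
proof -
  have "((\<lambda>j. inner (coord f j) (coord (single i c) j)) has_sum inner (coord f i) c) UNIV"
    by (rule has_sum_finite_neutralI[of "{i}"]) auto
  then show ?thesis by (simp add: inner_ell2_def infsumI)
qed

lemma norm_single [simp]: "norm (single i c) = cmod c"
  by (simp add: norm_eq_sqrt_inner inner_single)

text \<open>By Pythagoras the squared distance from \<open>f\<close> to a partial sum is the
  remainder of the series for the squared norm of \<open>f\<close>.\<close>

lemma has_sum_single: "((\<lambda>i. single i (coord f i)) has_sum f) UNIV"
  unfolding has_sum_def
proof (rule tendstoI)
  fix e :: real assume e: "e > 0"
  have "((\<lambda>i. (cmod (coord f i))\<^sup>2) has_sum (norm f)\<^sup>2) UNIV"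
    using square_summable_coord[of f] by (simp add: norm_ell2_power2 square_summable_def)
  then have "\<forall>\<^sub>F F in finite_subsets_at_top UNIV. dist (\<Sum>i\<in>F. (cmod (coord f i))\<^sup>2) ((norm f)\<^sup>2) < e\<^sup>2"
    unfolding has_sum_def using e by (intro tendstoD) auto
  then show "\<forall>\<^sub>F F in finite_subsets_at_top UNIV. dist (\<Sum>i\<in>F. single i (coord f i)) f < e"
  proof (rule eventually_mp[rotated], intro eventually_finite_subsets_at_top_weakI impI)
    fix F :: "'a set" assume F: "finite F" and d: "dist (\<Sum>i\<in>F. (cmod (coord f i))\<^sup>2) ((norm f)\<^sup>2) < e\<^sup>2"
    define p where "p = (\<Sum>i\<in>F. single i (coord f i))"
    have fp: "inner f p = (\<Sum>i\<in>F. (cmod (coord f i))\<^sup>2)"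
      by (simp add: p_def inner_sum_right inner_single power2_norm_eq_inner)
    have "coord p i = coord f i" if "i \<in> F" for i
      using that F by (simp add: p_def sum.delta')
    then have "inner p p = (\<Sum>i\<in>F. (cmod (coord f i))\<^sup>2)"
      unfolding p_def[THEN arg_cong[of _ _ "inner p"]]
      by (simp add: inner_sum_right inner_single power2_norm_eq_inner)
    then have "(norm (p - f))\<^sup>2 = (norm f)\<^sup>2 - (\<Sum>i\<in>F. (cmod (coord f i))\<^sup>2)"
      using fp by (simp add: power2_norm_eq_inner inner_diff_left inner_diff_right inner_commute)
    also have "\<dots> < e\<^sup>2" using d by (simp add: dist_real_def)
    finally show "dist (\<Sum>i\<in>F. single i (coord f i)) f < e"
      using e by (simp add: dist_norm p_def power2_less_imp_less)
  qed
qed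

text \<open>The maps are assumed only real linear, which is why the test vectors carry arbitrary
  complex scalars.\<close>

lemma bounded_linear_ell2_eqI:
  assumes "bounded_linear \<phi>" "bounded_linear \<psi>" "\<And>i c. \<phi> (single i c) = \<psi> (single i c)"
  shows "\<phi> f = \<psi> f"
proof -
  have "((\<lambda>i. \<phi> (single i (coord f i))) has_sum \<phi> f) UNIV" "((\<lambda>i. \<psi> (single i (coord f i))) has_sum \<psi> f) UNIV"
    using has_sum_bounded_linear[OF assms(1) has_sum_single] has_sum_bounded_linear[OF assms(2) has_sum_single]
    by (simp_all add: comp_def)
  then show ?thesis using assms(3) has_sum_unique by auto
qed

lemma norm_scaleC [simp]: "norm (scaleC c f) = cmod c * norm f"
proof -
  have "(norm (scaleC c f))\<^sup>2 = (cmod c * norm f)\<^sup>2"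
    unfolding power_mult_distrib norm_ell2_power2 by (simp add: norm_mult power_mult_distrib infsum_cmult_right')
  then show ?thesis by (simp add: power2_eq_iff_nonneg)
qed

lemma scaleC_simps:
  "scaleC c (f + g) = scaleC c f + scaleC c g" "scaleC c (r *\<^sub>R f) = r *\<^sub>R scaleC c f"
  "scaleC (a + b) f = scaleC a f + scaleC b f" "scaleC a (scaleC b f) = scaleC (a * b) f"
  "scaleC 1 f = f" "scaleC c (single i a) = single i (c * a)"
  by (auto intro!: ell2_eqI simp: algebra_simps)

lemma bounded_linear_scaleC: "bounded_linear (scaleC c)"
  by (rule bounded_linear_intro[of _ "cmod c"]) (auto simp: scaleC_simps)

lemma inner_scaleC: "inner (scaleC c f) g = inner f (scaleC (cnj c) g)"
  by (simp add: inner_ell2_def) (simp add: inner_complex_def algebra_simps)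

section \<open>Bounded operators and matrices\<close>

type_synonym 'i op = "'i ell2 \<Rightarrow>\<^sub>L 'i ell2"

definition clinear :: "'i op \<Rightarrow> bool" where
  "clinear T \<longleftrightarrow> (\<forall>c f. blinfun_apply T (scaleC c f) = scaleC c (blinfun_apply T f))"

definition adjoint_pair :: "'i op \<Rightarrow> 'i op \<Rightarrow> bool" where
  "adjoint_pair T S \<longleftrightarrow> (\<forall>f g. inner (blinfun_apply T f) g = inner f (blinfun_apply S g))"

text \<open>The inner product is the real one; for a complex-linear operator the adjoint with respect to it
  is the usual complex adjoint. Demanding an adjoint avoids the Riesz representation theorem.\<close>

definition bops :: "'i op set" where
  "bops = {T. clinear T \<and> (\<exists>S. adjoint_pair T S)}"

definition adj :: "'i op \<Rightarrow> 'i op" where "adj T = (THE S. adjoint_pair T S)"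

text \<open>Operators form a real vector space as a type; a complex scalar acts by composition with
  this operator.\<close>

definition mulC :: "complex \<Rightarrow> 'i op" where "mulC c = Blinfun (scaleC c)"

definition ent :: "'i op \<Rightarrow> 'i \<Rightarrow> 'i \<Rightarrow> complex" where
  "ent T i j = coord (blinfun_apply T (single j 1)) i"

lemma mulC_apply [simp]: "blinfun_apply (mulC c) f = scaleC c f"
  by (simp add: mulC_def bounded_linear_Blinfun_apply bounded_linear_scaleC)

lemma adjoint_pair_unique: "adjoint_pair T S \<Longrightarrow> adjoint_pair T S' \<Longrightarrow> S = S'"
proof (rule blinfun_eqI)
  fix g assume "adjoint_pair T S" "adjoint_pair T S'"
  then have "inner f (S g - S' g) = 0" for f by (simp add: adjoint_pair_def inner_diff_right)
  then show "S g = S' g" by (metis eq_iff_diff_eq_0 inner_eq_zero_iff)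
qed

lemma adjI: "adjoint_pair T S \<Longrightarrow> adj T = S"
  unfolding adj_def using adjoint_pair_unique by blast

lemma adjoint_pair_adj: "T \<in> bops \<Longrightarrow> adjoint_pair T (adj T)"
  using adjI by (auto simp: bops_def)

lemma inner_adj: "T \<in> bops \<Longrightarrow> inner (blinfun_apply T f) g = inner f (blinfun_apply (adj T) g)"
  using adjoint_pair_adj by (auto simp: adjoint_pair_def)

lemma apply_scaleC: "T \<in> bops \<Longrightarrow> blinfun_apply T (scaleC c f) = scaleC c (blinfun_apply T f)"
  by (auto simp: bops_def clinear_def)

lemma apply_single: "T \<in> bops \<Longrightarrow> coord (blinfun_apply T (single j c)) i = c * ent T i j"
  using apply_scaleC[of T c "single j 1"] by (simp add: scaleC_simps ent_def)

lemma bopsI: "(\<And>c f. blinfun_apply T (scaleC c f) = scaleC c (blinfun_apply T f)) \<Longrightarrow> adjoint_pair T S \<Longrightarrow> T \<in> bops"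
  by (auto simp: bops_def clinear_def)

lemma adj_in_bops: assumes T: "T \<in> bops" shows "adj T \<in> bops" "adj (adj T) = T"
proof -
  have *: "adjoint_pair (adj T) T"
    using inner_adj[OF T] by (simp add: adjoint_pair_def) (metis inner_commute)
  show "adj T \<in> bops"
  proof (rule bopsI[OF _ *])
    fix c f
    have "inner g (adj T (scaleC c f)) = inner g (scaleC c (adj T f))" for g
      using inner_adj[OF T, of g "scaleC c f"] inner_adj[OF T, of "scaleC (cnj c) g" f] apply_scaleC[OF T, of "cnj c" g]
      by (metis complex_cnj_cnj inner_scaleC)
    then have "inner g (adj T (scaleC c f) - scaleC c (adj T f)) = 0" for g by (simp add: inner_diff_right)
    then show "adj T (scaleC c f) = scaleC c (adj T f)" by (metis eq_iff_diff_eq_0 inner_eq_zero_iff)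
  qed
  show "adj (adj T) = T" using * by (rule adjI)
qed

lemma norm_adj: assumes T: "T \<in> bops" shows "norm (adj T) = norm T"
proof -
  have le: "norm (adj S) \<le> norm S" if S: "S \<in> bops" for S :: "'a op"
  proof (rule norm_blinfun_bound)
    fix g
    have "(norm (adj S g))\<^sup>2 = inner (S (adj S g)) g"
      using inner_adj[OF S] by (simp add: power2_norm_eq_inner)
    also have "\<dots> \<le> norm S * norm (adj S g) * norm g"
      by (meson Cauchy_Schwarz_ineq2 abs_le_D1 mult_right_mono norm_blinfun norm_ge_zero order_trans)
    finally have "norm (adj S g) * norm (adj S g) \<le> norm S * norm g * norm (adj S g)"
      by (simp add: power2_eq_square mult_ac)
    then show "norm (adj S g) \<le> norm S * norm g"
      by (cases "norm (adj S g) = 0") (auto simp: mult_nonneg_nonneg)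
  qed auto
  show ?thesis using le[OF T] le[OF adj_in_bops(1)[OF T]] adj_in_bops(2)[OF T] by simp
qed

lemma bops_closed:
  assumes S: "S \<in> bops" and T: "T \<in> bops"
  shows "S + T \<in> bops" "adj (S + T) = adj S + adj T" "S o\<^sub>L T \<in> bops" "adj (S o\<^sub>L T) = adj T o\<^sub>L adj S"
proof -
  have 1: "adjoint_pair (S + T) (adj S + adj T)" "adjoint_pair (S o\<^sub>L T) (adj T o\<^sub>L adj S)"
    using inner_adj[OF S] inner_adj[OF T]
    by (auto simp: adjoint_pair_def blinfun.add_left inner_add_left inner_add_right)
  show "adj (S + T) = adj S + adj T" "adj (S o\<^sub>L T) = adj T o\<^sub>L adj S" using 1 by (auto intro: adjI)
  show "S + T \<in> bops" "S o\<^sub>L T \<in> bops"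
    using 1 apply_scaleC[OF S] apply_scaleC[OF T]
    by (auto intro!: bopsI simp: blinfun.add_left scaleC_simps)
qed

lemma mulC_in_bops: "mulC c \<in> bops" "adj (mulC c) = mulC (cnj c)"
proof -
  have 1: "adjoint_pair (mulC c) (mulC (cnj c))" by (simp add: adjoint_pair_def inner_scaleC)
  then show "adj (mulC c) = mulC (cnj c)" by (rule adjI)
  show "mulC c \<in> bops" using 1 by (rule bopsI[rotated]) (simp add: scaleC_simps mult.commute)
qed

lemma scaleR_eq_mulC: "r *\<^sub>R T = mulC (of_real r) o\<^sub>L T"
  by (rule blinfun_eqI) (auto intro!: ell2_eqI simp: blinfun.scaleR_left)

lemma zero_in_bops: "(0 :: 'a op) \<in> bops" "adj (0 :: 'a op) = 0"
proof -
  have 1: "adjoint_pair (0 :: 'a op) 0" by (simp add: adjoint_pair_def)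
  then show "adj 0 = (0 :: 'a op)" by (rule adjI)
  show "(0 :: 'a op) \<in> bops" using 1 by (rule bopsI[rotated]) (auto intro!: ell2_eqI)
qed

lemma id_eq_mulC: "id_blinfun = mulC 1"
  by (rule blinfun_eqI) (simp add: scaleC_simps)

lemma norm_mulC_compose_le: "norm (mulC c o\<^sub>L T) \<le> cmod c * norm T"
  by (rule norm_blinfun_bound) (auto simp: norm_blinfun mult_left_mono mult.assoc)

lemma norm_mulC_compose: "norm (mulC c o\<^sub>L T) = cmod c * norm T"
proof (rule antisym)
  note 1 = norm_mulC_compose_le
  show "norm (mulC c o\<^sub>L T) \<le> cmod c * norm T" by (rule 1)
  show "cmod c * norm T \<le> norm (mulC c o\<^sub>L T)"
  proof (cases "c = 0")
    case False
    have "mulC (inverse c) o\<^sub>L (mulC c o\<^sub>L T) = T" using False by (intro blinfun_eqI) (simp add: scaleC_simps)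
    then show ?thesis using 1[of "inverse c" "mulC c o\<^sub>L T"] False by (simp add: norm_divide field_simps)
  qed simp
qed

lemma norm_adj_compose: assumes T: "T \<in> bops" shows "norm (adj T o\<^sub>L T) = (norm T)\<^sup>2"
proof (rule antisym)
  show "norm (adj T o\<^sub>L T) \<le> (norm T)\<^sup>2"
    using norm_blinfun_compose[of "adj T" T] norm_adj[OF T] by (simp add: power2_eq_square)
  have "norm T \<le> sqrt (norm (adj T o\<^sub>L T))"
  proof (rule norm_blinfun_bound)
    fix f
    have "(norm (T f))\<^sup>2 = inner f ((adj T o\<^sub>L T) f)" using inner_adj[OF T] by (simp add: power2_norm_eq_inner)
    also have "\<dots> \<le> norm f * (norm (adj T o\<^sub>L T) * norm f)"
      by (meson Cauchy_Schwarz_ineq2 abs_le_D1 mult_left_mono norm_blinfun norm_ge_zero order_trans)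
    also have "\<dots> = (sqrt (norm (adj T o\<^sub>L T)) * norm f)\<^sup>2" by (simp add: power_mult_distrib power2_eq_square)
    finally show "norm (T f) \<le> sqrt (norm (adj T o\<^sub>L T)) * norm f" by (rule power2_le_imp_le) simp
  qed simp
  then have "(norm T)\<^sup>2 \<le> (sqrt (norm (adj T o\<^sub>L T)))\<^sup>2" by (intro power_mono) auto
  then show "(norm T)\<^sup>2 \<le> norm (adj T o\<^sub>L T)" by simp
qed

lemma tendsto_apply: "X \<longlonglongrightarrow> T \<Longrightarrow> (\<lambda>n. blinfun_apply (X n) f) \<longlonglongrightarrow> blinfun_apply T f"
  by (intro blinfun.tendsto) auto

lemma uminus_in_bops: "T \<in> bops \<Longrightarrow> - T \<in> bops \<and> adj (- T) = - adj T"
  using bops_closed(3,4)[OF mulC_in_bops(1), of T "- 1"] scaleR_eq_mulC[of "- 1" T] 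
    scaleR_eq_mulC[of "- 1" "adj T"] mulC_in_bops(2)[of "- 1"] scaleR_eq_mulC[of "- 1"]
  by (metis (no_types, lifting) adj_in_bops apply_scaleC bops_closed(4) blinfun_apply_blinfun_compose blinfun_eqI 
      complex_cnj_minus complex_cnj_one mulC_apply mulC_in_bops(1) of_real_1 of_real_minus scaleR_minus1_left)

text \<open>The adjoint is isometric on \<open>bops\<close>, so the adjoints of a convergent
  sequence are Cauchy, and their limit is an adjoint of the limit by continuity of the inner
  product.\<close>

lemma tendsto_adj:
  assumes X: "\<And>n. X n \<in> bops" and lim: "X \<longlonglongrightarrow> T"
  shows "T \<in> bops" "(\<lambda>n. adj (X n)) \<longlonglongrightarrow> adj T"
proof -
  have diff: "adj (X m) - adj (X n) = adj (X m - X n)" "X m - X n \<in> bops" for m n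
    using bops_closed(1,2)[OF X[of m], of "- X n"] uminus_in_bops[OF X[of n]] by simp_all
  have "Cauchy (\<lambda>n. adj (X n))"
    using LIMSEQ_imp_Cauchy[OF lim] norm_adj[OF diff(2)] diff(1) unfolding Cauchy_def dist_norm by simp
  then obtain S where S: "(\<lambda>n. adj (X n)) \<longlonglongrightarrow> S" using Cauchy_convergent convergent_def by blast
  have "adjoint_pair T S"
    unfolding adjoint_pair_def
  proof (intro allI)
    fix f g
    have "(\<lambda>n. inner (X n f) g) \<longlonglongrightarrow> inner (T f) g" "(\<lambda>n. inner f (adj (X n) g)) \<longlonglongrightarrow> inner f (S g)"
      by (intro tendsto_intros tendsto_apply lim S)+
    then show "inner (T f) g = inner f (S g)" unfolding inner_adj[OF X] by (rule LIMSEQ_unique)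
  qed
  moreover have "T (scaleC c f) = scaleC c (T f)" for c f
  proof -
    have "(\<lambda>n. X n (scaleC c f)) \<longlonglongrightarrow> T (scaleC c f)" by (intro tendsto_apply lim)
    then have "(\<lambda>n. scaleC c (X n f)) \<longlonglongrightarrow> T (scaleC c f)" unfolding apply_scaleC[OF X] .
    moreover have "(\<lambda>n. scaleC c (X n f)) \<longlonglongrightarrow> scaleC c (T f)"
      by (intro bounded_linear.tendsto[OF bounded_linear_scaleC] tendsto_apply lim)
    ultimately show ?thesis by (rule LIMSEQ_unique)
  qed
  ultimately show "T \<in> bops" "(\<lambda>n. adj (X n)) \<longlonglongrightarrow> adj T" using S adjI by (auto intro: bopsI)
qed

section \<open>Matrix entries and operators with prescribed entries\<close>

lemma ent_adj: assumes T: "T \<in> bops" shows "ent (adj T) i j = cnj (ent T j i)"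
proof -
  have "inner (T (single i 1)) (single j c) = inner (single i 1) (adj T (single j c))" for c by (rule inner_adj[OF T])
  moreover have "inner (T (single i 1)) (single j c) = inner (ent T j i) c" for c
    by (simp add: inner_single ent_def)
  moreover have "inner (single i 1) (adj T (single j c)) = inner (c * ent (adj T) i j) 1" for c
    by (subst inner_commute) (simp add: inner_single apply_single[OF adj_in_bops(1)[OF T]])
  ultimately have "inner (ent T j i) c = inner (c * ent (adj T) i j) 1" for c by metis
  \<comment> \<open>The real inner product sees one real component at a time; the scalars 1 and
    \<open>\<i>\<close> recover the real and the imaginary part.\<close>
  from this[of 1] this[of \<i>] show ?thesis by (simp add: inner_complex_def complex_eq_iff)
qed

lemma bops_eqI: assumes "S \<in> bops" "T \<in> bops" "\<And>i j. ent S i j = ent T i j" shows "S = T"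
proof (rule blinfun_eqI)
  fix f
  have "S (single j c) = T (single j c)" for j c
    by (rule ell2_eqI) (simp add: apply_single assms)
  then show "S f = T f"
    by (rule bounded_linear_ell2_eqI[OF blinfun.bounded_linear_right blinfun.bounded_linear_right])
qed

lemma ent_simps:
  "ent (S + T) i j = ent S i j + ent T i j" "ent (mulC c o\<^sub>L T) i j = c * ent T i j"
  "ent (mulC c) i j = (if i = j then c else 0)" "ent 0 i j = 0"
  by (auto simp: ent_def blinfun.add_left)

lemma cmod_ent_le: "cmod (ent T i j) \<le> norm T"
  using norm_coord_le[of "T (single j 1)" i] norm_blinfun[of T "single j 1"] by (simp add: ent_def)

text \<open>Only finite sections are tested, so the condition presupposes no convergence.\<close>

definition bounded_matrix :: "('i \<Rightarrow> 'i \<Rightarrow> complex) \<Rightarrow> real \<Rightarrow> bool" where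
  "bounded_matrix m K \<longleftrightarrow> (\<forall>F G f. finite F \<and> finite G \<longrightarrow>
     (\<Sum>i\<in>G. (cmod (\<Sum>j\<in>F. m i j * f j))\<^sup>2) \<le> K\<^sup>2 * (\<Sum>j\<in>F. (cmod (f j))\<^sup>2))"

lemma bounded_matrixD:
  "\<lbrakk>bounded_matrix m K; finite F; finite G\<rbrakk> \<Longrightarrow>
     (\<Sum>i\<in>G. (cmod (\<Sum>j\<in>F. m i j * f j))\<^sup>2) \<le> K\<^sup>2 * (\<Sum>j\<in>F. (cmod (f j))\<^sup>2)"
  by (simp add: bounded_matrix_def)

text \<open>Testing with the conjugate of the row bounds the square of its partial sum
  \<open>s\<close> by \<open>K\<^sup>2 * s\<close>, hence \<open>s\<close> by
  \<open>K\<^sup>2\<close>.\<close>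

lemma bounded_matrix_row:
  assumes m: "bounded_matrix m K" shows "square_summable (m i)"
  unfolding square_summable_def
proof (rule nonneg_bdd_above_summable_on)
  have "(\<Sum>j\<in>F. (cmod (m i j))\<^sup>2) \<le> K\<^sup>2" if F: "finite F" for F
  proof -
    define s where "s = (\<Sum>j\<in>F. (cmod (m i j))\<^sup>2)"
    have s0: "s \<ge> 0" by (simp add: s_def sum_nonneg)
    have "(\<Sum>i\<in>{i}. (cmod (\<Sum>j\<in>F. m i j * cnj (m i j)))\<^sup>2) \<le> K\<^sup>2 * (\<Sum>j\<in>F. (cmod (cnj (m i j)))\<^sup>2)"
      using bounded_matrixD[OF m F, of "{i}" "\<lambda>j. cnj (m i j)"] by simp
    then have *: "(cmod (\<Sum>j\<in>F. m i j * cnj (m i j)))\<^sup>2 \<le> K\<^sup>2 * s" by (simp add: s_def)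
    have "(\<Sum>j\<in>F. m i j * cnj (m i j)) = of_real s"
      by (simp add: s_def of_real_cmod_power2)
    then have "s\<^sup>2 \<le> K\<^sup>2 * s" using * s0 by (simp only: norm_of_real power2_abs)
    then have "s \<le> K\<^sup>2" using s0 by (cases "s = 0") (simp_all add: power2_eq_square)
    then show ?thesis by (simp only: s_def)
  qed
  then show "bdd_above (sum (\<lambda>j. (cmod (m i j))\<^sup>2) ` {F. F \<subseteq> UNIV \<and> finite F})" by (intro bdd_aboveI2[of _ _ "K\<^sup>2"]) auto
qed auto

text \<open>Square summable rows let the matrix act by convergent series. The bound survives the
  limit over \<open>F\<close>, and its uniformity in \<open>G\<close> makes the image square
  summable.\<close>

lemma matrix_op:
  assumes m: "bounded_matrix m K" and K: "K \<ge> 0"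
  shows "\<exists>T. clinear T \<and> norm T \<le> K \<and> (\<forall>i j. ent T i j = m i j)"
proof -
  define h where "h f i = (\<Sum>\<^sub>\<infinity>j. m i j * coord f j)" for f i
  have summ: "(\<lambda>j. m i j * coord f j) summable_on UNIV" for f i
    by (rule square_summable_mult[OF bounded_matrix_row[OF m] square_summable_coord])
  have bound: "(\<Sum>i\<in>G. (cmod (h f i))\<^sup>2) \<le> (K * norm f)\<^sup>2" if G: "finite G" for f G
  proof (rule tendsto_upperbound)
    show "((\<lambda>F. \<Sum>i\<in>G. (cmod (\<Sum>j\<in>F. m i j * coord f j))\<^sup>2) \<longlongrightarrow> (\<Sum>i\<in>G. (cmod (h f i))\<^sup>2)) (finite_subsets_at_top UNIV)"
      unfolding h_def by (intro tendsto_intros infsum_tendsto summ)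
    have "(\<Sum>i\<in>G. (cmod (\<Sum>j\<in>F. m i j * coord f j))\<^sup>2) \<le> (K * norm f)\<^sup>2" if F: "finite F" for F
    proof -
      have "(\<Sum>i\<in>G. (cmod (\<Sum>j\<in>F. m i j * coord f j))\<^sup>2) \<le> K\<^sup>2 * (\<Sum>j\<in>F. (cmod (coord f j))\<^sup>2)"
        by (rule bounded_matrixD[OF m F G])
      also have "\<dots> \<le> K\<^sup>2 * (norm f)\<^sup>2" using sum_coord_le[OF F] by (intro mult_left_mono) auto
      finally show ?thesis by (simp add: power_mult_distrib)
    qed
    then show "\<forall>\<^sub>F F in finite_subsets_at_top UNIV. (\<Sum>i\<in>G. (cmod (\<Sum>j\<in>F. m i j * coord f j))\<^sup>2) \<le> (K * norm f)\<^sup>2"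
      by (intro eventually_finite_subsets_at_top_weakI)
  qed auto
  have Kn: "K * norm f \<ge> 0" for f :: "'a ell2" using K by simp
  define t where "t f = Ell2 (h f)" for f
  have ct: "coord (t f) i = h f i" and nt: "norm (t f) \<le> K * norm f" for f i
    using ell2_of_bounded_sums[OF bound Kn, of f] by (auto simp: t_def)
  have lin: "bounded_linear t"
  proof (rule bounded_linear_intro[of _ K])
    show "t (f + g) = t f + t g" for f g
      by (rule ell2_eqI) (simp add: ct h_def distrib_left infsum_add summ)
    show "t (r *\<^sub>R f) = r *\<^sub>R t f" for r f
      by (rule ell2_eqI) (simp add: ct h_def mult.left_commute[of _ "of_real r"] infsum_cmult_right')
    show "norm (t f) \<le> norm f * K" for f using nt[of f] by (simp add: mult.commute)
  qed
  have cl: "t (scaleC c f) = scaleC c (t f)" for c f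
    by (rule ell2_eqI) (simp add: ct h_def mult.left_commute[of _ c] infsum_cmult_right')
  have "coord (t (single j 1)) i = m i j" for i j
  proof -
    have "((\<lambda>k. m i k * coord (single j 1) k) has_sum m i j) UNIV"
      by (rule has_sum_finite_neutralI[of "{j}"]) auto
    then show ?thesis by (simp add: ct h_def infsumI)
  qed
  moreover have "norm (Blinfun t) \<le> K"
    by (rule norm_blinfun_bound) (use lin nt K in \<open>auto simp: bounded_linear_Blinfun_apply\<close>)
  ultimately show ?thesis
    using lin cl by (intro exI[of _ "Blinfun t"]) (auto simp: clinear_def ent_def bounded_linear_Blinfun_apply)
qed

text \<open>The adjoint is built from the conjugate transpose by the same construction, so that
  matrix is assumed bounded too. The two operators are adjoint on basis vectors, hence everywhere by
  continuity.\<close>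

lemma matrix_bops:
  assumes m: "bounded_matrix m K" and m': "bounded_matrix (\<lambda>i j. cnj (m j i)) K" and K: "K \<ge> 0"
  shows "\<exists>T\<in>bops. norm T \<le> K \<and> (\<forall>i j. ent T i j = m i j)"
proof -
  obtain T where T: "clinear T" "norm T \<le> K" "\<And>i j. ent T i j = m i j" using matrix_op[OF m K] by blast
  obtain S where S: "clinear S" "\<And>i j. ent S i j = cnj (m j i)" using matrix_op[OF m' K] by blast
  have Ts: "coord (T (single j c)) i = c * m i j" for i j c
    using T(1) T(3)[of i j] by (simp add: clinear_def ent_def) (metis coord_simps(6) mult.right_neutral scaleC_simps(6))
  have Ss: "coord (S (single j c)) i = c * cnj (m j i)" for i j c
    using S(1) S(2)[of i j] by (simp add: clinear_def ent_def) (metis coord_simps(6) mult.right_neutral scaleC_simps(6))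
  have "adjoint_pair T S"
    unfolding adjoint_pair_def
  proof (intro allI)
    fix f g
    have 1: "inner (T (single i c)) g' = inner (single i c) (S g')" for i c g'
    proof (rule bounded_linear_ell2_eqI[where \<phi> = "\<lambda>g'. inner (T (single i c)) g'"])
      show "bounded_linear (\<lambda>g'. inner (single i c) (S g'))"
        by (rule bounded_linear_compose[OF bounded_linear_inner_right blinfun.bounded_linear_right])
      show "inner (T (single i c)) (single j d) = inner (single i c) (S (single j d))" for j d
        by (subst (2) inner_commute) (simp add: inner_single Ts Ss, simp add: inner_complex_def algebra_simps)
    qed (rule bounded_linear_inner_right)
    show "inner (T f) g = inner f (S g)"
    proof (rule bounded_linear_ell2_eqI[where \<phi> = "\<lambda>f. inner (T f) g"])
      show "bounded_linear (\<lambda>f. inner (T f) g)"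
        by (rule bounded_linear_compose[OF bounded_linear_inner_left blinfun.bounded_linear_right])
    qed (use 1 bounded_linear_inner_left in auto)
  qed
  then show ?thesis using T by (auto simp: bops_def)
qed

section \<open>The C*-algebra generated by the monomial operators\<close>

definition monomial_ops :: "'i op set" where
  "monomial_ops = {T \<in> bops. (\<forall>i i' j. ent T i j \<noteq> 0 \<and> ent T i' j \<noteq> 0 \<longrightarrow> i = i') \<and>
     (\<forall>i j j'. ent T i j \<noteq> 0 \<and> ent T i j' \<noteq> 0 \<longrightarrow> j = j')}"

definition diag_ops :: "'i op set" where
  "diag_ops = {T \<in> bops. \<forall>i j. i \<noteq> j \<longrightarrow> ent T i j = 0}"

text \<open>\<open>span\<close> is the real span. Since a monomial operator composed with
  \<open>mulC c\<close> is again monomial, it is also the complex span.\<close>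

definition monomial_alg :: "'i op set" where "monomial_alg = closure (span monomial_ops)"

lemma ent_compose:
  assumes T: "T \<in> bops" and S: "\<And>k'. k' \<noteq> k \<Longrightarrow> ent S k' j = 0"
  shows "ent (T o\<^sub>L S) i j = ent T i k * ent S k j"
proof -
  have "blinfun_apply S (single j 1) = single k (ent S k j)"
    using S by (intro ell2_eqI) (auto simp: ent_def)
  then show ?thesis using apply_single[OF T] by (simp add: ent_def[of "T o\<^sub>L S"])
qed

lemma ent_compose_monomial:
  assumes T: "T \<in> bops" and S: "S \<in> monomial_ops" and nz: "ent (T o\<^sub>L S) i j \<noteq> 0"
  obtains k where "ent S k j \<noteq> 0" "ent T i k \<noteq> 0" "ent (T o\<^sub>L S) i j = ent T i k * ent S k j"
proof -
  have "\<exists>k. ent S k j \<noteq> 0"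
  proof (rule ccontr)
    assume "\<nexists>k. ent S k j \<noteq> 0"
    \<comment> \<open>The column of \<open>S\<close> is zero, so any index serves as
      \<open>k\<close>.\<close>
    then show False using ent_compose[OF T, of undefined S j i] nz by simp
  qed
  then obtain k where k: "ent S k j \<noteq> 0" by blast
  then have "ent (T o\<^sub>L S) i j = ent T i k * ent S k j"
    using S by (intro ent_compose[OF T]) (auto simp: monomial_ops_def)
  then show thesis using that k nz by auto
qed

lemma diag_subset_monomial: "diag_ops \<subseteq> monomial_ops"
  unfolding diag_ops_def monomial_ops_def by clarsimp metis

lemma ent_compose_diag_right: "T \<in> bops \<Longrightarrow> d \<in> diag_ops \<Longrightarrow> ent (T o\<^sub>L d) i j = ent T i j * ent d j j"
  by (rule ent_compose) (auto simp: diag_ops_def)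

lemma adj_diag: "d \<in> diag_ops \<Longrightarrow> adj d \<in> diag_ops"
  by (auto simp: diag_ops_def adj_in_bops ent_adj)

text \<open>\<open>ent_compose\<close> wants a column with at most one nonzero entry in the right
  factor, which a general \<open>T\<close> lacks; passing to adjoints puts the diagonal factor on
  the right.\<close>

lemma ent_compose_diag_left:
  assumes T: "T \<in> bops" and d: "d \<in> diag_ops" shows "ent (d o\<^sub>L T) i j = ent d i i * ent T i j"
proof -
  have db: "d \<in> bops" using d by (simp add: diag_ops_def)
  have "ent (adj (d o\<^sub>L T)) j i = ent (adj T) j i * ent (adj d) i i"
    unfolding bops_closed(4)[OF db T]
    by (rule ent_compose_diag_right) (use T d adj_diag adj_in_bops in auto)
  then have "cnj (ent (d o\<^sub>L T) i j) = cnj (ent T i j * ent d i i)"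
    using T db bops_closed(3)[OF db T] by (simp add: ent_adj)
  then show ?thesis by (simp only: complex_cnj_cancel_iff mult.commute)
qed

lemma monomial_compose: assumes T: "T \<in> monomial_ops" and S: "S \<in> monomial_ops" shows "T o\<^sub>L S \<in> monomial_ops"
proof -
  have b: "T \<in> bops" "S \<in> bops" using T S by (auto simp: monomial_ops_def)
  have "i = i'" if nz: "ent (T o\<^sub>L S) i j \<noteq> 0" "ent (T o\<^sub>L S) i' j \<noteq> 0" for i i' j
  proof -
    obtain k k' where "ent S k j \<noteq> 0" "ent T i k \<noteq> 0" "ent S k' j \<noteq> 0" "ent T i' k' \<noteq> 0"
      using ent_compose_monomial[OF b(1) S nz(1)] ent_compose_monomial[OF b(1) S nz(2)] by metis
    then show ?thesis using T S unfolding monomial_ops_def by blast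
  qed
  moreover have "j = j'" if nz: "ent (T o\<^sub>L S) i j \<noteq> 0" "ent (T o\<^sub>L S) i j' \<noteq> 0" for i j j'
  proof -
    obtain k k' where "ent S k j \<noteq> 0" "ent T i k \<noteq> 0" "ent S k' j' \<noteq> 0" "ent T i k' \<noteq> 0"
      using ent_compose_monomial[OF b(1) S nz(1)] ent_compose_monomial[OF b(1) S nz(2)] by metis
    then show ?thesis using T S unfolding monomial_ops_def by blast
  qed
  ultimately show ?thesis using bops_closed(3)[OF b] unfolding monomial_ops_def by blast
qed

lemma monomial_adj: "T \<in> monomial_ops \<Longrightarrow> adj T \<in> monomial_ops"
  unfolding monomial_ops_def by (simp add: adj_in_bops ent_adj) blast

lemma mulC_diag: "mulC c \<in> diag_ops"
  by (simp add: diag_ops_def mulC_in_bops ent_simps)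

lemma zero_diag: "0 \<in> diag_ops"
  by (simp add: diag_ops_def zero_in_bops ent_simps)

lemma closed_monomial_alg: "closed monomial_alg" by (simp add: monomial_alg_def)

lemma subspace_monomial_alg: "subspace monomial_alg"
  unfolding subspace_def monomial_alg_def
proof (intro conjI ballI allI)
  show "0 \<in> closure (span monomial_ops)" using closure_subset span_zero by blast
  fix x y :: "'a op" and c :: real
  assume x: "x \<in> closure (span monomial_ops)"
  then obtain X where X: "\<And>n. X n \<in> span monomial_ops" "X \<longlonglongrightarrow> x" by (auto simp: closure_sequential)
  show "c *\<^sub>R x \<in> closure (span monomial_ops)"
    unfolding closure_sequential using X by (intro exI[of _ "\<lambda>n. c *\<^sub>R X n"]) (auto intro: span_scale tendsto_intros)
  assume y: "y \<in> closure (span monomial_ops)"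
  then obtain Y where Y: "\<And>n. Y n \<in> span monomial_ops" "Y \<longlonglongrightarrow> y" by (auto simp: closure_sequential)
  show "x + y \<in> closure (span monomial_ops)"
    unfolding closure_sequential using X Y by (intro exI[of _ "\<lambda>n. X n + Y n"]) (auto intro: span_add tendsto_intros)
qed

lemma monomial_subset_alg: "monomial_ops \<subseteq> monomial_alg"
  unfolding monomial_alg_def using closure_subset span_superset by blast

text \<open>This serves as the induction principle for the algebra: properties that cut out a closed
  subspace need checking on monomial operators only.\<close>

lemma monomial_alg_minimal: "monomial_ops \<subseteq> V \<Longrightarrow> subspace V \<Longrightarrow> closed V \<Longrightarrow> monomial_alg \<subseteq> V"
  unfolding monomial_alg_def by (intro closure_minimal span_minimal)

lemma monomial_alg_image:
  assumes "bounded_linear \<phi>" "\<phi> ` monomial_ops \<subseteq> monomial_alg" "T \<in> monomial_alg"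
  shows "\<phi> T \<in> monomial_alg"
proof -
  interpret bounded_linear \<phi> by fact
  have "monomial_alg \<subseteq> \<phi> -` monomial_alg"
  proof (rule monomial_alg_minimal)
    show "monomial_ops \<subseteq> \<phi> -` monomial_alg" using assms(2) by blast
    show "subspace (\<phi> -` monomial_alg)"
      using subspace_monomial_alg by (auto simp: subspace_def add scaleR zero)
    show "closed (\<phi> -` monomial_alg)"
      by (intro closed_vimage closed_monomial_alg linear_continuous_on) (rule assms(1))
  qed
  then show ?thesis using assms(3) by blast
qed

lemma subspace_bops: "subspace bops"
  using zero_in_bops bops_closed(1) bops_closed(3)[OF mulC_in_bops(1)] by (auto simp: subspace_def scaleR_eq_mulC)

lemma closed_bops: "closed bops"
  using tendsto_adj(1) by (auto simp: closed_sequential_limits)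

lemma monomial_alg_bops: "monomial_alg \<subseteq> bops"
  by (rule monomial_alg_minimal) (auto simp: monomial_ops_def subspace_bops closed_bops)

lemma monomial_alg_add: "S \<in> monomial_alg \<Longrightarrow> T \<in> monomial_alg \<Longrightarrow> S + T \<in> monomial_alg"
  and monomial_alg_zero: "0 \<in> monomial_alg"
  using subspace_monomial_alg by (auto simp: subspace_def)

lemma bounded_linear_compose_left: "bounded_linear (\<lambda>A. A o\<^sub>L B)"
  and bounded_linear_compose_right: "bounded_linear (\<lambda>B. A o\<^sub>L B)"
  using bounded_bilinear.bounded_linear_left[OF bounded_bilinear_blinfun_compose]
    bounded_bilinear.bounded_linear_right[OF bounded_bilinear_blinfun_compose] by auto

lemma monomial_alg_compose:
  assumes "A \<in> monomial_alg" "B \<in> monomial_alg" shows "A o\<^sub>L B \<in> monomial_alg"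
proof -
  \<comment> \<open>The factors are freed one at a time: first \<open>A\<close> ranges over the
    algebra against a monomial \<open>S\<close>, then the second factor does.\<close>
  have "A o\<^sub>L S \<in> monomial_alg" if "S \<in> monomial_ops" for S
    by (rule monomial_alg_image[OF bounded_linear_compose_left _ assms(1)])
      (use that monomial_compose monomial_subset_alg in blast)
  then show ?thesis
    by (intro monomial_alg_image[OF bounded_linear_compose_right _ assms(2)]) blast
qed

text \<open>\<open>adj\<close> is controlled only on \<open>bops\<close> and is not a linear map on
  all operators, so \<open>monomial_alg_image\<close> does not apply; membership in
  \<open>bops\<close> is carried along in the closed subspace.\<close>

lemma monomial_alg_adj:
  fixes T :: "'a op"
  assumes "T \<in> monomial_alg" shows "adj T \<in> monomial_alg"
proof -
  have "monomial_alg \<subseteq> {T \<in> bops. adj (T :: 'a op) \<in> monomial_alg}"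
  proof (rule monomial_alg_minimal)
    show "monomial_ops \<subseteq> {T \<in> bops. adj (T :: 'a op) \<in> monomial_alg}"
      using monomial_adj monomial_subset_alg monomial_alg_bops by blast
    have "mulC c o\<^sub>L S \<in> monomial_alg" "S o\<^sub>L mulC c \<in> monomial_alg" if "S \<in> monomial_alg" for S :: "'a op" and c
      using that monomial_alg_compose mulC_diag diag_subset_monomial monomial_subset_alg by blast+
    then show "subspace {T \<in> bops. adj (T :: 'a op) \<in> monomial_alg}"
      by (auto simp: subspace_def scaleR_eq_mulC zero_in_bops bops_closed mulC_in_bops monomial_alg_zero monomial_alg_add)
    show "closed {T \<in> bops. adj (T :: 'a op) \<in> monomial_alg}"
      unfolding closed_sequential_limits
    proof (intro allI impI, elim conjE)
      fix X :: "nat \<Rightarrow> 'a op" and l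
      assume X: "\<forall>n. X n \<in> {T \<in> bops. adj T \<in> monomial_alg}" and l: "X \<longlonglongrightarrow> l"
      have "l \<in> bops" "(\<lambda>n. adj (X n)) \<longlonglongrightarrow> adj l" using tendsto_adj[OF _ l] X by auto
      moreover from this(2) have "adj l \<in> monomial_alg"
        by (rule closed_sequentially[OF closed_monomial_alg, rotated]) (use X in auto)
      ultimately show "l \<in> {T \<in> bops. adj T \<in> monomial_alg}" by simp
    qed
  qed
  then show ?thesis using assms by blast
qed

lemma mulC_in_alg: "mulC c \<in> monomial_alg" 
  using mulC_diag diag_subset_monomial monomial_subset_alg by blast

lemma id_in_alg: "id_blinfun \<in> monomial_alg"
  using mulC_in_alg[of 1] by (simp add: id_eq_mulC)

section \<open>Diagonal operators and the diagonal part\<close>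

definition diag_op :: "('i \<Rightarrow> complex) \<Rightarrow> 'i op" where
  "diag_op g = (THE T. T \<in> bops \<and> (\<forall>i j. ent T i j = (if i = j then g i else 0)))"

lemma bounded_matrix_diag:
  assumes g: "\<And>i. cmod (g i) \<le> K" shows "bounded_matrix (\<lambda>i j. if i = j then g i else 0) K"
  unfolding bounded_matrix_def
proof (intro allI impI, elim conjE)
  fix F G :: "'a set" and f :: "'a \<Rightarrow> complex" assume F: "finite F" and G: "finite G"
  have "(\<Sum>j\<in>F. (if i = j then g i else 0) * f j) = (if i \<in> F then g i * f i else 0)" for i
    using F by (simp add: if_distrib[of "\<lambda>x. x * _"] sum.delta cong: if_cong)
  then have "(\<Sum>i\<in>G. (cmod (\<Sum>j\<in>F. (if i = j then g i else 0) * f j))\<^sup>2) = (\<Sum>i\<in>G. if i \<in> F then (cmod (g i * f i))\<^sup>2 else 0)"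
    by (intro sum.cong) auto
  also have "\<dots> = (\<Sum>i\<in>G \<inter> F. (cmod (g i * f i))\<^sup>2)" using G by (simp add: sum.inter_restrict)
  also have "\<dots> \<le> (\<Sum>i\<in>F. (cmod (g i * f i))\<^sup>2)" using F by (intro sum_mono2) auto
  also have "\<dots> \<le> (\<Sum>i\<in>F. K\<^sup>2 * (cmod (f i))\<^sup>2)"
    using g by (intro sum_mono) (auto simp: norm_mult power_mult_distrib intro!: mult_right_mono power_mono)
  finally show "(\<Sum>i\<in>G. (cmod (\<Sum>j\<in>F. (if i = j then g i else 0) * f j))\<^sup>2) \<le> K\<^sup>2 * (\<Sum>j\<in>F. (cmod (f j))\<^sup>2)"
    by (simp add: sum_distrib_left)
qed

lemma diag_op:
  assumes g: "\<And>i. cmod (g i) \<le> K"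
  shows "diag_op g \<in> diag_ops" "norm (diag_op g) \<le> K" "ent (diag_op g) i j = (if i = j then g i else 0)"
proof -
  \<comment> \<open>The index type is inhabited, so the bound at one index already shows that
    \<open>K\<close> is nonnegative.\<close>
  have K: "K \<ge> 0" using g[of undefined] norm_ge_zero order_trans by blast
  have m': "bounded_matrix (\<lambda>i j. cnj (if j = i then g j else 0)) K"
    using bounded_matrix_diag[of "\<lambda>i. cnj (g i)" K] g by (simp add: if_distrib eq_commute cong: if_cong)
  obtain T where T: "T \<in> bops" "norm T \<le> K" "\<And>i j. ent T i j = (if i = j then g i else 0)"
    using matrix_bops[OF bounded_matrix_diag[OF g] m' K] by blast
  have "diag_op g = T" unfolding diag_op_def using T by (intro the_equality bops_eqI) auto
  then show "diag_op g \<in> diag_ops" "norm (diag_op g) \<le> K" "ent (diag_op g) i j = (if i = j then g i else 0)"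
    using T by (auto simp: diag_ops_def)
qed

definition diag_part :: "'i op \<Rightarrow> 'i op" where "diag_part T = diag_op (\<lambda>i. ent T i i)"

lemma diag_part:
  "diag_part T \<in> diag_ops" "norm (diag_part T) \<le> norm T" "ent (diag_part T) i j = (if i = j then ent T i i else 0)"
  unfolding diag_part_def using diag_op[of "\<lambda>i. ent T i i" "norm T", OF cmod_ent_le] by auto

text \<open>Operators are coded as maps on arbitrary families to fit into the universe type. On families that
  are not square summable the code is junk, which \<open>dec\<close> ignores.\<close>

type_synonym 'i coded_op = "('i \<Rightarrow> complex) \<Rightarrow> ('i \<Rightarrow> complex)"

definition enc :: "'i op \<Rightarrow> 'i coded_op" where
  "enc T = (\<lambda>f. coord (blinfun_apply T (Ell2 f)))"

definition dec :: "'i coded_op \<Rightarrow> 'i op" where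
  "dec X = Blinfun (\<lambda>f. Ell2 (X (coord f)))"

lemma dec_enc [simp]: "dec (enc T) = T"
  by (simp add: dec_def enc_def coord_inverse blinfun_apply_inverse)

lemma enc_eq_iff [simp]: "enc S = enc T \<longleftrightarrow> S = T"
  by (metis dec_enc)

section \<open>The monomial algebra and its diagonal as an inclusion\<close>

definition monomial_cstar :: "'i coded_op cstar" where
  "monomial_cstar = \<lparr>carrier = enc ` monomial_alg, monoid.mult = (\<lambda>X Y. enc (dec X o\<^sub>L dec Y)), one = enc id_blinfun,
     zero = enc 0, add = (\<lambda>X Y. enc (dec X + dec Y)), module.smult = (\<lambda>a X. enc (mulC a o\<^sub>L dec X)),
     star = (\<lambda>X. enc (adj (dec X))), nrm = (\<lambda>X. norm (dec X))\<rparr>"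

lemma monomial_cstar_simps [simp]:
  "carrier monomial_cstar = enc ` monomial_alg"
  "enc S \<otimes>\<^bsub>monomial_cstar\<^esub> enc T = enc (S o\<^sub>L T)"
  "enc S \<oplus>\<^bsub>monomial_cstar\<^esub> enc T = enc (S + T)"
  "\<one>\<^bsub>monomial_cstar\<^esub> = enc id_blinfun" "\<zero>\<^bsub>monomial_cstar\<^esub> = enc 0"
  "a \<odot>\<^bsub>monomial_cstar\<^esub> enc T = enc (mulC a o\<^sub>L T)"
  "(enc T)\<^sup>\<star>\<^bsub>monomial_cstar\<^esub> = enc (adj T)"
  "nrm monomial_cstar (enc T) = norm T"
  by (simp_all add: monomial_cstar_def)

lemma cring_complex_ring: "cring complex_ring"
proof (intro cringI abelian_groupI comm_monoidI)
  show "\<exists>y\<in>carrier complex_ring. y \<oplus>\<^bsub>complex_ring\<^esub> x = \<zero>\<^bsub>complex_ring\<^esub>" if "x \<in> carrier complex_ring" for x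
    by (intro bexI[of _ "- x"]) (auto simp: complex_ring_def)
qed (auto simp: complex_ring_def algebra_simps)

lemma blinfun_compose_simps:
  "(A o\<^sub>L B) o\<^sub>L C = A o\<^sub>L (B o\<^sub>L C)" "A o\<^sub>L (S + T) = (A o\<^sub>L S) + (A o\<^sub>L T)" "(S + T) o\<^sub>L A = (S o\<^sub>L A) + (T o\<^sub>L A)"
  "id_blinfun o\<^sub>L A = A" "A o\<^sub>L id_blinfun = A"
  by (auto intro!: blinfun_eqI simp: blinfun.add_left blinfun.add_right)

lemma mulC_simps:
  "mulC a o\<^sub>L (mulC b o\<^sub>L A) = mulC (a * b) o\<^sub>L A" "mulC (a + b) o\<^sub>L A = (mulC a o\<^sub>L A) + (mulC b o\<^sub>L A)" "mulC 1 o\<^sub>L A = A"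
  "S \<in> bops \<Longrightarrow> S o\<^sub>L (mulC a o\<^sub>L A) = mulC a o\<^sub>L (S o\<^sub>L A)"
  by (auto intro!: blinfun_eqI simp: blinfun.add_left scaleC_simps apply_scaleC)

lemma normed_monomial: "normed_star_algebra (monomial_cstar :: 'i coded_op cstar)"
proof -
  let ?U = "monomial_cstar :: 'i coded_op cstar"
  have neg: "\<exists>Y\<in>enc ` monomial_alg. Y \<oplus>\<^bsub>?U\<^esub> enc T = enc 0" if "T \<in> monomial_alg" for T :: "'i op"
  proof (intro bexI)
    show "enc (mulC (-1) o\<^sub>L T) \<in> enc ` monomial_alg" using that monomial_alg_compose mulC_in_alg by blast
    have eq: "mulC (-1) o\<^sub>L T = - T" using scaleR_eq_mulC[of "-1" T] by simp
    show "enc (mulC (-1) o\<^sub>L T) \<oplus>\<^bsub>?U\<^esub> enc T = enc 0"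
      by (simp add: eq)
  qed
  interpret R: ring ?U
  proof (intro ring.intro Ring.ring_axioms.intro abelian_groupI monoidI)
  qed (use neg in \<open>auto simp: monomial_alg_add monomial_alg_zero monomial_alg_compose blinfun_compose_simps
      id_in_alg\<close>)
  have b: "T \<in> bops" if "T \<in> monomial_alg" for T :: "'i op" using that monomial_alg_bops by blast
  show ?thesis
  proof (intro normed_star_algebra.intro R.ring_axioms normed_star_algebra_axioms.intro
      Module.module.intro module_axioms.intro R.abelian_group_axioms cring_complex_ring)
    fix X Y assume "X \<in> carrier ?U" "Y \<in> carrier ?U"
    then show "nrm ?U (X \<otimes>\<^bsub>?U\<^esub> Y) \<le> nrm ?U X * nrm ?U Y" "nrm ?U (X \<oplus>\<^bsub>?U\<^esub> Y) \<le> nrm ?U X + nrm ?U Y"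
      by (auto simp: norm_blinfun_compose norm_triangle_ineq)
  next
    fix a and X assume "X \<in> carrier ?U"
    then show "(a \<odot>\<^bsub>?U\<^esub> X)\<^sup>\<star>\<^bsub>?U\<^esub> = cnj a \<odot>\<^bsub>?U\<^esub> X\<^sup>\<star>\<^bsub>?U\<^esub>"
      using b by (auto simp: bops_closed(4) mulC_in_bops adj_in_bops intro!: blinfun_eqI simp: apply_scaleC)
  qed (use b in \<open>auto simp: complex_ring_def monomial_alg_compose mulC_in_alg mulC_simps blinfun_compose_simps
       monomial_alg_adj adj_in_bops bops_closed norm_mulC_compose\<close>)
qed

lemma monomial_minus:
  assumes "S \<in> monomial_alg" "T \<in> monomial_alg"
  shows "enc S \<ominus>\<^bsub>monomial_cstar\<^esub> enc T = enc (S - T)"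
proof -
  interpret normed_star_algebra monomial_cstar by (rule normed_monomial)
  have "enc S \<ominus>\<^bsub>monomial_cstar\<^esub> enc T = enc (S + (mulC (-1) o\<^sub>L T))"
    using assms by (subst minus_eq_smult) auto
  also have "S + (mulC (-1) o\<^sub>L T) = S - T" using scaleR_eq_mulC[of "-1" T] by simp
  finally show ?thesis .
qed

lemma cstar_monomial: "cstar_algebra (monomial_cstar :: 'i coded_op cstar)"
proof -
  let ?U = "monomial_cstar :: 'i coded_op cstar"
  interpret normed_star_algebra ?U by (rule normed_monomial)
  show ?thesis
  proof (intro cstar_algebra.intro normed_monomial cstar_algebra_axioms.intro)
    fix X assume "X \<in> carrier ?U"
    then show "nrm ?U (X\<^sup>\<star>\<^bsub>?U\<^esub> \<otimes>\<^bsub>?U\<^esub> X) = (nrm ?U X)\<^sup>2"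
      using monomial_alg_bops by (auto simp: norm_adj_compose)
  next
    show "Metric_space.mcomplete (carrier ?U) (cdist ?U)"
    proof (rule mcomplete_iff[THEN iffD2], intro allI impI, elim conjE)
      fix \<sigma> :: "nat \<Rightarrow> _"
      assume r: "range \<sigma> \<subseteq> carrier ?U"
        and c: "\<forall>e>0. \<exists>N. \<forall>m\<ge>N. \<forall>n\<ge>N. nrm ?U (\<sigma> m \<ominus>\<^bsub>?U\<^esub> \<sigma> n) < e"
      define X where "X n = dec (\<sigma> n)" for n
      have X: "\<sigma> n = enc (X n)" "X n \<in> monomial_alg" for n
      proof -
        have "\<sigma> n \<in> enc ` monomial_alg" using r by auto
        then show "\<sigma> n = enc (X n)" "X n \<in> monomial_alg" by (auto simp: X_def)
      qed
      have "Cauchy X" using c unfolding Cauchy_def dist_norm by (simp add: X monomial_minus)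
      then obtain L where L: "X \<longlonglongrightarrow> L" using Cauchy_convergent convergent_def by blast
      have LM: "L \<in> monomial_alg" by (rule closed_sequentially[OF closed_monomial_alg X(2) L])
      have "\<forall>e>0. \<exists>N. \<forall>n\<ge>N. nrm ?U (\<sigma> n \<ominus>\<^bsub>?U\<^esub> enc L) < e"
        using L unfolding LIMSEQ_def dist_norm by (simp add: X monomial_minus LM)
      then show "\<exists>x\<in>carrier ?U. \<forall>e>0. \<exists>N. \<forall>n\<ge>N. nrm ?U (\<sigma> n \<ominus>\<^bsub>?U\<^esub> x) < e" using LM by auto
    qed
  qed
qed

definition diag_sub :: "'i coded_op set" where "diag_sub = enc ` diag_ops"

lemma diag_ops_closed:
  assumes "S \<in> diag_ops" "T \<in> diag_ops"
  shows "S + T \<in> diag_ops" "S o\<^sub>L T \<in> diag_ops" "S o\<^sub>L T = T o\<^sub>L S" "S \<in> bops" "S \<in> monomial_alg"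
proof -
  have b: "S \<in> bops" "T \<in> bops" using assms by (auto simp: diag_ops_def)
  show "S \<in> bops" by (rule b)
  show "S + T \<in> diag_ops" using assms by (auto simp: diag_ops_def ent_simps bops_closed)
  show "S o\<^sub>L T \<in> diag_ops"
    using assms b ent_compose_diag_right[OF b(1) assms(2)] by (auto simp: diag_ops_def bops_closed)
  show "S o\<^sub>L T = T o\<^sub>L S"
  proof (rule bops_eqI[OF bops_closed(3)[OF b] bops_closed(3)[OF b(2,1)]])
    fix i j
    have "i \<noteq> j \<Longrightarrow> ent S i j = 0" using assms(1) by (simp add: diag_ops_def)
    then show "ent (S o\<^sub>L T) i j = ent (T o\<^sub>L S) i j"
      using ent_compose_diag_right[OF b(1) assms(2)] ent_compose_diag_left[OF b(1) assms(2)] by (cases "i = j") auto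
  qed
  show "S \<in> monomial_alg" using assms diag_subset_monomial monomial_subset_alg by blast
qed

lemma inclusion_monomial: "cstar_inclusion (monomial_cstar :: 'i coded_op cstar) diag_sub"
proof -
  let ?U = "monomial_cstar :: 'i coded_op cstar"
  interpret cstar_algebra ?U by (rule cstar_monomial)
  have "closedin (ctopology ?U) diag_sub"
    unfolding closedin_iff
  proof (intro conjI ballI impI)
    show "diag_sub \<subseteq> carrier ?U" using diag_ops_closed(5) by (auto simp: diag_sub_def)
    fix X assume "X \<in> carrier ?U" and ap: "\<forall>e>0. \<exists>Y\<in>diag_sub. nrm ?U (X \<ominus>\<^bsub>?U\<^esub> Y) < e"
    then obtain T where T: "X = enc T" "T \<in> monomial_alg" by auto
    \<comment> \<open>A diagonal operator closer to \<open>T\<close> than the modulus of an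
      off-diagonal entry would contradict the bound of entries by the norm.\<close>
    have "ent T i j = 0" if ij: "i \<noteq> j" for i j
    proof (rule ccontr)
      assume nz: "ent T i j \<noteq> 0"
      then obtain S where S: "S \<in> diag_ops" "nrm ?U (enc T \<ominus>\<^bsub>?U\<^esub> enc S) < cmod (ent T i j)"
        using ap T by (auto simp: diag_sub_def dest!: spec[of _ "cmod (ent T i j)"])
      then have "norm (T - S) < cmod (ent T i j)" using T diag_ops_closed(5)[OF S(1) S(1)] by (simp add: monomial_minus)
      moreover have "ent (T - S) i j = ent T i j"
        using S(1) ij ent_simps(1)[of "T - S" S i j] by (auto simp: diag_ops_def)
      ultimately show False using cmod_ent_le[of "T - S" i j] by simp
    qed
    then show "X \<in> diag_sub" using T monomial_alg_bops by (auto simp: diag_sub_def diag_ops_def)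
  qed
  then show ?thesis
    using cstar_monomial mulC_diag[of 1]
    unfolding cstar_inclusion_def abelian_cstar_subalgebra_def cstar_subalgebra_def
    by (auto simp: diag_sub_def id_eq_mulC diag_ops_closed(1,2) adj_diag zero_diag mulC_diag intro: diag_ops_closed(3))
qed

section \<open>The monomial operators form a C*-diagonal\<close>

text \<open>Otherwise \<open>\<rho>\<close> is a proper convex combination of the vector states of
  \<open>p\<close> and of its complement \<open>q\<close>. Purity identifies the first of these with
  \<open>\<rho>\<close>, but it takes the value 1 at \<open>p\<close>.\<close>

lemma (in cstar_state) pure_state_projection:
  assumes pure: "pure_state A \<rho>" and comm: "\<And>x y. \<lbrakk>x \<in> carrier A; y \<in> carrier A\<rbrakk> \<Longrightarrow> x \<otimes> y = y \<otimes> x"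
    and p: "p \<in> carrier A" "p\<^sup>\<star> = p" "p \<otimes> p = p"
  shows "\<rho> p = 0 \<or> \<rho> p = 1"
proof (rule ccontr)
  assume *: "\<not> ?thesis"
  define q where "q = \<one> \<oplus> (- 1) \<odot> p"
  have q: "q \<in> carrier A" "q\<^sup>\<star> = q" using p by (auto simp: q_def star_add star_smult)
  have "q \<otimes> q = \<one> \<oplus> ((- 1) \<odot> p \<oplus> ((- 1) \<odot> p \<oplus> 1 \<odot> p))"
    using p by (simp add: q_def l_distr r_distr smult_mult_left smult_mult_right smult_add_right a_ac)
  also have "(- 1) \<odot> p \<oplus> 1 \<odot> p = \<zero>" using p(1) smult_add_left[of p "- 1" 1] by simp
  finally have qq: "q \<otimes> q = q" using p by (simp add: q_def)
  define t where "t = Re (\<rho> p)"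
  have \<rho>p: "\<rho> p = of_real t" using rho_eq_Re[OF p(1)] p by (simp add: t_def)
  have \<rho>q: "\<rho> q = of_real (1 - t)" using p by (simp add: q_def rho_add rho_smult \<rho>p rho_uminus)
  have t: "0 < t" "t < 1"
    using Re_rho_pos[OF p(1)] Re_rho_pos[OF q(1)] p q qq * by (auto simp: \<rho>p \<rho>q)
  define \<sigma> \<tau> where "\<sigma> = restrict (\<lambda>x. \<rho> (p\<^sup>\<star> \<otimes> x \<otimes> p) / of_real t) (carrier A)"
    and "\<tau> = restrict (\<lambda>x. \<rho> (q\<^sup>\<star> \<otimes> x \<otimes> q) / of_real (1 - t)) (carrier A)"
  have st: "state A \<sigma>" "state A \<tau>"
    unfolding \<sigma>_def \<tau>_def
    by (rule state_vector[OF p(1)]; use p t in \<open>simp add: \<rho>p\<close>)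
      (rule state_vector[OF q(1)]; use q qq t in \<open>simp add: \<rho>q\<close>)
  have "\<rho> x = of_real t * \<sigma> x + of_real (1 - t) * \<tau> x" if x: "x \<in> carrier A" for x
  proof -
    have "p \<otimes> x \<otimes> p = x \<otimes> p" using x p comm[of p x] by (simp add: m_assoc)
    moreover have "q \<otimes> x \<otimes> q = x \<otimes> q" using x q qq comm[of q x] by (simp add: m_assoc)
    moreover have "x \<otimes> q = x \<oplus> (- 1) \<odot> (x \<otimes> p)" using x p by (simp add: q_def r_distr smult_mult_right)
    moreover have "complex_of_real t \<noteq> 0" "complex_of_real (1 - t) \<noteq> 0" using t by (auto simp del: of_real_diff)
    ultimately show ?thesis
      using x p q by (simp add: \<sigma>_def \<tau>_def rho_add rho_smult rho_uminus del: of_real_diff)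
  qed
  then have "\<sigma> = \<rho>" using pure st t by (auto simp: pure_state_def)
  then have "\<sigma> p = \<rho> p" by simp
  then have "\<rho> p / of_real t = \<rho> p" using p by (simp add: \<sigma>_def)
  then show False using t by (simp add: \<rho>p)
qed

text \<open>A basis vector is moved along the only nonzero entry of its column, scaled by
  \<open>d\<close>, and moved back along the same entry, which is also the only one of its
  row.\<close>

lemma monomial_conj_diag:
  assumes T: "T \<in> monomial_ops" and d: "d \<in> diag_ops"
  shows "adj T o\<^sub>L d o\<^sub>L T \<in> diag_ops"
proof -
  have b: "T \<in> bops" "d \<in> bops" "adj T \<in> bops" using T d by (auto simp: monomial_ops_def diag_ops_def adj_in_bops)
  have dT: "d o\<^sub>L T \<in> monomial_ops" using monomial_compose T d diag_subset_monomial by blast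
  have "ent (adj T o\<^sub>L (d o\<^sub>L T)) i j = 0" if ij: "i \<noteq> j" for i j
  proof (rule ccontr)
    assume "ent (adj T o\<^sub>L (d o\<^sub>L T)) i j \<noteq> 0"
    then obtain k where "ent (d o\<^sub>L T) k j \<noteq> 0" "ent (adj T) i k \<noteq> 0"
      using ent_compose_monomial[OF b(3) dT] by metis
    then have "ent T k j \<noteq> 0" "ent T k i \<noteq> 0" using b d by (auto simp: ent_compose_diag_left ent_adj)
    then show False using T ij unfolding monomial_ops_def by blast
  qed
  then show ?thesis using b by (simp add: diag_ops_def bops_closed blinfun_compose_simps)
qed

lemma monomial_normalizers: "T \<in> monomial_ops \<Longrightarrow> enc T \<in> normalizers monomial_cstar diag_sub"
proof -
  assume T: "T \<in> monomial_ops"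
  have b: "T \<in> bops" using T by (simp add: monomial_ops_def)
  show ?thesis
    using T monomial_conj_diag[OF T] monomial_conj_diag[OF monomial_adj[OF T]] monomial_subset_alg
    by (auto simp: normalizers_def diag_sub_def adj_in_bops[OF b])
qed

lemma regular_monomial: "regular_inclusion (monomial_cstar :: 'i coded_op cstar) diag_sub"
proof -
  let ?U = "monomial_cstar :: 'i coded_op cstar"
  interpret cstar_algebra ?U by (rule cstar_monomial)
  have N: "normalizers ?U diag_sub \<subseteq> carrier ?U" by (auto simp: normalizers_def)
  have span: "enc S \<in> cspan ?U (normalizers ?U diag_sub)" if "S \<in> span monomial_ops" for S
    using that
  proof (induction rule: span_induct_alt)
    case base
    then show ?case using cspan_zero[of "normalizers ?U diag_sub"] by simp
  next
    case (step c x y)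
    then show ?case
      using cspan_smult_add[OF N monomial_normalizers[OF step(1)] step(2), of "of_real c"]
      by (simp add: scaleR_eq_mulC)
  qed
  have "X \<in> ctopology ?U closure_of (cspan ?U (normalizers ?U diag_sub))" if X: "X \<in> carrier ?U" for X
    unfolding in_closure_of_iff[OF cspan_subset[OF N]]
  proof (intro conjI allI impI X)
    fix e :: real assume e: "e > 0"
    obtain T where T: "X = enc T" "T \<in> monomial_alg" using X by auto
    obtain S where S: "S \<in> span monomial_ops" "dist S T < e"
      using T(2) e unfolding monomial_alg_def closure_approachable by blast
    have "S \<in> monomial_alg" using S(1) closure_subset unfolding monomial_alg_def by blast
    then have "nrm ?U (X \<ominus>\<^bsub>?U\<^esub> enc S) < e" using T S(2) by (simp add: monomial_minus dist_norm norm_minus_commute)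
    then show "\<exists>y\<in>cspan ?U (normalizers ?U diag_sub). nrm ?U (X \<ominus>\<^bsub>?U\<^esub> y) < e" using span[OF S(1)] by blast
  qed
  moreover have "ctopology ?U closure_of (cspan ?U (normalizers ?U diag_sub)) \<subseteq> carrier ?U"
    using in_closure_of_iff[OF cspan_subset[OF N]] by blast
  ultimately show ?thesis unfolding regular_inclusion_def using inclusion_monomial by blast
qed

section \<open>Maximality of the diagonal and the faithful expectation\<close>

definition indicator_op :: "'i set \<Rightarrow> 'i op" where
  "indicator_op B = diag_op (\<lambda>i. if i \<in> B then 1 else 0)"

lemma indicator_op:
  "indicator_op B \<in> diag_ops" "ent (indicator_op B) i j = (if i = j \<and> i \<in> B then 1 else 0)"
  unfolding indicator_op_def using diag_op[of "\<lambda>i. if i \<in> B then 1 else 0" 1] by auto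

text \<open>Commuting with the rank-one projection \<open>indicator_op {i}\<close> kills the
  off-diagonal entries of row \<open>i\<close>.\<close>

lemma MASA_monomial: "MASA_inclusion (monomial_cstar :: 'i coded_op cstar) diag_sub"
proof -
  let ?U = "monomial_cstar :: 'i coded_op cstar"
  interpret cstar_algebra ?U by (rule cstar_monomial)
  have "B \<subseteq> diag_sub" if B: "abelian_cstar_subalgebra ?U B" "diag_sub \<subseteq> B" for B
  proof
    fix X assume X: "X \<in> B"
    have "B \<subseteq> carrier ?U" using B(1) unfolding abelian_cstar_subalgebra_def cstar_subalgebra_def closedin_iff by blast
    then obtain T where T: "X = enc T" "T \<in> monomial_alg" using X by auto
    have Tb: "T \<in> bops" using T(2) monomial_alg_bops by blast
    have "ent T i j = 0" if ij: "i \<noteq> j" for i j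
    proof -
      have "enc (indicator_op {i}) \<in> B" using B(2) indicator_op(1) by (auto simp: diag_sub_def)
      then have "enc (indicator_op {i}) \<otimes>\<^bsub>?U\<^esub> enc T = enc T \<otimes>\<^bsub>?U\<^esub> enc (indicator_op {i})"
        using B(1) X T(1) unfolding abelian_cstar_subalgebra_def by blast
      then have "ent (indicator_op {i} o\<^sub>L T) i j = ent (T o\<^sub>L indicator_op {i}) i j" by simp
      then show ?thesis
        using ij by (simp add: ent_compose_diag_left[OF Tb indicator_op(1)] ent_compose_diag_right[OF Tb indicator_op(1)] indicator_op(2))
    qed
    then show "X \<in> diag_sub" using T Tb by (auto simp: diag_sub_def diag_ops_def)
  qed
  then show ?thesis unfolding MASA_inclusion_def using inclusion_monomial by blast
qed

lemma diag_eqI: "S \<in> diag_ops \<Longrightarrow> T \<in> diag_ops \<Longrightarrow> (\<And>i. ent S i i = ent T i i) \<Longrightarrow> S = T"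
  by (rule bops_eqI) (auto simp: diag_ops_def, metis)

lemma ent_adj_compose_self: assumes T: "T \<in> bops" shows "ent (adj T o\<^sub>L T) i i = of_real ((norm (blinfun_apply T (single i 1)))\<^sup>2)"
proof -
  define v where "v = blinfun_apply T (single i 1)"
  have "inner (blinfun_apply T (single i c)) v = inner (single i c) (blinfun_apply (adj T) v)" for c
    by (rule inner_adj[OF T])
  moreover have "inner (single i c) (blinfun_apply (adj T) v) = inner (ent (adj T o\<^sub>L T) i i) c" for c
    by (subst inner_commute) (simp add: inner_single ent_def v_def)
  moreover have "blinfun_apply T (single i c) = scaleC c v" for c
    using apply_scaleC[OF T, of c "single i 1"] by (simp add: v_def scaleC_simps)
  ultimately have *: "inner (ent (adj T o\<^sub>L T) i i) c = inner (scaleC c v) v" for c by metis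
  \<comment> \<open>For the real inner product, multiplication by \<open>\<i>\<close> turns a vector
    into an orthogonal one; this removes the imaginary part of the entry.\<close>
  have "inner (scaleC \<i> v) v = - inner (scaleC \<i> v) v"
  proof -
    have "inner (scaleC \<i> v) v = inner v (scaleC (- \<i>) v)" by (simp add: inner_scaleC)
    also have "scaleC (- \<i>) v = - scaleC \<i> v" by (rule ell2_eqI) simp
    also have "inner v (- scaleC \<i> v) = - inner (scaleC \<i> v) v" by (simp add: inner_commute)
    finally show ?thesis .
  qed
  then have "inner (scaleC \<i> v) v = 0" by simp
  then show ?thesis
    using *[of 1] *[of \<i>] unfolding v_def[symmetric]
    by (simp add: scaleC_simps inner_complex_def complex_eq_iff power2_norm_eq_inner)
qed

lemma expectation_monomial:
  "faithful_expectation (monomial_cstar :: 'i coded_op cstar) diag_sub (\<lambda>X. enc (diag_part (dec X)))"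
proof -
  let ?U = "monomial_cstar :: 'i coded_op cstar"
  have b: "T \<in> bops" if "T \<in> monomial_alg" for T :: "'i op" using that monomial_alg_bops by blast
  have db: "d \<in> bops" if "d \<in> diag_ops" for d :: "'i op" using that by (simp add: diag_ops_def)
  have add: "diag_part (S + T) = diag_part S + diag_part T" for S T :: "'i op"
    by (intro diag_eqI diag_part diag_ops_closed) (simp add: diag_part(3) ent_simps)
  have sm: "diag_part (mulC a o\<^sub>L T) = mulC a o\<^sub>L diag_part T" for T :: "'i op" and a
    by (intro diag_eqI diag_part diag_ops_closed mulC_diag) (simp add: diag_part(3) ent_simps)
  have idd: "diag_part d = d" if "d \<in> diag_ops" for d :: "'i op"
    by (intro diag_eqI diag_part that) (simp add: diag_part(3))
  have mod: "diag_part (d o\<^sub>L T) = d o\<^sub>L diag_part T" "diag_part (T o\<^sub>L d) = diag_part T o\<^sub>L d"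
    if "d \<in> diag_ops" "T \<in> bops" for d T :: "'i op"
    by (intro diag_eqI diag_part diag_ops_closed that;
        simp add: diag_part(3) ent_compose_diag_left ent_compose_diag_right that db[OF diag_part(1)])+
  have pos: "\<exists>d\<in>diag_ops. diag_part (adj T o\<^sub>L T) = adj d o\<^sub>L d" if T: "T \<in> bops" for T :: "'i op"
  proof -
    \<comment> \<open>The diagonal of \<open>adj T\<close> composed with \<open>T\<close> consists
      of squared column norms, so the column norms form its positive square root; they are bounded
      by \<open>norm T\<close>.\<close>
    define g where "g i = complex_of_real (norm (blinfun_apply T (single i 1)))" for i
    have g: "cmod (g i) \<le> norm T" for i using norm_blinfun[of T "single i 1"] by (simp add: g_def)
    note d = diag_op[of g "norm T", OF g]
    have "diag_part (adj T o\<^sub>L T) = adj (diag_op g) o\<^sub>L diag_op g"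
    proof (intro diag_eqI diag_part diag_ops_closed adj_diag d(1))
      fix i
      have "ent (adj (diag_op g) o\<^sub>L diag_op g) i i = cnj (g i) * g i"
        using d db[OF d(1)] by (simp add: ent_compose_diag_right adj_in_bops ent_adj)
      then show "ent (diag_part (adj T o\<^sub>L T)) i i = ent (adj (diag_op g) o\<^sub>L diag_op g) i i"
        by (simp add: diag_part(3) ent_adj_compose_self[OF T] g_def power2_eq_square)
    qed
    then show ?thesis using d(1) by blast
  qed
  have faith: "T = 0" if T: "T \<in> bops" and z: "diag_part (adj T o\<^sub>L T) = 0" for T :: "'i op"
  proof (rule bops_eqI[OF T zero_in_bops(1)])
    fix i j
    have "ent (diag_part (adj T o\<^sub>L T)) j j = 0" by (simp add: z ent_simps)
    then have "blinfun_apply T (single j 1) = 0" by (simp add: diag_part(3) ent_adj_compose_self[OF T])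
    then show "ent T i j = ent 0 i j" by (simp add: ent_def)
  qed
  have "conditional_expectation ?U diag_sub (\<lambda>X. enc (diag_part (dec X)))"
    unfolding conditional_expectation_def
  proof (intro conjI)
    show "\<forall>x\<in>carrier ?U. \<exists>d\<in>diag_sub. enc (diag_part (dec (x\<^sup>\<star>\<^bsub>?U\<^esub> \<otimes>\<^bsub>?U\<^esub> x))) = d\<^sup>\<star>\<^bsub>?U\<^esub> \<otimes>\<^bsub>?U\<^esub> d"
      using pos b by (auto simp: diag_sub_def)
  qed (auto simp: diag_sub_def diag_part(1,2) add sm idd mod b)
  then show ?thesis unfolding faithful_expectation_def using faith b by auto
qed

text \<open>Let \<open>s\<close> be the partial injection underlying \<open>T\<close>. If \<open>A\<close> is maximal with \<open>A \<inter> s(A) = {}\<close>, then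
  \<open>A\<close>, \<open>s(A)\<close> and the preimage of \<open>A\<close> cover everything.\<close>

lemma monomial_offdiag_cover:
  assumes T: "T \<in> monomial_ops" and off: "\<And>i. ent T i i = 0"
  shows "\<exists>\<B>. finite \<B> \<and> \<Union>\<B> = UNIV \<and> (\<forall>B\<in>\<B>. \<forall>x\<in>B. \<forall>y\<in>B. ent T y x = 0)"
proof -
  define \<A> where "\<A> = {A. \<forall>x\<in>A. \<forall>y\<in>A. ent T y x = 0}"
  have "\<exists>A\<in>\<A>. \<forall>X\<in>\<A>. A \<subseteq> X \<longrightarrow> X = A"
  proof (rule subset_Zorn_nonempty)
    have "{} \<in> \<A>" by (simp add: \<A>_def)
    then show "\<A> \<noteq> {}" by blast
    fix \<C> assume "\<C> \<noteq> {}" and \<C>: "subset.chain \<A> \<C>"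
    have "ent T y x = 0" if xy: "x \<in> \<Union>\<C>" "y \<in> \<Union>\<C>" for x y
    proof -
      obtain X Y where XY: "X \<in> \<C>" "Y \<in> \<C>" "x \<in> X" "y \<in> Y" using xy by blast
      then have "X \<subseteq> Y \<or> Y \<subseteq> X" using \<C> by (auto simp: subset_chain_def)
      then obtain Z where "Z \<in> \<C>" "x \<in> Z" "y \<in> Z" using XY by blast
      moreover then have "Z \<in> \<A>" using \<C> by (auto simp: subset_chain_def)
      ultimately show ?thesis by (simp add: \<A>_def)
    qed
    then show "\<Union>\<C> \<in> \<A>" by (simp add: \<A>_def)
  qed
  then obtain A where "A \<in> \<A>" and m: "\<And>X. X \<in> \<A> \<Longrightarrow> A \<subseteq> X \<Longrightarrow> X = A" by blast
  then have A: "\<And>x y. x \<in> A \<Longrightarrow> y \<in> A \<Longrightarrow> ent T y x = 0" by (simp add: \<A>_def)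
  have max: "X = A" if "A \<subseteq> X" "\<forall>x\<in>X. \<forall>y\<in>X. ent T y x = 0" for X
    using m[of X] that by (simp add: \<A>_def)
  define A2 A3 where "A2 = {y. \<exists>x\<in>A. ent T y x \<noteq> 0}" and "A3 = {x. \<exists>y\<in>A. ent T y x \<noteq> 0}"
  have col: "\<And>i i' j. ent T i j \<noteq> 0 \<Longrightarrow> ent T i' j \<noteq> 0 \<Longrightarrow> i = i'"
    and row: "\<And>i j j'. ent T i j \<noteq> 0 \<Longrightarrow> ent T i j' \<noteq> 0 \<Longrightarrow> j = j'"
    using T unfolding monomial_ops_def by blast+
  have cover: "x \<in> A \<union> A2 \<union> A3" for x
  proof (rule ccontr)
    assume x: "x \<notin> A \<union> A2 \<union> A3"
    \<comment> \<open>Outside \<open>A2\<close> and \<open>A3\<close> no nonzero entry links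
      \<open>x\<close> with \<open>A\<close>, and the diagonal entry at \<open>x\<close> vanishes,
      so adding \<open>x\<close> would keep the set admissible.\<close>
    have "insert x A = A" by (rule max) (use x off A in \<open>auto simp: A2_def A3_def\<close>)
    then show False using x by blast
  qed
  have A2: "ent T y' y = 0" if "y \<in> A2" "y' \<in> A2" for y y'
  proof (rule ccontr)
    assume nz: "ent T y' y \<noteq> 0"
    obtain x x' where "x \<in> A" "ent T y x \<noteq> 0" "x' \<in> A" "ent T y' x' \<noteq> 0" using \<open>y \<in> A2\<close> \<open>y' \<in> A2\<close> by (auto simp: A2_def)
    then show False using row[OF nz, of x'] A[of x x'] by simp
  qed
  have A3: "ent T x' x = 0" if "x \<in> A3" "x' \<in> A3" for x x'
  proof (rule ccontr)
    assume nz: "ent T x' x \<noteq> 0"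
    obtain y y' where "y \<in> A" "ent T y x \<noteq> 0" "y' \<in> A" "ent T y' x' \<noteq> 0" using \<open>x \<in> A3\<close> \<open>x' \<in> A3\<close> by (auto simp: A3_def)
    then show False using col[OF nz, of y] A[of y y'] by simp
  qed
  show ?thesis
    using cover A A2 A3 by (intro exI[of _ "{A, A2, A3}"]) auto
qed

text \<open>A state that is 0 or 1 on each indicator is concentrated on one of the finitely many sets covering
  the index set, and compressing the operator to any of them gives 0.\<close>

lemma state_monomial_offdiag:
  fixes \<rho> :: "'i coded_op \<Rightarrow> complex"
  assumes st: "state monomial_cstar \<rho>"
    and proj: "\<And>B. \<rho> (enc (indicator_op B)) = 0 \<or> \<rho> (enc (indicator_op B)) = 1"
    and T: "T \<in> monomial_ops" and off: "\<And>i. ent T i i = 0"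
  shows "\<rho> (enc T) = 0"
proof -
  interpret cstar_state monomial_cstar \<rho> using cstar_monomial st by (rule cstar_stateI)
  obtain \<B> where \<B>: "finite \<B>" "\<Union>\<B> = UNIV" "\<forall>B\<in>\<B>. \<forall>x\<in>B. \<forall>y\<in>B. ent T y x = 0"
    using monomial_offdiag_cover[OF T off] by blast
  have Pa: "indicator_op B \<in> monomial_alg" "indicator_op B \<in> bops" for B :: "'i set"
    using diag_ops_closed(4,5)[OF indicator_op(1) indicator_op(1)] by auto
  have Ps: "adj (indicator_op B) = indicator_op B" for B :: "'i set"
    by (intro bops_eqI adj_in_bops Pa) (auto simp: ent_adj Pa indicator_op(2))
  have PP: "indicator_op B o\<^sub>L indicator_op C = indicator_op (B \<inter> C)" for B C :: "'i set"
    by (intro bops_eqI bops_closed Pa) (auto simp: ent_compose_diag_right[OF Pa(2) indicator_op(1)] indicator_op(2))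
  \<comment> \<open>A projection of value 0 or 1 attains equality in Cauchy--Schwarz against the
    unit, so \<open>\<rho>\<close> is multiplicative with respect to it.\<close>
  have right: "\<rho> (enc (S o\<^sub>L indicator_op B)) = \<rho> (enc S) * \<rho> (enc (indicator_op B))"
    and left: "\<rho> (enc (indicator_op B o\<^sub>L S)) = \<rho> (enc (indicator_op B)) * \<rho> (enc S)"
    if S: "S \<in> monomial_alg" for S and B :: "'i set"
    using rho_mult_right[of "enc S" "enc (indicator_op B)"] rho_mult_left[of "enc S" "enc (indicator_op B)"]
      S Pa proj[of B] by (auto simp: Ps PP)
  have un: "\<rho> (enc (indicator_op (\<Union>\<F>))) = 0" if "finite \<F>" "\<forall>B\<in>\<F>. \<rho> (enc (indicator_op B)) = 0" for \<F> :: "'i set set"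
    using that
  proof (induction \<F>)
    case empty
    have "indicator_op {} = (0 :: 'i op)"
      by (intro bops_eqI Pa zero_in_bops) (simp add: indicator_op(2) ent_simps)
    then show ?case using rho_zero by simp
  next
    case (insert B \<F>)
    \<comment> \<open>Inclusion and exclusion for two projections; the value at the intersection
      factors and is therefore 0.\<close>
    have "indicator_op (B \<union> \<Union>\<F>) + indicator_op (B \<inter> \<Union>\<F>) = indicator_op B + indicator_op (\<Union>\<F>)"
      by (intro bops_eqI bops_closed Pa) (auto simp: ent_simps indicator_op(2))
    then have "\<rho> (enc (indicator_op (B \<union> \<Union>\<F>)) \<oplus>\<^bsub>monomial_cstar\<^esub> enc (indicator_op (B \<inter> \<Union>\<F>)))
        = \<rho> (enc (indicator_op B) \<oplus>\<^bsub>monomial_cstar\<^esub> enc (indicator_op (\<Union>\<F>)))" by simp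
    then have "\<rho> (enc (indicator_op (B \<union> \<Union>\<F>))) + \<rho> (enc (indicator_op (B \<inter> \<Union>\<F>)))
        = \<rho> (enc (indicator_op B)) + \<rho> (enc (indicator_op (\<Union>\<F>)))" using Pa by (subst (asm) (1 2) rho_add) auto
    moreover have "\<rho> (enc (indicator_op (B \<inter> \<Union>\<F>))) = 0" using left[OF Pa(1)] insert by (simp flip: PP)
    ultimately show ?case using insert by simp
  qed
  have "indicator_op UNIV = (id_blinfun :: 'i op)"
    by (intro bops_eqI Pa) (auto simp: id_eq_mulC mulC_in_bops indicator_op(2) ent_simps)
  then have "\<rho> (enc (indicator_op (\<Union>\<B>))) = 1" using rho_one \<B>(2) by simp
  then obtain B where B: "B \<in> \<B>" "\<rho> (enc (indicator_op B)) = 1" using un[OF \<B>(1)] proj by force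
  have Ta: "T \<in> monomial_alg" "T \<in> bops" using T monomial_subset_alg by (auto simp: monomial_ops_def)
  have "indicator_op B o\<^sub>L (T o\<^sub>L indicator_op B) = 0"
  proof (intro bops_eqI bops_closed Pa Ta zero_in_bops)
    fix i j
    show "ent (indicator_op B o\<^sub>L (T o\<^sub>L indicator_op B)) i j = ent 0 i j"
      using \<B>(3)[rule_format, OF B(1), of j i]
      by (simp add: ent_compose_diag_left[OF bops_closed(3)[OF Ta(2) Pa(2)] indicator_op(1)]
          ent_compose_diag_right[OF Ta(2) indicator_op(1)] indicator_op(2) ent_simps)
  qed
  then have "0 = \<rho> (enc (indicator_op B o\<^sub>L (T o\<^sub>L indicator_op B)))" using rho_zero by simp
  also have "\<dots> = \<rho> (enc T)" 
    using left[OF monomial_alg_compose[OF Ta(1) Pa(1)], of B B] right[OF Ta(1), of B] B(2) by simp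
  finally show ?thesis by simp
qed

text \<open>A monomial operator minus its diagonal part is monomial with zero diagonal, where both
  states vanish; on the diagonal part they agree by assumption. Linearity and norm continuity carry
  the equality to the whole algebra.\<close>

lemma state_monomial_eq:
  fixes \<rho> \<tau> :: "'i coded_op \<Rightarrow> complex"
  assumes \<rho>: "state monomial_cstar \<rho>" and \<tau>: "state monomial_cstar \<tau>"
    and eq: "\<And>d. d \<in> diag_sub \<Longrightarrow> \<rho> d = \<tau> d"
    and proj: "\<And>B. \<rho> (enc (indicator_op B)) = 0 \<or> \<rho> (enc (indicator_op B)) = 1"
  shows "\<rho> = \<tau>"
proof -
  interpret R: cstar_state monomial_cstar \<rho> using cstar_monomial \<rho> by (rule cstar_stateI)
  interpret T: cstar_state monomial_cstar \<tau> using cstar_monomial \<tau> by (rule cstar_stateI)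
  have projT: "\<tau> (enc (indicator_op B)) = 0 \<or> \<tau> (enc (indicator_op B)) = 1" for B
    using proj[of B] eq[of "enc (indicator_op B)"] indicator_op(1)[of B] by (auto simp: diag_sub_def)
  have mono: "\<rho> (enc S) = \<tau> (enc S)" if S: "S \<in> monomial_ops" for S
  proof -
    define S' where "S' = S + (mulC (-1) o\<^sub>L diag_part S)"
    have dp: "diag_part S \<in> diag_ops" "diag_part S \<in> bops" "diag_part S \<in> monomial_alg"
      using diag_ops_closed(4,5)[OF diag_part(1) diag_part(1)] diag_part(1) by auto
    have b: "S \<in> bops" using S by (simp add: monomial_ops_def)
    have ent': "ent S' i j = (if i = j then 0 else ent S i j)" for i j
      by (simp add: S'_def ent_simps diag_part(3))
    have S'b: "S' \<in> bops" using b dp by (simp add: S'_def bops_closed mulC_in_bops)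
    have S': "S' \<in> monomial_ops" using S S'b unfolding monomial_ops_def by (simp add: ent') metis
    have "S = S' + diag_part S"
      by (intro bops_eqI bops_closed b S'b dp) (simp add: ent_simps ent' diag_part(3))
    then have "enc S = enc S' \<oplus>\<^bsub>monomial_cstar\<^esub> enc (diag_part S)" by simp
    moreover have "enc S' \<in> carrier monomial_cstar" "enc (diag_part S) \<in> carrier monomial_cstar"
      using S' dp monomial_subset_alg by auto
    moreover have "\<rho> (enc S') = 0" by (rule state_monomial_offdiag[OF \<rho> proj S']) (simp add: ent')
    moreover have "\<tau> (enc S') = 0" by (rule state_monomial_offdiag[OF \<tau> projT S']) (simp add: ent')
    ultimately show ?thesis using eq[of "enc (diag_part S)"] dp(1) by (simp only: R.rho_add T.rho_add) (simp add: diag_sub_def)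
  qed
  have "monomial_alg \<subseteq> {S \<in> monomial_alg. \<rho> (enc S) = \<tau> (enc (S :: 'i op))}"
  proof (rule monomial_alg_minimal)
    show "monomial_ops \<subseteq> {S \<in> monomial_alg. \<rho> (enc S) = \<tau> (enc (S :: 'i op))}"
      using mono monomial_subset_alg by blast
    have "\<rho> (enc (x + y)) = \<rho> (enc x) + \<rho> (enc y)" "\<tau> (enc (x + y)) = \<tau> (enc x) + \<tau> (enc y)"
      if "x \<in> monomial_alg" "y \<in> monomial_alg" for x y :: "'i op"
      using R.rho_add[of "enc x" "enc y"] T.rho_add[of "enc x" "enc y"] that by auto
    moreover have "\<rho> (enc (c *\<^sub>R x)) = of_real c * \<rho> (enc x)" "\<tau> (enc (c *\<^sub>R x)) = of_real c * \<tau> (enc x)"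
      if "x \<in> monomial_alg" for x :: "'i op" and c
      using R.rho_smult[of "enc x" "of_real c"] T.rho_smult[of "enc x" "of_real c"] that
      by (auto simp: scaleR_eq_mulC)
    ultimately show "subspace {S \<in> monomial_alg. \<rho> (enc S) = \<tau> (enc (S :: 'i op))}"
      using subspace_monomial_alg R.rho_zero T.rho_zero by (auto simp: subspace_def)
    show "closed {S \<in> monomial_alg. \<rho> (enc S) = \<tau> (enc (S :: 'i op))}"
      unfolding closed_sequential_limits
    proof (intro allI impI, elim conjE)
      fix X :: "nat \<Rightarrow> 'i op" and l
      assume X: "\<forall>n. X n \<in> {S \<in> monomial_alg. \<rho> (enc S) = \<tau> (enc S)}" and l: "X \<longlonglongrightarrow> l"
      have lM: "l \<in> monomial_alg" by (rule closed_sequentially[OF closed_monomial_alg _ l]) (use X in auto)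
      have lim: "(\<lambda>n. \<phi> (enc (X n))) \<longlonglongrightarrow> \<phi> (enc l)" if \<phi>: "state monomial_cstar \<phi>" for \<phi>
      proof -
        interpret P: cstar_state monomial_cstar \<phi> using cstar_monomial \<phi> by (rule cstar_stateI)
        have "(\<lambda>n. \<phi> (enc (X n)) - \<phi> (enc l)) \<longlonglongrightarrow> 0"
        proof (rule Lim_null_comparison)
          show "(\<lambda>n. norm (X n - l)) \<longlonglongrightarrow> 0" using l by (simp add: tendsto_norm_zero LIM_zero)
          have "cmod (\<phi> (enc (X n)) - \<phi> (enc l)) \<le> norm (X n - l)" for n
          proof -
            have c: "enc (X n) \<in> carrier monomial_cstar" "enc l \<in> carrier monomial_cstar" using X lM by auto
            have "\<phi> (enc (X n)) - \<phi> (enc l) = \<phi> (enc (X n) \<ominus>\<^bsub>monomial_cstar\<^esub> enc l)" using P.rho_minus[OF c] by simp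
            also have "cmod \<dots> \<le> nrm monomial_cstar (enc (X n) \<ominus>\<^bsub>monomial_cstar\<^esub> enc l)"
              by (rule P.rho_bounded[OF R.minus_closed[OF c]])
            also have "\<dots> = norm (X n - l)" using X lM by (simp add: monomial_minus)
            finally show ?thesis .
          qed
          then show "\<forall>\<^sub>F n in sequentially. norm (\<phi> (enc (X n)) - \<phi> (enc l)) \<le> norm (X n - l)" by simp
        qed
        then show ?thesis by (rule LIM_zero_cancel)
      qed
      have "\<rho> (enc l) = \<tau> (enc l)" using lim[OF \<rho>] lim[OF \<tau>] X LIMSEQ_unique by auto
      then show "l \<in> {S \<in> monomial_alg. \<rho> (enc S) = \<tau> (enc S)}" using lM by simp
    qed
  qed
  then have "\<rho> x = \<tau> x" if "x \<in> carrier monomial_cstar" for x using that by auto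
  then show ?thesis
    using \<rho> \<tau> by (intro extensionalityI[of \<rho> "carrier monomial_cstar" \<tau>]) (auto simp: state_def)
qed

text \<open>Purity enters only to give the indicator projections the values 0 and 1. An extension
  exists through the expectation, and no state annihilates the diagonal because the unit belongs to
  it.\<close>

lemma EP_monomial: "EP_inclusion (monomial_cstar :: 'i coded_op cstar) diag_sub"
proof -
  let ?U = "monomial_cstar :: 'i coded_op cstar"
  let ?E = "\<lambda>X. enc (diag_part (dec X)) :: ('i \<Rightarrow> complex) \<Rightarrow> ('i \<Rightarrow> complex)"
  note incf = inclusion_facts[OF inclusion_monomial]
  interpret abelian_cstar_algebra "?U\<lparr>carrier := diag_sub\<rparr>"
    by (rule abelian_cstar_algebra_subalgebra[OF inclusion_monomial])
  have E: "conditional_expectation ?U diag_sub ?E" 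
    by (rule conjunct1[OF expectation_monomial[unfolded faithful_expectation_def]])
  have "\<exists>!\<rho>. state ?U \<rho> \<and> (\<forall>d\<in>diag_sub. \<rho> d = \<sigma> d)" if pure: "pure_state (?U\<lparr>carrier := diag_sub\<rparr>) \<sigma>" for \<sigma>
  proof -
    have s: "state (?U\<lparr>carrier := diag_sub\<rparr>) \<sigma>" using pure by (simp add: pure_state_def)
    interpret S: cstar_state "?U\<lparr>carrier := diag_sub\<rparr>" \<sigma> by (rule cstar_stateI[OF cstar_algebra_axioms s])
    have proj: "\<sigma> (enc (indicator_op B)) = 0 \<or> \<sigma> (enc (indicator_op B)) = 1" for B
    proof (rule S.pure_state_projection[OF pure])
      have P: "indicator_op B \<in> diag_ops" "indicator_op B \<in> bops"
        using diag_ops_closed(4)[OF indicator_op(1) indicator_op(1)] indicator_op(1) by auto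
      show "enc (indicator_op B) \<in> carrier (?U\<lparr>carrier := diag_sub\<rparr>)" using P by (simp add: diag_sub_def)
      have "adj (indicator_op B) = indicator_op B" using P
        by (intro bops_eqI adj_in_bops) (auto simp: ent_adj indicator_op(2))
      then show "(enc (indicator_op B))\<^sup>\<star>\<^bsub>?U\<lparr>carrier := diag_sub\<rparr>\<^esub> = enc (indicator_op B)" by simp
      have "indicator_op B o\<^sub>L indicator_op B = indicator_op B" using P
        by (intro bops_eqI bops_closed) (auto simp: ent_compose_diag_right[OF P(2,1)] indicator_op(2))
      then show "enc (indicator_op B) \<otimes>\<^bsub>?U\<lparr>carrier := diag_sub\<rparr>\<^esub> enc (indicator_op B) = enc (indicator_op B)" by simp
    qed (use mult_commute in auto)
    define \<rho> where "\<rho> = restrict (\<lambda>x. \<sigma> (?E x)) (carrier ?U)"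
    have Ed: "?E x = x" if "x \<in> diag_sub" for x using E that by (auto simp: conditional_expectation_def)
    have \<rho>d: "\<rho> d = \<sigma> d" if "d \<in> diag_sub" for d using that incf(2) Ed[OF that] by (auto simp: \<rho>_def simp del: monomial_cstar_simps)
    have "state ?U \<rho>"
      unfolding \<rho>_def by (rule state_expectation[OF inclusion_monomial E s])
    moreover have "\<tau> = \<rho>" if "state ?U \<tau> \<and> (\<forall>d\<in>diag_sub. \<tau> d = \<sigma> d)" for \<tau>
    proof (rule state_monomial_eq)
      show "\<tau> (enc (indicator_op B)) = 0 \<or> \<tau> (enc (indicator_op B)) = 1" for B
        using that proj[of B] indicator_op(1)[of B] by (auto simp: diag_sub_def)
    qed (use that calculation \<rho>d in auto)
    ultimately show ?thesis using \<rho>d by (intro ex1I[of _ \<rho>]) auto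
  qed
  moreover have "\<exists>d\<in>diag_sub. \<rho> d \<noteq> 0" if "pure_state ?U \<rho>" for \<rho>
    using that incf(3) by (intro bexI[of _ "\<one>\<^bsub>?U\<^esub>"]) (auto simp: pure_state_def state_def simp del: monomial_cstar_simps)
  ultimately show ?thesis unfolding EP_inclusion_def using inclusion_monomial by blast
qed

theorem cstar_diagonal_monomial: "cstar_diagonal monomial_cstar diag_sub"
  unfolding cstar_diagonal_def Cartan_inclusion_def
  using regular_monomial MASA_monomial expectation_monomial EP_monomial by blast

section \<open>Eigenbases of compatible states\<close>

locale compatible_state = cstar_state C \<rho> for C :: "'a cstar" (structure) and \<rho> :: "'a \<Rightarrow> complex" +
  fixes D :: "'a set"
  assumes inc: "cstar_inclusion C D" and compatible: "\<rho> \<in> compatible_states C D"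
begin

abbreviation N :: "'a set" where "N \<equiv> normalizers C D"

lemmas incf = inclusion_facts[OF inc]

lemma N_closed: "v \<in> N \<Longrightarrow> v \<in> carrier C"
  by (simp add: normalizers_def)

lemma D_closed: "d \<in> D \<Longrightarrow> d \<in> carrier C"
  using incf(2) by blast

lemma N_conj: "\<lbrakk>v \<in> N; d \<in> D\<rbrakk> \<Longrightarrow> v\<^sup>\<star> \<otimes> d \<otimes> v \<in> D" "\<lbrakk>v \<in> N; d \<in> D\<rbrakk> \<Longrightarrow> v \<otimes> d \<otimes> v\<^sup>\<star> \<in> D"
  by (auto simp: normalizers_def)

lemma N_square: assumes "v \<in> N" shows "v\<^sup>\<star> \<otimes> v \<in> D" "v \<otimes> v\<^sup>\<star> \<in> D"
  using N_conj[OF assms incf(3)] N_closed[OF assms] by simp_all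

lemma N_star: "v \<in> N \<Longrightarrow> v\<^sup>\<star> \<in> N"
  by (auto simp: normalizers_def)

lemma N_mult: assumes v: "v \<in> N" and w: "w \<in> N" shows "v \<otimes> w \<in> N"
proof -
  note c = N_closed[OF v] N_closed[OF w]
  have "(v \<otimes> w)\<^sup>\<star> \<otimes> d \<otimes> (v \<otimes> w) \<in> D \<and> (v \<otimes> w) \<otimes> d \<otimes> (v \<otimes> w)\<^sup>\<star> \<in> D" if d: "d \<in> D" for d
  proof
    have "(v \<otimes> w)\<^sup>\<star> \<otimes> d \<otimes> (v \<otimes> w) = w\<^sup>\<star> \<otimes> (v\<^sup>\<star> \<otimes> d \<otimes> v) \<otimes> w"
      using c D_closed[OF d] by (simp add: star_mult m_assoc)
    then show "(v \<otimes> w)\<^sup>\<star> \<otimes> d \<otimes> (v \<otimes> w) \<in> D" using N_conj v w d by simp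
    have "(v \<otimes> w) \<otimes> d \<otimes> (v \<otimes> w)\<^sup>\<star> = v \<otimes> (w \<otimes> d \<otimes> w\<^sup>\<star>) \<otimes> v\<^sup>\<star>"
      using c D_closed[OF d] by (simp add: star_mult m_assoc)
    then show "(v \<otimes> w) \<otimes> d \<otimes> (v \<otimes> w)\<^sup>\<star> \<in> D" using N_conj v w d by simp
  qed
  then show ?thesis using c by (simp add: normalizers_def)
qed

lemma compat: assumes "v \<in> N" "\<rho> v \<noteq> 0" shows "\<rho> (v\<^sup>\<star> \<otimes> v) = of_real ((cmod (\<rho> v))\<^sup>2)"
proof -
  have "of_real ((cmod (\<rho> v))\<^sup>2) \<in> {0, \<rho> (v\<^sup>\<star> \<otimes> v)}" using compatible assms(1) by (auto simp: compatible_states_def)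
  then show ?thesis using assms(2) by auto
qed

text \<open>The dichotomy for \<open>d\<close> may fail to be informative when \<open>\<rho> d = 0\<close>; a scalar shift repairs this.\<close>

lemma rho_D: assumes d: "d \<in> D" shows "\<rho> (d\<^sup>\<star> \<otimes> d) = of_real ((cmod (\<rho> d))\<^sup>2)"
proof -
  define t where "t = 1 - \<rho> d"
  define e where "e = d \<oplus> t \<odot> \<one>"
  have dc: "d \<in> carrier C" using D_closed[OF d] .
  have e: "e \<in> N" using D_subset_normalizers[OF inc] d incf(3,4,7) by (auto simp: e_def)
  have "\<rho> e = 1" using dc by (simp add: e_def rho_add rho_smult t_def)
  then have "\<rho> (e\<^sup>\<star> \<otimes> e) = 1" using compat[OF e] by simp
  then have "\<rho> (d\<^sup>\<star> \<otimes> d) + t * cnj (\<rho> d) + cnj t * \<rho> d + t * cnj t = 1"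
    using rho_expand[OF dc one_closed, of t] dc by (simp add: e_def rho_star of_real_cmod_power2)
  then show ?thesis by (simp add: t_def of_real_cmod_power2 algebra_simps)
qed

lemma rho_D_right: "\<lbrakk>x \<in> carrier C; d \<in> D\<rbrakk> \<Longrightarrow> \<rho> (x \<otimes> d) = \<rho> x * \<rho> d"
  using rho_D D_closed by (intro rho_mult_right) auto

text \<open>In the GNS space, normalizers move the cyclic vector to vectors that are pairwise orthogonal or parallel.\<close>

lemma parallel:
  assumes v: "v \<in> N" and w: "w \<in> N" and nz: "\<rho> (w\<^sup>\<star> \<otimes> v) \<noteq> 0" and b: "b \<in> carrier C"
  shows "\<rho> (b \<otimes> v) * \<rho> (w\<^sup>\<star> \<otimes> w) = \<rho> (w\<^sup>\<star> \<otimes> v) * \<rho> (b \<otimes> w)"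
proof -
  define k where "k = w\<^sup>\<star> \<otimes> v"
  have vc: "v \<in> carrier C" and wc: "w \<in> carrier C" using N_closed v w by auto
  have k: "k \<in> N" "k \<in> carrier C" using N_mult[OF N_star[OF w] v] N_closed by (auto simp: k_def)
  have kk: "\<rho> (k\<^sup>\<star> \<otimes> k) = of_real ((cmod (\<rho> k))\<^sup>2)" using compat[OF k(1)] nz by (simp add: k_def)
  \<comment> \<open>The value at \<open>c w w\<^sup>\<star> v v\<^sup>\<star> v\<close> is computed
    twice: with \<open>k\<close> and \<open>v\<^sup>\<star> \<otimes> v\<close> split off on the
    right, and after interchanging \<open>w \<otimes> w\<^sup>\<star>\<close> and
    \<open>v \<otimes> v\<^sup>\<star>\<close> in the abelian \<open>D\<close>.\<close>
  have *: "\<rho> (c \<otimes> v) * cnj (\<rho> k) = \<rho> (c \<otimes> w) * \<rho> (v\<^sup>\<star> \<otimes> v)" if c: "c \<in> carrier C" for c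
  proof -
    have "\<rho> (c \<otimes> w) * \<rho> k * \<rho> (v\<^sup>\<star> \<otimes> v) = \<rho> ((c \<otimes> w) \<otimes> k \<otimes> (v\<^sup>\<star> \<otimes> v))"
      using rho_mult_right[of "c \<otimes> w" k] kk rho_D_right[OF _ N_square(1)[OF v], of "(c \<otimes> w) \<otimes> k"] c wc k(2) by simp
    also have "(c \<otimes> w) \<otimes> k \<otimes> (v\<^sup>\<star> \<otimes> v) = c \<otimes> ((w \<otimes> w\<^sup>\<star>) \<otimes> (v \<otimes> v\<^sup>\<star>)) \<otimes> v"
      using c vc wc by (simp add: k_def m_assoc)
    also have "(w \<otimes> w\<^sup>\<star>) \<otimes> (v \<otimes> v\<^sup>\<star>) = (v \<otimes> v\<^sup>\<star>) \<otimes> (w \<otimes> w\<^sup>\<star>)"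
      by (rule incf(8)[OF N_square(2)[OF w] N_square(2)[OF v]])
    also have "c \<otimes> ((v \<otimes> v\<^sup>\<star>) \<otimes> (w \<otimes> w\<^sup>\<star>)) \<otimes> v = (c \<otimes> v) \<otimes> (v\<^sup>\<star> \<otimes> (w \<otimes> w\<^sup>\<star>) \<otimes> v)"
      using c vc wc by (simp add: m_assoc)
    also have "\<rho> \<dots> = \<rho> (c \<otimes> v) * \<rho> (v\<^sup>\<star> \<otimes> (w \<otimes> w\<^sup>\<star>) \<otimes> v)"
      using c vc by (intro rho_D_right N_conj(1)[OF v] N_square(2)[OF w]) simp
    also have "v\<^sup>\<star> \<otimes> (w \<otimes> w\<^sup>\<star>) \<otimes> v = k\<^sup>\<star> \<otimes> k" using vc wc by (simp add: k_def star_mult m_assoc)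
    finally have "(\<rho> (c \<otimes> v) * cnj (\<rho> k)) * \<rho> k = (\<rho> (c \<otimes> w) * \<rho> (v\<^sup>\<star> \<otimes> v)) * \<rho> k"
      by (auto simp add: kk of_real_cmod_power2 mult_ac)
    then show ?thesis using nz unfolding k_def[symmetric] by (simp only: mult_cancel_right) simp
  qed
  \<comment> \<open>For \<open>c = w\<^sup>\<star>\<close> this is the equality case of
    Cauchy--Schwarz for \<open>w\<close> and \<open>v\<close>.\<close>
  have kk': "\<rho> k * cnj (\<rho> k) = \<rho> (w\<^sup>\<star> \<otimes> w) * \<rho> (v\<^sup>\<star> \<otimes> v)" using *[of "w\<^sup>\<star>"] wc by (simp add: k_def)
  have "(\<rho> (b \<otimes> v) * \<rho> (w\<^sup>\<star> \<otimes> w)) * cnj (\<rho> k) = (\<rho> (b \<otimes> v) * cnj (\<rho> k)) * \<rho> (w\<^sup>\<star> \<otimes> w)"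
    by (simp only: mult_ac)
  also have "\<dots> = \<rho> (b \<otimes> w) * (\<rho> (w\<^sup>\<star> \<otimes> w) * \<rho> (v\<^sup>\<star> \<otimes> v))" unfolding *[OF b] by (simp only: mult_ac)
  also have "\<dots> = (\<rho> k * \<rho> (b \<otimes> w)) * cnj (\<rho> k)" unfolding kk'[symmetric] by (simp only: mult_ac)
  finally show ?thesis using nz unfolding k_def[symmetric] by (simp only: mult_cancel_right) simp
qed

lemma rho_cnj_zero: "\<lbrakk>v \<in> carrier C; w \<in> carrier C\<rbrakk> \<Longrightarrow> \<rho> (v\<^sup>\<star> \<otimes> w) = 0 \<longleftrightarrow> \<rho> (w\<^sup>\<star> \<otimes> v) = 0"
  using rho_cnj[of v w] by auto

definition N0 :: "'a set" where "N0 = {v \<in> N. \<rho> (v\<^sup>\<star> \<otimes> v) \<noteq> 0}"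

lemma parallel_trans:
  assumes "v \<in> N0" "w \<in> N0" "u \<in> N0" "\<rho> (w\<^sup>\<star> \<otimes> v) \<noteq> 0" "\<rho> (u\<^sup>\<star> \<otimes> w) \<noteq> 0"
  shows "\<rho> (u\<^sup>\<star> \<otimes> v) \<noteq> 0"
  using parallel[of v w "u\<^sup>\<star>"] assms N_closed by (auto simp: N0_def)

text \<open>By \<open>parallel_trans\<close>, not being orthogonal is an equivalence relation on
  \<open>N0\<close>. One normalizer is chosen from each class; equal classes get equal choices
  because \<open>SOME\<close> depends only on the set.\<close>

lemma ex_representatives:
  "\<exists>R\<subseteq>N0. (\<forall>v\<in>N0. \<exists>r\<in>R. \<rho> (r\<^sup>\<star> \<otimes> v) \<noteq> 0) \<and> (\<forall>r\<in>R. \<forall>r'\<in>R. r \<noteq> r' \<longrightarrow> \<rho> (r\<^sup>\<star> \<otimes> r') = 0)"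
proof -
  have c: "v \<in> carrier C" if "v \<in> N0" for v using that N_closed by (simp add: N0_def)
  define cls where "cls v = {w \<in> N0. \<rho> (w\<^sup>\<star> \<otimes> v) \<noteq> 0}" for v
  define rep where "rep v = (SOME w. w \<in> cls v)" for v
  have rep: "rep v \<in> cls v" if "v \<in> N0" for v
    unfolding rep_def by (rule someI[of _ v]) (use that in \<open>simp add: cls_def N0_def\<close>)
  have eq: "rep v = rep v'" if v: "v \<in> N0" "v' \<in> N0" and nz: "\<rho> ((rep v)\<^sup>\<star> \<otimes> rep v') \<noteq> 0" for v v'
  proof -
    note r = rep[OF v(1)] rep[OF v(2)]
    have 1: "\<rho> ((rep v)\<^sup>\<star> \<otimes> v') \<noteq> 0"
      using parallel_trans[of v' "rep v'" "rep v"] r v nz by (auto simp: cls_def)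
    have 2: "\<rho> (v\<^sup>\<star> \<otimes> v') \<noteq> 0"
      using parallel_trans[of v' "rep v" v] 1 r v rho_cnj_zero[of v "rep v"] c by (auto simp: cls_def)
    have "cls v = cls v'"
    proof -
      have "\<rho> (w\<^sup>\<star> \<otimes> v) \<noteq> 0 \<longleftrightarrow> \<rho> (w\<^sup>\<star> \<otimes> v') \<noteq> 0" if "w \<in> N0" for w
        using parallel_trans[of v' v w] parallel_trans[of v v' w] that v 2 rho_cnj_zero[of v v'] c by blast
      then show ?thesis by (auto simp: cls_def)
    qed
    then show ?thesis by (simp add: rep_def)
  qed
  show ?thesis
  proof (intro exI[of _ "rep ` N0"] conjI ballI impI)
    show "rep ` N0 \<subseteq> N0" using rep by (auto simp: cls_def)
    show "\<exists>r\<in>rep ` N0. \<rho> (r\<^sup>\<star> \<otimes> v) \<noteq> 0" if "v \<in> N0" for v using rep[OF that] that by (auto simp: cls_def)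
    show "\<rho> (r\<^sup>\<star> \<otimes> r') = 0" if "r \<in> rep ` N0" "r' \<in> rep ` N0" "r \<noteq> r'" for r r' using that eq by auto
  qed
qed

lemma vanish_on_N:
  assumes reg: "ctopology C closure_of (cspan C N) = carrier C" and b: "b \<in> carrier C"
    and 0: "\<And>v. v \<in> N \<Longrightarrow> \<rho> (b \<otimes> v) = 0" and y: "y \<in> carrier C"
  shows "\<rho> (b \<otimes> y) = 0"
proof (rule ccontr)
  assume nz: "\<rho> (b \<otimes> y) \<noteq> 0"
  have NC: "N \<subseteq> carrier C" using N_closed by blast
  have span: "\<rho> (b \<otimes> z) = 0" if "z \<in> cspan C N" for z
    using that NC
  proof (induction rule: cspan_induct)
    case zero then show ?case using b by simp
  next
    case (add a v z)
    then show ?case using b N_closed[OF add(1)] 0 by (simp add: r_distr smult_mult_right rho_add rho_smult)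
  qed
  define e where "e = cmod (\<rho> (b \<otimes> y)) / (nrm C b + 1)"
  have bp: "nrm C b + 1 > 0" using nrm_nonneg[OF b] by simp
  have e: "e > 0" using nz bp by (simp add: e_def)
  obtain z where z: "z \<in> cspan C N" "nrm C (y \<ominus> z) < e"
    using y e in_closure_of_iff[OF cspan_subset[OF NC], of y] unfolding reg by blast
  have zc: "z \<in> carrier C" using z cspan_subset[OF NC] by blast
  have "\<rho> (b \<otimes> y) = \<rho> (b \<otimes> (y \<ominus> z))"
    using b y zc span[OF z(1)] by (simp add: minus_eq r_distr r_minus rho_add rho_uminus)
  then have "cmod (\<rho> (b \<otimes> y)) \<le> nrm C (b \<otimes> (y \<ominus> z))" using b y zc rho_bounded[of "b \<otimes> (y \<ominus> z)"] by simp
  also have "\<dots> \<le> nrm C b * nrm C (y \<ominus> z)" using b y zc by (intro nrm_mult) auto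
  also have "\<dots> \<le> (nrm C b + 1) * nrm C (y \<ominus> z)" using nrm_nonneg[of "y \<ominus> z"] y zc by (intro mult_right_mono) auto
  also have "\<dots> < (nrm C b + 1) * e" using z(2) bp by (intro mult_strict_left_mono) auto
  also have "\<dots> = cmod (\<rho> (b \<otimes> y))" using bp by (simp add: e_def)
  finally show False by simp
qed

text \<open>By regularity the vectors given by normalizers are total, so a nonzero vector pairs
  nontrivially with one of them. This is applied once to replace \<open>y\<close> by
  \<open>v\<close> and once to find \<open>w\<close>; the nonzero pairing excludes null
  vectors.\<close>

lemma ex_nonzero_coefficient:
  assumes reg: "ctopology C closure_of (cspan C N) = carrier C"
    and x: "x \<in> carrier C" and y: "y \<in> carrier C" and nz: "\<rho> ((x \<otimes> y)\<^sup>\<star> \<otimes> (x \<otimes> y)) \<noteq> 0"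
  shows "\<exists>v\<in>N0. \<exists>w\<in>N0. \<rho> (w\<^sup>\<star> \<otimes> x \<otimes> v) \<noteq> 0"
proof -
  obtain v where v: "v \<in> N" "\<rho> ((x \<otimes> y)\<^sup>\<star> \<otimes> x \<otimes> v) \<noteq> 0"
    using vanish_on_N[OF reg, of "(x \<otimes> y)\<^sup>\<star> \<otimes> x" y] nz x y by (auto simp: m_assoc)
  have vc: "v \<in> carrier C" using N_closed v by simp
  have "\<rho> ((x \<otimes> v)\<^sup>\<star> \<otimes> (x \<otimes> v)) \<noteq> 0"
    using rho_mult_eq_0[of "(x \<otimes> y)\<^sup>\<star>" "x \<otimes> v"] v x y vc by (auto simp: m_assoc)
  then obtain w where w: "w \<in> N" "\<rho> ((x \<otimes> v)\<^sup>\<star> \<otimes> w) \<noteq> 0"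
    using vanish_on_N[OF reg, of "(x \<otimes> v)\<^sup>\<star>" "x \<otimes> v"] x vc by auto
  have wc: "w \<in> carrier C" using N_closed w by simp
  have nz': "\<rho> (w\<^sup>\<star> \<otimes> x \<otimes> v) \<noteq> 0" using w(2) rho_cnj_zero[of w "x \<otimes> v"] x vc wc by (simp add: m_assoc)
  have "\<rho> (v\<^sup>\<star> \<otimes> v) \<noteq> 0" using rho_mult_eq_0[of "w\<^sup>\<star> \<otimes> x" v] nz' x vc wc by auto
  moreover have "\<rho> (w\<^sup>\<star> \<otimes> w) \<noteq> 0" using rho_mult_eq_0[of "(x \<otimes> v)\<^sup>\<star>" w] w(2) x vc wc by auto
  ultimately show ?thesis using v w nz' by (auto simp: N0_def)
qed

end

locale eigenbasis = compatible_state C \<rho> D for C :: "'a cstar" (structure) and \<rho> D +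
  fixes R :: "'a set"
  assumes R_N0: "R \<subseteq> N0" and R_cover: "v \<in> N0 \<Longrightarrow> \<exists>r\<in>R. \<rho> (r\<^sup>\<star> \<otimes> v) \<noteq> 0"
    and R_orth: "\<lbrakk>r \<in> R; r' \<in> R; r \<noteq> r'\<rbrakk> \<Longrightarrow> \<rho> (r\<^sup>\<star> \<otimes> r') = 0"
begin

lemma R_closed: "r \<in> R \<Longrightarrow> r \<in> carrier C" "r \<in> R \<Longrightarrow> r \<in> N"
  using R_N0 N_closed by (auto simp: N0_def)

lemma snorm_pos: "r \<in> R \<Longrightarrow> snorm r > 0" and snorm_R: "r \<in> R \<Longrightarrow> \<rho> (r\<^sup>\<star> \<otimes> r) = of_real ((snorm r)\<^sup>2)"
proof -
  assume r: "r \<in> R"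
  have rc: "r \<in> carrier C" using R_closed r by auto
  have "Re (\<rho> (r\<^sup>\<star> \<otimes> r)) \<noteq> 0" using R_N0 r rho_eq_Re[OF rc] by (auto simp: N0_def)
  then have p: "Re (\<rho> (r\<^sup>\<star> \<otimes> r)) > 0" using Re_rho_pos[OF rc] by simp
  then show "snorm r > 0" by (simp add: snorm_def gns_seminorm_def)
  show "\<rho> (r\<^sup>\<star> \<otimes> r) = of_real ((snorm r)\<^sup>2)" using rho_eq_Re[OF rc] p by (simp add: snorm_def gns_seminorm_def)
qed

lemma Bessel:
  assumes "finite G" "G \<subseteq> R" "a \<in> carrier C"
  shows "(\<Sum>w\<in>G. (cmod (\<rho> (w\<^sup>\<star> \<otimes> a)))\<^sup>2 / (snorm w)\<^sup>2) \<le> Re (\<rho> (a\<^sup>\<star> \<otimes> a))"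
  using assms
proof (induction G arbitrary: a)
  case empty
  then show ?case using Re_rho_pos by simp
next
  case (insert w G)
  have w: "w \<in> R" "w \<in> carrier C" "snorm w > 0" using insert R_closed snorm_pos by auto
  \<comment> \<open>Adding \<open>t \<odot> w\<close> removes the component of \<open>a\<close>
    along \<open>w\<close>: pairings with the rest of \<open>G\<close> stay the same, and the
    squared length drops by exactly the term of \<open>w\<close>.\<close>
  define t where "t = - \<rho> (w\<^sup>\<star> \<otimes> a) / of_real ((snorm w)\<^sup>2)"
  define a' where "a' = a \<oplus> t \<odot> w"
  have a': "a' \<in> carrier C" using insert w by (simp add: a'_def)
  have "\<rho> (u\<^sup>\<star> \<otimes> a') = \<rho> (u\<^sup>\<star> \<otimes> a)" if "u \<in> G" for u
  proof -
    have "u \<in> R" "u \<noteq> w" using that insert by auto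
    then show ?thesis using R_orth[of u w] w R_closed insert(5)
      by (simp add: a'_def r_distr smult_mult_right rho_add rho_smult)
  qed
  then have IH: "(\<Sum>u\<in>G. (cmod (\<rho> (u\<^sup>\<star> \<otimes> a)))\<^sup>2 / (snorm u)\<^sup>2) \<le> Re (\<rho> (a'\<^sup>\<star> \<otimes> a'))"
    using insert.IH[OF _ a'] insert by simp
  define z where "z = \<rho> (w\<^sup>\<star> \<otimes> a)"
  have "\<rho> (a'\<^sup>\<star> \<otimes> a') = \<rho> (a\<^sup>\<star> \<otimes> a) + t * cnj z + cnj t * z + t * cnj t * of_real ((snorm w)\<^sup>2)"
    using insert(5) w rho_expand[of a w t] rho_cnj[of w a] snorm_R[OF w(1)]
    by (simp add: a'_def z_def of_real_cmod_power2)
  also have "\<dots> = \<rho> (a\<^sup>\<star> \<otimes> a) - z * cnj z / of_real ((snorm w)\<^sup>2)"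
    using w(3) by (simp add: t_def z_def[symmetric] field_simps power2_eq_square)
  also have "z * cnj z / of_real ((snorm w)\<^sup>2) = of_real ((cmod z)\<^sup>2 / (snorm w)\<^sup>2)"
    by (simp add: of_real_cmod_power2)
  finally have "Re (\<rho> (a'\<^sup>\<star> \<otimes> a')) = Re (\<rho> (a\<^sup>\<star> \<otimes> a)) - (cmod z)\<^sup>2 / (snorm w)\<^sup>2" by simp
  then show ?case using IH insert by (simp add: z_def)
qed

text \<open>The element stands for the vector with coordinates \<open>f\<close> in the normalized
  basis \<open>F\<close>; its pairings are all that is needed of it.\<close>

lemma ex_combination:
  assumes "finite F" "F \<subseteq> R"
  shows "\<exists>a\<in>carrier C. \<forall>b\<in>carrier C. \<rho> (b \<otimes> a) = (\<Sum>v\<in>F. f v * \<rho> (b \<otimes> v) / of_real (snorm v))"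
  using assms
proof (induction F)
  case empty
  then show ?case by (intro bexI[of _ \<zero>]) auto
next
  case (insert v F)
  then obtain a where a: "a \<in> carrier C" "\<forall>b\<in>carrier C. \<rho> (b \<otimes> a) = (\<Sum>v\<in>F. f v * \<rho> (b \<otimes> v) / of_real (snorm v))"
    by auto
  have v: "v \<in> carrier C" using insert R_closed by auto
  show ?case
    using a v insert
    by (intro bexI[of _ "(f v / of_real (snorm v)) \<odot> v \<oplus> a"]) (auto simp: r_distr smult_mult_right rho_add rho_smult)
qed

text \<open>The matrix entry \<open>\<langle>c v \<xi>\<^sub>\<rho>, w \<xi>\<^sub>\<rho>\<rangle>\<close>, normalized.\<close>

definition coeff :: "'a \<Rightarrow> 'a \<Rightarrow> 'a \<Rightarrow> complex" where
  "coeff c w v = \<rho> (w\<^sup>\<star> \<otimes> c \<otimes> v) / of_real (snorm w * snorm v)"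

text \<open>Orthogonality gives the combination \<open>a\<close> with coordinates \<open>f\<close>
  the squared length of \<open>f\<close>. The left side is a Bessel sum for
  \<open>c \<otimes> a\<close>, whose length is controlled by the norm of \<open>c\<close>.\<close>

lemma coeff_bound:
  assumes F: "finite F" "F \<subseteq> R" and G: "finite G" "G \<subseteq> R" and c: "c \<in> carrier C"
  shows "(\<Sum>w\<in>G. (cmod (\<Sum>v\<in>F. coeff c w v * f v))\<^sup>2) \<le> (nrm C c)\<^sup>2 * (\<Sum>v\<in>F. (cmod (f v))\<^sup>2)"
proof -
  obtain a where a: "a \<in> carrier C" "\<And>b. b \<in> carrier C \<Longrightarrow> \<rho> (b \<otimes> a) = (\<Sum>v\<in>F. f v * \<rho> (b \<otimes> v) / of_real (snorm v))"
    using ex_combination[OF F, of f] by blast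
  have va: "\<rho> (v\<^sup>\<star> \<otimes> a) = f v * of_real (snorm v)" if v: "v \<in> F" for v
  proof -
    have vR: "v \<in> R" using v F by auto
    have "\<rho> (v\<^sup>\<star> \<otimes> a) = (\<Sum>u\<in>F. f u * \<rho> (v\<^sup>\<star> \<otimes> u) / of_real (snorm u))" using a(2)[of "v\<^sup>\<star>"] R_closed vR by simp
    also have "\<dots> = (\<Sum>u\<in>F. if u = v then f v * \<rho> (v\<^sup>\<star> \<otimes> v) / of_real (snorm v) else 0)"
      using R_orth[OF vR] F by (intro sum.cong) auto
    also have "\<dots> = f v * of_real (snorm v)" using F v snorm_R[OF vR] snorm_pos[OF vR] by (simp add: power2_eq_square)
    finally show ?thesis .
  qed
  have "\<rho> (a\<^sup>\<star> \<otimes> a) = (\<Sum>v\<in>F. f v * \<rho> (a\<^sup>\<star> \<otimes> v) / of_real (snorm v))" using a by simp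
  also have "\<dots> = (\<Sum>v\<in>F. of_real ((cmod (f v))\<^sup>2))"
  proof (rule sum.cong)
    fix v assume v: "v \<in> F"
    have vR: "v \<in> R" using v F by auto
    have "\<rho> (a\<^sup>\<star> \<otimes> v) = cnj (f v) * of_real (snorm v)" using rho_cnj[of v a] va[OF v] R_closed[OF vR] a(1) by simp
    then show "f v * \<rho> (a\<^sup>\<star> \<otimes> v) / of_real (snorm v) = of_real ((cmod (f v))\<^sup>2)"
      using snorm_pos[OF vR] by (simp add: of_real_cmod_power2)
  qed simp
  finally have aa: "Re (\<rho> (a\<^sup>\<star> \<otimes> a)) = (\<Sum>v\<in>F. (cmod (f v))\<^sup>2)" by simp
  have "(cmod (\<Sum>v\<in>F. coeff c w v * f v))\<^sup>2 = (cmod (\<rho> (w\<^sup>\<star> \<otimes> (c \<otimes> a))))\<^sup>2 / (snorm w)\<^sup>2" if w: "w \<in> G" for w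
  proof -
    have wR: "w \<in> R" "w \<in> carrier C" "snorm w > 0" using w G R_closed snorm_pos by auto
    have "(\<Sum>v\<in>F. coeff c w v * f v) = (\<Sum>v\<in>F. f v * \<rho> (w\<^sup>\<star> \<otimes> c \<otimes> v) / of_real (snorm v)) / of_real (snorm w)"
      unfolding sum_divide_distrib by (intro sum.cong) (auto simp: coeff_def mult.commute)
    also have "\<dots> = \<rho> (w\<^sup>\<star> \<otimes> (c \<otimes> a)) / of_real (snorm w)" using a wR c by (simp add: m_assoc flip: a(2))
    finally show ?thesis using wR by (simp add: norm_divide power_divide)
  qed
  then have "(\<Sum>w\<in>G. (cmod (\<Sum>v\<in>F. coeff c w v * f v))\<^sup>2) = (\<Sum>w\<in>G. (cmod (\<rho> (w\<^sup>\<star> \<otimes> (c \<otimes> a))))\<^sup>2 / (snorm w)\<^sup>2)" by simp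
  also have "\<dots> \<le> Re (\<rho> ((c \<otimes> a)\<^sup>\<star> \<otimes> (c \<otimes> a)))" using c a by (intro Bessel G) simp
  also have "\<dots> \<le> (nrm C c)\<^sup>2 * Re (\<rho> (a\<^sup>\<star> \<otimes> a))" by (rule rho_conjugate_le[OF c a(1)])
  finally show ?thesis by (simp only: aa)
qed

lemma coeff_star: "\<lbrakk>c \<in> carrier C; v \<in> R; w \<in> R\<rbrakk> \<Longrightarrow> cnj (coeff c v w) = coeff (c\<^sup>\<star>) w v"
  using rho_star[of "v\<^sup>\<star> \<otimes> c \<otimes> w"] R_closed by (simp add: coeff_def star_mult m_assoc mult.commute)

lemma coeff_linear:
  assumes "c \<in> carrier C" "d \<in> carrier C" "w \<in> R" "v \<in> R"
  shows "coeff (c \<oplus> d) w v = coeff c w v + coeff d w v" "coeff (a \<odot> c) w v = a * coeff c w v"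
  using assms R_closed
  by (simp_all add: coeff_def l_distr r_distr smult_mult_left smult_mult_right rho_add rho_smult add_divide_distrib)

text \<open>A normalizer maps each basis line to a basis line or to 0.\<close>

lemma coeff_normalizer:
  assumes u: "u \<in> N" and v: "v \<in> R"
  shows "\<exists>w0. (\<forall>w\<in>R. w \<noteq> w0 \<longrightarrow> coeff u w v = 0) \<and>
    (\<forall>c\<in>carrier C. \<forall>w\<in>R. coeff (c \<otimes> u) w v = (if w0 \<in> R then coeff c w w0 * coeff u w0 v else 0))"
proof -
  have uc: "u \<in> carrier C" and vc: "v \<in> carrier C" using u v N_closed R_closed by auto
  have uv: "u \<otimes> v \<in> N" using N_mult u v R_closed by auto
  show ?thesis
  \<comment> \<open>If \<open>u \<otimes> v\<close> is a null vector, all coefficients in question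
    vanish and any basis element can be \<open>w0\<close>; otherwise \<open>w0\<close> is a
    representative not orthogonal to it.\<close>
  proof (cases "\<rho> ((u \<otimes> v)\<^sup>\<star> \<otimes> (u \<otimes> v)) = 0")
    case True
    have z: "coeff (c \<otimes> u) w v = 0" if "c \<in> carrier C" "w \<in> R" for c w
      using rho_mult_eq_0[OF _ _ True, of "w\<^sup>\<star> \<otimes> c"] that uc vc R_closed by (simp add: coeff_def m_assoc)
    have z1: "coeff u w v = 0" if "w \<in> R" for w using z[OF one_closed that] uc by simp
    show ?thesis
    proof (cases "R = {}")
      case False
      then obtain w0 where "w0 \<in> R" by blast
      then show ?thesis using z z1 by (intro exI[of _ w0]) simp
    qed (use v in simp)
  next
    case False
    then have "u \<otimes> v \<in> N0" using uv by (simp add: N0_def)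
    then obtain w0 where w0: "w0 \<in> R" "\<rho> (w0\<^sup>\<star> \<otimes> (u \<otimes> v)) \<noteq> 0" using R_cover by blast
    have w0c: "w0 \<in> carrier C" "w0 \<in> N" "snorm w0 > 0" using R_closed snorm_pos w0 by auto
    have par: "\<rho> (b \<otimes> (u \<otimes> v)) * of_real ((snorm w0)\<^sup>2) = \<rho> (w0\<^sup>\<star> \<otimes> (u \<otimes> v)) * \<rho> (b \<otimes> w0)" if "b \<in> carrier C" for b
      using parallel[OF uv w0c(2) w0(2) that] snorm_R[OF w0(1)] by simp
    have "coeff u w v = 0" if w: "w \<in> R" "w \<noteq> w0" for w
      using par[of "w\<^sup>\<star>"] R_orth[OF w(1) w0(1) w(2)] w0c R_closed[OF w(1)] uc vc by (simp add: coeff_def m_assoc)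
    moreover have "coeff (c \<otimes> u) w v = coeff c w w0 * coeff u w0 v" if c: "c \<in> carrier C" and w: "w \<in> R" for c w
    proof -
      have wc: "w \<in> carrier C" "snorm w > 0" "snorm v > 0" using R_closed snorm_pos w v by auto
      have "\<rho> (w\<^sup>\<star> \<otimes> c \<otimes> (u \<otimes> v)) * of_real ((snorm w0)\<^sup>2) = \<rho> (w0\<^sup>\<star> \<otimes> (u \<otimes> v)) * \<rho> (w\<^sup>\<star> \<otimes> c \<otimes> w0)"
        using par[of "w\<^sup>\<star> \<otimes> c"] c wc by simp
      then show ?thesis
        using wc w0c c uc vc by (simp add: coeff_def m_assoc field_simps power2_eq_square)
    qed
    ultimately show ?thesis using w0(1) by (intro exI[of _ w0]) auto
  qed
qed

end

section \<open>The embedding\<close>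

text \<open>This sets up the direct sum over \<open>X\<close> of the GNS representations of the
  states \<open>\<rho> x\<close>, each in its own eigenbasis \<open>R x\<close>. Faithfulness is not
  part of the locale; it comes from the choice of \<open>\<rho>\<close> later.\<close>

locale eigenbasis_family =
  fixes C :: "'a cstar" (structure) and D :: "'a set" and X :: "'a set" and \<rho> :: "'a \<Rightarrow> 'a \<Rightarrow> complex" and R :: "'a \<Rightarrow> 'a set"
  assumes regular: "regular_inclusion C D"
    and basis: "\<And>x. x \<in> X \<Longrightarrow> eigenbasis C (\<rho> x) D (R x)"
begin

lemma inc: "cstar_inclusion C D"
  and reg: "ctopology C closure_of (cspan C (normalizers C D)) = carrier C"
  using regular by (auto simp: regular_inclusion_def)

sublocale cstar_algebra C
  by (rule inclusion_facts[OF inc])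

lemma normalizers_closed: "normalizers C D \<subseteq> carrier C"
  by (auto simp: normalizers_def)

definition index :: "('a \<times> 'a) set" where "index = Sigma X R"

text \<open>The matrix is block diagonal, with one block per \<open>x\<close> in \<open>X\<close>.
  Padding by zero outside \<open>index\<close> makes it act on all families over
  \<open>'a \<times> 'a\<close>, so the unit of \<open>C\<close> becomes the projection onto
  \<open>index\<close>.\<close>

definition mat :: "'a \<Rightarrow> 'a \<times> 'a \<Rightarrow> 'a \<times> 'a \<Rightarrow> complex" where
  "mat c i j = (if i \<in> index \<and> j \<in> index \<and> fst i = fst j
     then eigenbasis.coeff C (\<rho> (fst j)) c (snd i) (snd j) else 0)"

lemma mat_row_bound:
  assumes c: "c \<in> carrier C" and B: "finite B"
  shows "(\<Sum>w\<in>B. (cmod (\<Sum>v\<in>B. mat c (x, w) (x, v) * f v))\<^sup>2) \<le> (nrm C c)\<^sup>2 * (\<Sum>v\<in>B. (cmod (f v))\<^sup>2)"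
proof (cases "x \<in> X")
  case False
  then show ?thesis by (simp add: mat_def index_def sum_nonneg)
next
  case True
  interpret e: eigenbasis C "\<rho> x" D "R x" by (rule basis[OF True])
  have "(\<Sum>v\<in>B. mat c (x, w) (x, v) * f v) = (if w \<in> R x then (\<Sum>v\<in>B \<inter> R x. e.coeff c w v * f v) else 0)" for w
  proof (cases "w \<in> R x")
    case w: True
    have "(\<Sum>v\<in>B. mat c (x, w) (x, v) * f v) = (\<Sum>v\<in>B. if v \<in> R x then e.coeff c w v * f v else 0)"
      using True w by (intro sum.cong) (auto simp: mat_def index_def)
    then show ?thesis using w B by (simp add: sum.inter_restrict)
  qed (simp add: mat_def index_def)
  then have "(\<Sum>w\<in>B. (cmod (\<Sum>v\<in>B. mat c (x, w) (x, v) * f v))\<^sup>2)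
      = (\<Sum>w\<in>B. if w \<in> R x then (cmod (\<Sum>v\<in>B \<inter> R x. e.coeff c w v * f v))\<^sup>2 else 0)"
    by (intro sum.cong) auto
  also have "\<dots> = (\<Sum>w\<in>B \<inter> R x. (cmod (\<Sum>v\<in>B \<inter> R x. e.coeff c w v * f v))\<^sup>2)"
    by (rule sum.inter_restrict[OF B, symmetric])
  also have "\<dots> \<le> (nrm C c)\<^sup>2 * (\<Sum>v\<in>B \<inter> R x. (cmod (f v))\<^sup>2)"
    using B c by (intro e.coeff_bound) auto
  also have "\<dots> \<le> (nrm C c)\<^sup>2 * (\<Sum>v\<in>B. (cmod (f v))\<^sup>2)"
    using B by (intro mult_left_mono sum_mono2) auto
  finally show ?thesis .
qed

lemma mat_bounded: assumes c: "c \<in> carrier C" shows "bounded_matrix (mat c) (nrm C c)"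
  unfolding bounded_matrix_def
proof (intro allI impI, elim conjE)
  fix F G :: "('a \<times> 'a) set" and f :: "'a \<times> 'a \<Rightarrow> complex"
  assume F: "finite F" and G: "finite G"
  \<comment> \<open>\<open>F\<close> and \<open>G\<close> are enlarged to a common rectangle, so
    that sums split into blocks indexed by the first coordinate; \<open>f\<close> is extended by
    zero.\<close>
  define A B where "A = fst ` F \<union> fst ` G" and "B = snd ` F \<union> snd ` G"
  have AB: "finite A" "finite B" "F \<subseteq> A \<times> B" "G \<subseteq> A \<times> B"
    using F G by (auto simp: A_def B_def image_iff) (force+)
  define g where "g j = (if j \<in> F then f j else 0)" for j
  have 1: "(\<Sum>j\<in>F. mat c i j * f j) = (\<Sum>v\<in>B. mat c i (fst i, v) * g (fst i, v))" if "i \<in> A \<times> B" for i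
  proof -
    have "(\<Sum>j\<in>F. mat c i j * f j) = (\<Sum>j\<in>A \<times> B. mat c i j * g j)"
      using AB by (intro sum.mono_neutral_cong_left) (auto simp: g_def)
    also have "\<dots> = (\<Sum>x\<in>A. \<Sum>v\<in>B. mat c i (x, v) * g (x, v))" by (simp add: sum.cartesian_product)
    also have "\<dots> = (\<Sum>x\<in>A. if x = fst i then (\<Sum>v\<in>B. mat c i (fst i, v) * g (fst i, v)) else 0)"
      by (intro sum.cong) (auto simp: mat_def)
    also have "\<dots> = (\<Sum>v\<in>B. mat c i (fst i, v) * g (fst i, v))" using that AB by (auto simp: sum.delta)
    finally show ?thesis .
  qed
  have "(\<Sum>i\<in>G. (cmod (\<Sum>j\<in>F. mat c i j * f j))\<^sup>2) \<le> (\<Sum>i\<in>A \<times> B. (cmod (\<Sum>j\<in>F. mat c i j * f j))\<^sup>2)"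
    using AB by (intro sum_mono2) auto
  also have "\<dots> = (\<Sum>i\<in>A \<times> B. (cmod (\<Sum>v\<in>B. mat c i (fst i, v) * g (fst i, v)))\<^sup>2)"
    by (intro sum.cong) (auto simp: 1)
  also have "\<dots> = (\<Sum>x\<in>A. \<Sum>w\<in>B. (cmod (\<Sum>v\<in>B. mat c (x, w) (x, v) * g (x, v)))\<^sup>2)"
    by (simp add: sum.cartesian_product case_prod_unfold)
  also have "\<dots> \<le> (\<Sum>x\<in>A. (nrm C c)\<^sup>2 * (\<Sum>v\<in>B. (cmod (g (x, v)))\<^sup>2))"
    using AB by (intro sum_mono mat_row_bound c)
  also have "\<dots> = (nrm C c)\<^sup>2 * (\<Sum>j\<in>A \<times> B. (cmod (g j))\<^sup>2)"
    by (simp add: sum_distrib_left sum.cartesian_product case_prod_unfold)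
  also have "(\<Sum>j\<in>A \<times> B. (cmod (g j))\<^sup>2) = (\<Sum>j\<in>F. (cmod (f j))\<^sup>2)"
    using AB by (intro sum.mono_neutral_cong_right) (auto simp: g_def)
  finally show "(\<Sum>i\<in>G. (cmod (\<Sum>j\<in>F. mat c i j * f j))\<^sup>2) \<le> (nrm C c)\<^sup>2 * (\<Sum>j\<in>F. (cmod (f j))\<^sup>2)" .
qed

lemma mat_star: assumes c: "c \<in> carrier C" shows "cnj (mat c j i) = mat (c\<^sup>\<star>) i j"
proof (cases "i \<in> index \<and> j \<in> index \<and> fst i = fst j")
  case True
  then interpret e: eigenbasis C "\<rho> (fst j)" D "R (fst j)" by (intro basis) (auto simp: index_def)
  show ?thesis using True c e.coeff_star[of c "snd j" "snd i"] by (auto simp: mat_def index_def)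
qed (auto simp: mat_def)

section \<open>The representation and its multiplicativity\<close>

definition rep :: "'a \<Rightarrow> ('a \<times> 'a) op" where
  "rep c = (THE T. T \<in> bops \<and> (\<forall>i j. ent T i j = mat c i j))"

lemma rep: assumes c: "c \<in> carrier C" shows "rep c \<in> bops" "norm (rep c) \<le> nrm C c" "ent (rep c) i j = mat c i j"
proof -
  have m': "bounded_matrix (\<lambda>i j. cnj (mat c j i)) (nrm C c)"
    using mat_bounded[of "c\<^sup>\<star>"] c by (simp add: mat_star)
  obtain T where T: "T \<in> bops" "norm T \<le> nrm C c" "\<And>i j. ent T i j = mat c i j"
    using matrix_bops[OF mat_bounded[OF c] m' nrm_nonneg[OF c]] by blast
  have "rep c = T" unfolding rep_def using T by (intro the_equality bops_eqI) auto
  then show "rep c \<in> bops" "norm (rep c) \<le> nrm C c" "ent (rep c) i j = mat c i j" using T by auto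
qed

lemma mat_linear:
  assumes "c \<in> carrier C" "d \<in> carrier C"
  shows "mat (c \<oplus> d) i j = mat c i j + mat d i j" "mat (a \<odot> c) i j = a * mat c i j"
proof -
  have "mat (c \<oplus> d) i j = mat c i j + mat d i j \<and> mat (a \<odot> c) i j = a * mat c i j"
  proof (cases "i \<in> index \<and> j \<in> index \<and> fst i = fst j")
    case True
    then interpret e: eigenbasis C "\<rho> (fst j)" D "R (fst j)" by (intro basis) (auto simp: index_def)
    show ?thesis using True assms e.coeff_linear[of c d "snd i" "snd j"] by (auto simp: mat_def index_def)
  qed (auto simp: mat_def)
  then show "mat (c \<oplus> d) i j = mat c i j + mat d i j" "mat (a \<odot> c) i j = a * mat c i j" by auto
qed

lemma rep_add: "\<lbrakk>c \<in> carrier C; d \<in> carrier C\<rbrakk> \<Longrightarrow> rep (c \<oplus> d) = rep c + rep d"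
  by (intro bops_eqI bops_closed rep) (auto simp: rep ent_simps mat_linear)

lemma rep_smult: "c \<in> carrier C \<Longrightarrow> rep (a \<odot> c) = mulC a o\<^sub>L rep c"
  by (intro bops_eqI bops_closed mulC_in_bops rep) (auto simp: rep ent_simps mat_linear)

lemma rep_star: "c \<in> carrier C \<Longrightarrow> rep (c\<^sup>\<star>) = adj (rep c)"
  by (intro bops_eqI adj_in_bops rep) (auto simp: rep ent_adj mat_star)

lemma rep_minus: "\<lbrakk>c \<in> carrier C; d \<in> carrier C\<rbrakk> \<Longrightarrow> rep (c \<ominus> d) = rep c - rep d"
  using scaleR_eq_mulC[of "-1" "rep d"] by (simp add: minus_eq_smult rep_add rep_smult)

lemma rep_zero: "rep \<zero> = 0"
  using rep_minus[of "\<zero>" "\<zero>"] by (simp add: minus_eq)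

lemma mat_normalizer:
  assumes u: "u \<in> normalizers C D"
  shows "\<exists>k. (\<forall>i. i \<noteq> k \<longrightarrow> mat u i j = 0) \<and> (\<forall>c\<in>carrier C. \<forall>i. mat (c \<otimes> u) i j = mat c i k * mat u k j)"
proof (cases "j \<in> index")
  case False
  then show ?thesis by (simp add: mat_def)
next
  case True
  then obtain x v where j: "j = (x, v)" "x \<in> X" "v \<in> R x" by (auto simp: index_def)
  interpret e: eigenbasis C "\<rho> x" D "R x" by (rule basis[OF j(2)])
  obtain w0 where w0: "\<And>w. w \<in> R x \<Longrightarrow> w \<noteq> w0 \<Longrightarrow> e.coeff u w v = 0"
    "\<And>c w. c \<in> carrier C \<Longrightarrow> w \<in> R x \<Longrightarrow> e.coeff (c \<otimes> u) w v = (if w0 \<in> R x then e.coeff c w w0 * e.coeff u w0 v else 0)"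
    using e.coeff_normalizer[OF u j(3)] by blast
  show ?thesis
    using w0 j by (intro exI[of _ "(x, w0)"]) (auto simp: mat_def index_def)
qed

lemma rep_normalizer: assumes u: "u \<in> normalizers C D" shows "rep u \<in> monomial_ops"
proof -
  have uc: "u \<in> carrier C" "u\<^sup>\<star> \<in> normalizers C D" "u\<^sup>\<star> \<in> carrier C" using u by (auto simp: normalizers_def)
  have col: "i = i'" if "mat u' i j \<noteq> 0" "mat u' i' j \<noteq> 0" "u' \<in> normalizers C D" for i i' j u'
    using mat_normalizer[OF that(3), of j] that(1,2) by metis
  have row: "j = j'" if nz: "mat u i j \<noteq> 0" "mat u i j' \<noteq> 0" for i j j'
  proof -
    \<comment> \<open>Rows of \<open>u\<close> are conjugated columns of its adjoint, which is a
      normalizer too.\<close>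
    have "mat (u\<^sup>\<star>) j i \<noteq> 0" "mat (u\<^sup>\<star>) j' i \<noteq> 0" using nz by (simp_all flip: mat_star[OF uc(1)])
    then show ?thesis using col uc by blast
  qed
  show ?thesis unfolding monomial_ops_def using rep[OF uc(1)] col[OF _ _ u] row by auto
qed

text \<open>A column of a normalizer has at most one nonzero entry, so the matrix product reduces to
  one term and can be compared entry by entry.\<close>

lemma rep_mult_normalizer:
  assumes c: "c \<in> carrier C" and u: "u \<in> normalizers C D"
  shows "rep (c \<otimes> u) = rep c o\<^sub>L rep u"
proof -
  have uc: "u \<in> carrier C" using u normalizers_closed by blast
  show ?thesis
  proof (intro bops_eqI bops_closed rep c uc m_closed)
    fix i j
    obtain k where k: "\<And>i. i \<noteq> k \<Longrightarrow> mat u i j = 0" "\<And>i. mat (c \<otimes> u) i j = mat c i k * mat u k j"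
      using mat_normalizer[OF u, of j] c by blast
    have "ent (rep c o\<^sub>L rep u) i j = ent (rep c) i k * ent (rep u) k j"
      by (rule ent_compose) (use c uc k in \<open>auto simp: rep\<close>)
    then show "ent (rep (c \<otimes> u)) i j = ent (rep c o\<^sub>L rep u) i j" using c uc k by (simp add: rep)
  qed
qed

lemma dense: "\<lbrakk>c \<in> carrier C; e > 0\<rbrakk> \<Longrightarrow> \<exists>y\<in>cspan C (normalizers C D). nrm C (c \<ominus> y) < e"
  using in_closure_of_iff[OF cspan_subset[OF normalizers_closed], of c] unfolding reg by blast

lemma rep_mult:
  assumes c: "c \<in> carrier C" and d: "d \<in> carrier C"
  shows "rep (c \<otimes> d) = rep c o\<^sub>L rep d"
proof -
  have span: "rep (c \<otimes> y) = rep c o\<^sub>L rep y" if "y \<in> cspan C (normalizers C D)" for y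
    using that normalizers_closed
  proof (induction rule: cspan_induct)
    case zero
    then show ?case using c by (simp add: rep_zero)
  next
    case (add a v y)
    have v: "v \<in> carrier C" using add(1) normalizers_closed by blast
    have "rep (c \<otimes> (a \<odot> v \<oplus> y)) = (mulC a o\<^sub>L (rep c o\<^sub>L rep v)) + (rep c o\<^sub>L rep y)"
      using c v add by (simp add: r_distr smult_mult_right rep_add rep_smult rep_mult_normalizer)
    also have "\<dots> = rep c o\<^sub>L rep (a \<odot> v \<oplus> y)"
      using v add(2) rep(1)[OF c] by (simp add: rep_add rep_smult blinfun_compose_simps mulC_simps)
    finally show ?case .
  qed
  have "norm (rep (c \<otimes> d) - (rep c o\<^sub>L rep d)) \<le> e" if e: "e > 0" for e
  proof -
    \<comment> \<open>Two error terms arise, each at most \<open>nrm C c * nrm C z\<close>; the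
      summand 1 keeps the denominator positive.\<close>
    define e' where "e' = e / (2 * nrm C c + 1)"
    have p: "2 * nrm C c + 1 > 0" using nrm_nonneg[OF c] by simp
    obtain y where y: "y \<in> cspan C (normalizers C D)" "nrm C (d \<ominus> y) < e'"
      using dense[OF d, of e'] e p by (auto simp: e'_def)
    have yc: "y \<in> carrier C" using y cspan_subset[OF normalizers_closed] by blast
    define z where "z = d \<ominus> y"
    have z: "z \<in> carrier C" "d = z \<oplus> y" using d yc by (auto simp: z_def minus_eq a_assoc l_neg)
    have "rep (c \<otimes> d) - (rep c o\<^sub>L rep d) = rep (c \<otimes> z) - (rep c o\<^sub>L rep z)"
      using c z(1) yc span[OF y(1)] by (simp add: z(2) r_distr rep_add blinfun_compose_simps)
    also have "norm \<dots> \<le> norm (rep (c \<otimes> z)) + norm (rep c o\<^sub>L rep z)" by (rule norm_triangle_ineq4)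
    also have "\<dots> \<le> nrm C c * nrm C z + nrm C c * nrm C z"
    proof (rule add_mono)
      show "norm (rep (c \<otimes> z)) \<le> nrm C c * nrm C z"
        using rep(2)[of "c \<otimes> z"] nrm_mult[of c z] c z(1) by simp
      have "norm (rep c o\<^sub>L rep z) \<le> norm (rep c) * norm (rep z)" by (rule norm_blinfun_compose)
      also have "\<dots> \<le> nrm C c * nrm C z" using rep(2) c z(1) nrm_nonneg by (intro mult_mono) auto
      finally show "norm (rep c o\<^sub>L rep z) \<le> nrm C c * nrm C z" .
    qed
    also have "\<dots> \<le> (2 * nrm C c + 1) * nrm C z" using nrm_nonneg[OF z(1)] by (simp add: algebra_simps)
    also have "\<dots> \<le> (2 * nrm C c + 1) * e'" using y(2) p by (intro mult_left_mono) (auto simp: z_def)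
    also have "\<dots> = e" using p by (simp add: e'_def)
    finally show ?thesis .
  qed
  then have "norm (rep (c \<otimes> d) - (rep c o\<^sub>L rep d)) \<le> 0" by (rule field_le_epsilon) simp
  then show ?thesis by simp
qed

lemma rep_in_alg: assumes c: "c \<in> carrier C" shows "rep c \<in> monomial_alg"
proof -
  have span: "rep y \<in> monomial_alg" if "y \<in> cspan C (normalizers C D)" for y
    using that normalizers_closed
  proof (induction rule: cspan_induct)
    case zero
    then show ?case by (simp add: rep_zero monomial_alg_zero)
  next
    case (add a v y)
    have v: "v \<in> carrier C" using add(1) normalizers_closed by blast
    have "rep v \<in> monomial_alg" using rep_normalizer[OF add(1)] monomial_subset_alg by blast
    then show ?case using v add
      by (simp add: rep_add rep_smult monomial_alg_add monomial_alg_compose mulC_in_alg)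
  qed
  have "rep c \<in> closure monomial_alg"
    unfolding closure_approachable
  proof (intro allI impI)
    fix e :: real assume "e > 0"
    then obtain y where y: "y \<in> cspan C (normalizers C D)" "nrm C (c \<ominus> y) < e" using dense[OF c] by blast
    have yc: "y \<in> carrier C" using y cspan_subset[OF normalizers_closed] by blast
    have "dist (rep y) (rep c) = norm (rep (c \<ominus> y))"
      using c yc by (simp add: rep_minus dist_norm norm_minus_commute)
    also have "\<dots> < e" using rep(2)[of "c \<ominus> y"] y(2) c yc by simp
    finally show "\<exists>y\<in>monomial_alg. dist y (rep c) < e" using span[OF y(1)] by blast
  qed
  then show ?thesis by (simp add: closed_monomial_alg)
qed

lemma regular_hom_rep: "regular_star_hom C D monomial_cstar diag_sub (\<lambda>c. enc (rep c))"
  unfolding regular_star_hom_def star_hom_def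
  using rep_in_alg rep_normalizer monomial_normalizers
  by (auto simp: rep_add rep_mult rep_star rep_smult)

end

text \<open>The existential ranges over one sufficiently large type. The free type \<open>'b\<close>
  in the second conjunct shows that the choice of that type does not matter for the direction in
  which the diagonal is given.\<close>

theorem theorem5p9:
  fixes C :: "'a cstar" and D :: "'a set"
  assumes "regular_inclusion C D"
  shows "((\<exists>(C1 :: 'a universe cstar) D1 \<alpha>.
             cstar_diagonal C1 D1 \<and> regular_star_mono C D C1 D1 \<alpha>)
            \<longleftrightarrow> Rad C D = {\<zero>\<^bsub>C\<^esub>}) \<and>
         ((\<exists>(C1 :: 'b cstar) D1 \<alpha>.
             cstar_diagonal C1 D1 \<and> regular_star_mono C D C1 D1 \<alpha>)
            \<longrightarrow> Rad C D = {\<zero>\<^bsub>C\<^esub>})"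
proof -
  have inc: "cstar_inclusion C D" and reg: "ctopology C closure_of (cspan C (normalizers C D)) = carrier C"
    using assms by (auto simp: regular_inclusion_def)
  interpret C: cstar_algebra C by (rule inclusion_facts[OF inc])
  have "\<exists>(C1 :: 'a universe cstar) D1 \<alpha>. cstar_diagonal C1 D1 \<and> regular_star_mono C D C1 D1 \<alpha>"
    if rad: "Rad C D = {\<zero>\<^bsub>C\<^esub>}"
  proof -
    \<comment> \<open>The nonzero elements label the summands: the block of \<open>x\<close> is
      responsible for not annihilating \<open>x\<close>.\<close>
    define X where "X = carrier C - {\<zero>\<^bsub>C\<^esub>}"
    have ex: "\<exists>p. eigenbasis C (fst p) D (snd p) \<and> (\<exists>w\<in>snd p. \<exists>v\<in>snd p. fst p (w\<^sup>\<star>\<^bsub>C\<^esub> \<otimes>\<^bsub>C\<^esub> x \<otimes>\<^bsub>C\<^esub> v) \<noteq> 0)" if x: "x \<in> X" for x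
    proof -
      have xc: "x \<in> carrier C" using x by (simp add: X_def)
      obtain \<rho> y where \<rho>: "\<rho> \<in> compatible_states C D" and y: "y \<in> carrier C"
        "\<rho> ((x \<otimes>\<^bsub>C\<^esub> y)\<^sup>\<star>\<^bsub>C\<^esub> \<otimes>\<^bsub>C\<^esub> (x \<otimes>\<^bsub>C\<^esub> y)) \<noteq> 0"
        using rad x unfolding Rad_eq_zero_iff[OF inc] X_def by blast
      interpret compatible_state C \<rho> D
        using \<rho> inc C.cstar_algebra_axioms by unfold_locales (auto simp: compatible_states_def)
      obtain v w where vw: "v \<in> N0" "w \<in> N0" "\<rho> (w\<^sup>\<star>\<^bsub>C\<^esub> \<otimes>\<^bsub>C\<^esub> x \<otimes>\<^bsub>C\<^esub> v) \<noteq> 0"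
        using ex_nonzero_coefficient[OF reg xc y] by blast
      obtain R where R: "R \<subseteq> N0" "\<And>v. v \<in> N0 \<Longrightarrow> \<exists>r\<in>R. \<rho> (r\<^sup>\<star>\<^bsub>C\<^esub> \<otimes>\<^bsub>C\<^esub> v) \<noteq> 0"
        "\<And>r r'. r \<in> R \<Longrightarrow> r' \<in> R \<Longrightarrow> r \<noteq> r' \<Longrightarrow> \<rho> (r\<^sup>\<star>\<^bsub>C\<^esub> \<otimes>\<^bsub>C\<^esub> r') = 0"
        using ex_representatives by metis
      have eb: "eigenbasis C \<rho> D R" using R by unfold_locales
      have c: "u \<in> carrier C" "u \<in> normalizers C D" if "u \<in> N0" for u
        using that by (auto simp: N0_def normalizers_def)
      \<comment> \<open>\<open>v\<close> and \<open>w\<close> are replaced by basis elements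
        parallel to them, first on the right and then, through conjugation, on the left;
        \<open>parallel\<close> shows that the coefficient stays nonzero.\<close>
      obtain r s where r: "r \<in> R" "\<rho> (r\<^sup>\<star>\<^bsub>C\<^esub> \<otimes>\<^bsub>C\<^esub> v) \<noteq> 0" and s: "s \<in> R" "\<rho> (s\<^sup>\<star>\<^bsub>C\<^esub> \<otimes>\<^bsub>C\<^esub> w) \<noteq> 0"
        using R(2) vw by blast
      have rs: "r \<in> N0" "s \<in> N0" using r s R(1) by auto
      have nzr: "\<rho> (r\<^sup>\<star>\<^bsub>C\<^esub> \<otimes>\<^bsub>C\<^esub> r) \<noteq> 0" "\<rho> (s\<^sup>\<star>\<^bsub>C\<^esub> \<otimes>\<^bsub>C\<^esub> s) \<noteq> 0" using rs by (auto simp: N0_def)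
      have 1: "\<rho> (w\<^sup>\<star>\<^bsub>C\<^esub> \<otimes>\<^bsub>C\<^esub> x \<otimes>\<^bsub>C\<^esub> r) \<noteq> 0"
        using parallel[of v r "w\<^sup>\<star>\<^bsub>C\<^esub> \<otimes>\<^bsub>C\<^esub> x"] vw r rs c xc nzr by auto
      have "\<rho> ((x \<otimes>\<^bsub>C\<^esub> r)\<^sup>\<star>\<^bsub>C\<^esub> \<otimes>\<^bsub>C\<^esub> w) \<noteq> 0"
        using 1 rho_cnj_zero[of w "x \<otimes>\<^bsub>C\<^esub> r"] c[OF vw(2)] c[OF rs(1)] xc by (simp add: C.m_assoc)
      then have "\<rho> ((x \<otimes>\<^bsub>C\<^esub> r)\<^sup>\<star>\<^bsub>C\<^esub> \<otimes>\<^bsub>C\<^esub> s) \<noteq> 0"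
        using parallel[of w s "(x \<otimes>\<^bsub>C\<^esub> r)\<^sup>\<star>\<^bsub>C\<^esub>"] vw s rs c xc nzr by auto
      then have "\<rho> (s\<^sup>\<star>\<^bsub>C\<^esub> \<otimes>\<^bsub>C\<^esub> x \<otimes>\<^bsub>C\<^esub> r) \<noteq> 0"
        using rho_cnj_zero[of s "x \<otimes>\<^bsub>C\<^esub> r"] c[OF rs(1)] c[OF rs(2)] xc by (simp add: C.m_assoc)
      then show ?thesis using eb r(1) s(1) by (intro exI[of _ "(\<rho>, R)"]) auto
    qed
    obtain p where p: "\<forall>x\<in>X. eigenbasis C (fst (p x)) D (snd (p x)) \<and>
        (\<exists>w\<in>snd (p x). \<exists>v\<in>snd (p x). fst (p x) (w\<^sup>\<star>\<^bsub>C\<^esub> \<otimes>\<^bsub>C\<^esub> x \<otimes>\<^bsub>C\<^esub> v) \<noteq> 0)"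
      using bchoice[OF ballI[OF ex]] by (rule exE)
    define \<rho> R where "\<rho> x = fst (p x)" and "R x = snd (p x)" for x
    have eb: "eigenbasis C (\<rho> x) D (R x)" if "x \<in> X" for x
      unfolding \<rho>_def R_def by (rule conjunct1[OF bspec[OF p that]])
    have nz: "\<exists>w\<in>R x. \<exists>v\<in>R x. \<rho> x (w\<^sup>\<star>\<^bsub>C\<^esub> \<otimes>\<^bsub>C\<^esub> x \<otimes>\<^bsub>C\<^esub> v) \<noteq> 0" if "x \<in> X" for x
      unfolding \<rho>_def R_def by (rule conjunct2[OF bspec[OF p that]])
    interpret eigenbasis_family C D X \<rho> R by (rule eigenbasis_family.intro[OF assms eb])
    have "rep x \<noteq> 0" if x: "x \<in> X" for x
    proof -
      have xc: "x \<in> carrier C" using x by (simp add: X_def)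
      obtain w v where wv: "w \<in> R x" "v \<in> R x" "\<rho> x (w\<^sup>\<star>\<^bsub>C\<^esub> \<otimes>\<^bsub>C\<^esub> x \<otimes>\<^bsub>C\<^esub> v) \<noteq> 0" using nz[OF x] by blast
      interpret e: eigenbasis C "\<rho> x" D "R x" by (rule eb[OF x])
      \<comment> \<open>In the block of \<open>x\<close> itself the state was chosen so that
        \<open>x\<close> has a nonzero coefficient between two basis vectors.\<close>
      have "ent (rep x) (x, w) (x, v) \<noteq> 0"
        using rep(3)[OF xc, of "(x, w)" "(x, v)"] wv x e.snorm_pos[OF wv(1)] e.snorm_pos[OF wv(2)]
        by (simp add: mat_def index_def e.coeff_def)
      then show ?thesis using ent_simps(4) by metis
    qed
    then have ker: "x = \<zero>\<^bsub>C\<^esub>" if "x \<in> carrier C" "rep x = 0" for x using that by (auto simp: X_def)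
    have "inj_on (\<lambda>c. enc (rep c)) (carrier C)"
    proof (rule inj_onI)
      fix x y assume xy: "x \<in> carrier C" "y \<in> carrier C" "enc (rep x) = enc (rep y)"
      then have "rep (x \<ominus>\<^bsub>C\<^esub> y) = 0" by (simp add: rep_minus)
      then have "nrm C (x \<ominus>\<^bsub>C\<^esub> y) = 0" using ker[of "x \<ominus>\<^bsub>C\<^esub> y"] xy by simp
      then show "x = y" using Metric_space.zero[OF C.Metric_space_cdist, of x y] xy by (simp add: cdist_def)
    qed
    then have "regular_star_mono C D monomial_cstar diag_sub (\<lambda>c. enc (rep c))"
      using regular_hom_rep by (simp add: regular_star_mono_def)
    then show ?thesis using cstar_diagonal_monomial by blast
  qed
  moreover have "Rad C D = {\<zero>\<^bsub>C\<^esub>}"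
    if "\<exists>(C1 :: 'a universe cstar) D1 \<alpha>. cstar_diagonal C1 D1 \<and> regular_star_mono C D C1 D1 \<alpha>"
    using that Rad_eq_zero_of_embedding[OF inc] by blast
  moreover have "Rad C D = {\<zero>\<^bsub>C\<^esub>}"
    if "\<exists>(C1 :: 'b cstar) D1 \<alpha>. cstar_diagonal C1 D1 \<and> regular_star_mono C D C1 D1 \<alpha>"
    using that Rad_eq_zero_of_embedding[OF inc] by blast
  ultimately show ?thesis by blast
qed

end
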